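(* Let $\mathcal{C}$ be an extensive category with finite limits in which every object $X$ has a parametrized list object $L(X)$. Then the list object functor $L : \mathcal{C} \rightarrow \mathcal{C}$ is represented by the polynomial $$\mathbf{1} \longleftarrow E \xrightarrow{\ \pi_2^E\ } N \longrightarrow \mathbf{1}.$$ That is, the dependent product functor $\Pi_{\pi_2^E} : \mathcal{C}/E \to \mathcal{C}/N$ (right adjoint of the pullback functor $\Delta_{\pi_2^E}$) exists, and $L \cong \Sigma_N \circ \Pi_{\pi_2^E} \circ \Delta_E$.
   Context: Extensive categories are assumed to have finite coproducts. $\mathbf{1}$ is the terminal object. Equations with variables denote equations of arrows (e.g. $f(x,g(y))=_{x,y}k(x,y)$ means $f\circ(\mathrm{Id}\times g)=k$). Parametrized list object: a parametrized list object on $X$ is $(L(X), r_0^X:\mathbf{1}\to L(X), r_1^X:X\times L(X)\to L(X))$ such that for all objects $A,B$ and arrows $g:A\to B$, $h:X\times B\to B$ there is a unique arrow $f:A\times L(X)\to B$ with $f(a,\varnothing)=_a g(a)$ and $f(a,x::\ell)=_{a,x,\ell}h(x,f(a,\ell))$. Here $\varnothing$ denotes $r_0^X$ and $x::\ell$ denotes $r_1^X(x,\ell)$. The list object functor sends $X$ to $L(X)$ and $f:X\to Y$ to $L(f):L(X)\to L(Y)$ defined by $L(f)(\varnothing)=\varnothing$, $L(f)(x::\ell)=_{x,\ell}f(x)::L(f)(\ell)$. $N=L(\mathbf{1})$ with $0=r_0^{\mathbf 1}:\mathbf{1}\to N$ and $s:N\to N$ given by $r_1^{\mathbf 1}$ (via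 $\mathbf{1}\times N\cong N$); it is a parametrized natural numbers object: for all $g:A\to B$, $h:A\times N\times B\to B$ there is a unique $f:A\times N\to B$ with $f(a,0)=_a g(a)$, $f(a,sn)=_{a,n}h(a,n,f(a,n))$. Predecessor $P:N\to N$: $P(0)=0$, $P(sn)=_n n$. Truncated subtraction $\dot{-}:N\times N\to N$: $x\mathbin{\dot{-}}0=_x x$, $x\mathbin{\dot{-}}sy=_{x,y}P(x\mathbin{\dot{-}}y)$. $E=\{m:N,\,n:N\mid m<n\}$ is the equalizer of the two arrows $N\times N\to N$ given by $(m,n)\mapsto s(m)\mathbin{\dot{-}}n$ and $(m,n)\mapsto 0$, and $\pi_2^E:E\to N$ is $(m,n)\mapsto n$. For $f:A\to B$, $\Sigma_f:\mathcal{C}/A\to\mathcal{C}/B$ is composition with $f$, $\Delta_f:\mathcal{C}/B\to\mathcal{C}/A$ is its right adjoint (pullback along $f$), and $\Pi_f:\mathcal{C}/A\to\mathcal{C}/B$ is the right adjoint of $\Delta_f$, if it exists. $\Sigma_A:\mathcal{C}/A\to\mathcal{C}$ and $\Delta_A:\mathcal{C}\to\mathcal{C}/A$ are the case $A\to\mathbf{1}$ (with $\mathcal{C}/\mathbf{1}$ identified with $\mathcal{C}$). A polynomial $I\xleftarrow{s}A\xrightarrow{f}B\xrightarrow{t}J$ represents a functor $F:\mathcal{C}/I\to\mathcal{C}/J$ if $\Pi_f$ exists and $F\cong\Sigma_t\circ\Pi_f\circ\Delta_s$. *)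

theory Defs
  imports Main
begin

section \<open>Categories, functors, adjunctions\<close>

record ('o, 'a) category =
  Obj :: "'o set"
  Arr :: "'a set"
  Dom :: "'a \<Rightarrow> 'o"
  Cod :: "'a \<Rightarrow> 'o"
  Id :: "'o \<Rightarrow> 'a"
  Comp :: "'a \<Rightarrow> 'a \<Rightarrow> 'a" (infixl "\<cdot>\<index>" 70)

definition Hom :: "('o, 'a, 'm) category_scheme \<Rightarrow> 'o \<Rightarrow> 'o \<Rightarrow> 'a set" where
  "Hom C X Y = {f \<in> Arr C. Dom C f = X \<and> Cod C f = Y}"

locale category =
  fixes C :: "('o, 'a, 'm) category_scheme" (structure)
  assumes Dom_Obj: "f \<in> Arr C \<Longrightarrow> Dom C f \<in> Obj C"
    and Cod_Obj: "f \<in> Arr C \<Longrightarrow> Cod C f \<in> Obj C"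
    and Id_Hom: "X \<in> Obj C \<Longrightarrow> Id C X \<in> Hom C X X"
    and Comp_Hom: "f \<in> Hom C X Y \<Longrightarrow> g \<in> Hom C Y Z \<Longrightarrow> g \<cdot> f \<in> Hom C X Z"
    and Comp_Id: "f \<in> Hom C X Y \<Longrightarrow> f \<cdot> Id C X = f"
    and Id_Comp: "f \<in> Hom C X Y \<Longrightarrow> Id C Y \<cdot> f = f"
    and Comp_assoc: "f \<in> Hom C W X \<Longrightarrow> g \<in> Hom C X Y \<Longrightarrow> h \<in> Hom C Y Z
      \<Longrightarrow> (h \<cdot> g) \<cdot> f = h \<cdot> (g \<cdot> f)"

definition is_iso :: "('o, 'a, 'm) category_scheme \<Rightarrow> 'a \<Rightarrow> bool" where
  "is_iso C f \<longleftrightarrow> f \<in> Arr C \<and>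
     (\<exists>g \<in> Hom C (Cod C f) (Dom C f).
        g \<cdot>\<^bsub>C\<^esub> f = Id C (Dom C f) \<and> f \<cdot>\<^bsub>C\<^esub> g = Id C (Cod C f))"

record ('o, 'a, 'p, 'b) functor_data =
  Omap :: "'o \<Rightarrow> 'p"
  Amap :: "'a \<Rightarrow> 'b"

definition is_functor ::
  "('o, 'a, 'm) category_scheme \<Rightarrow> ('p, 'b, 'n) category_scheme
    \<Rightarrow> ('o, 'a, 'p, 'b) functor_data \<Rightarrow> bool" where
  "is_functor C D F \<longleftrightarrow> category C \<and> category D \<and>
     (\<forall>X \<in> Obj C. Omap F X \<in> Obj D \<and> Amap F (Id C X) = Id D (Omap F X)) \<and>
     (\<forall>f \<in> Arr C. Amap F f \<in> Hom D (Omap F (Dom C f)) (Omap F (Cod C f))) \<and>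
     (\<forall>f \<in> Arr C. \<forall>g \<in> Arr C. Dom C g = Cod C f \<longrightarrow>
        Amap F (g \<cdot>\<^bsub>C\<^esub> f) = Amap F g \<cdot>\<^bsub>D\<^esub> Amap F f)"

definition comp_functor ::
  "('p, 'b, 'q, 'c) functor_data \<Rightarrow> ('o, 'a, 'p, 'b) functor_data
    \<Rightarrow> ('o, 'a, 'q, 'c) functor_data" (infixl "\<circ>\<^sub>F" 55) where
  "G \<circ>\<^sub>F F = \<lparr>Omap = Omap G \<circ> Omap F, Amap = Amap G \<circ> Amap F\<rparr>"

definition naturally_isomorphic ::
  "('o, 'a, 'm) category_scheme \<Rightarrow> ('p, 'b, 'n) category_scheme
    \<Rightarrow> ('o, 'a, 'p, 'b) functor_data \<Rightarrow> ('o, 'a, 'p, 'b) functor_data \<Rightarrow> bool" where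
  "naturally_isomorphic C D F G \<longleftrightarrow> is_functor C D F \<and> is_functor C D G \<and>
     (\<exists>\<eta>. (\<forall>X \<in> Obj C. \<eta> X \<in> Hom D (Omap F X) (Omap G X) \<and> is_iso D (\<eta> X)) \<and>
          (\<forall>f \<in> Arr C. \<eta> (Cod C f) \<cdot>\<^bsub>D\<^esub> Amap F f = Amap G f \<cdot>\<^bsub>D\<^esub> \<eta> (Dom C f)))"

text \<open>\<open>adjunction C D F G\<close>: the functor \<open>G : D \<rightarrow> C\<close> is right adjoint to \<open>F : C \<rightarrow> D\<close>,
  i.e. there are bijections \<open>D(F X, Y) \<cong> C(X, G Y)\<close> natural in \<open>X\<close> and \<open>Y\<close>.\<close>

definition adjunction ::
  "('o, 'a, 'm) category_scheme \<Rightarrow> ('p, 'b, 'n) category_scheme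
    \<Rightarrow> ('o, 'a, 'p, 'b) functor_data \<Rightarrow> ('p, 'b, 'o, 'a) functor_data \<Rightarrow> bool" where
  "adjunction C D F G \<longleftrightarrow> is_functor C D F \<and> is_functor D C G \<and>
     (\<exists>\<phi>. (\<forall>X \<in> Obj C. \<forall>Y \<in> Obj D.
             bij_betw (\<phi> X Y) (Hom D (Omap F X) Y) (Hom C X (Omap G Y))) \<and>
          (\<forall>X \<in> Obj C. \<forall>X' \<in> Obj C. \<forall>Y \<in> Obj D. \<forall>Y' \<in> Obj D.
             \<forall>u \<in> Hom C X' X. \<forall>v \<in> Hom D Y Y'. \<forall>k \<in> Hom D (Omap F X) Y.
               \<phi> X' Y' (v \<cdot>\<^bsub>D\<^esub> k \<cdot>\<^bsub>D\<^esub> Amap F u) = Amap G v \<cdot>\<^bsub>C\<^esub> \<phi> X Y k \<cdot>\<^bsub>C\<^esub> u))"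


section \<open>Limits, colimits, extensivity\<close>

definition is_terminal :: "('o, 'a, 'm) category_scheme \<Rightarrow> 'o \<Rightarrow> bool" where
  "is_terminal C T \<longleftrightarrow> T \<in> Obj C \<and> (\<forall>X \<in> Obj C. \<exists>!f. f \<in> Hom C X T)"

definition is_initial :: "('o, 'a, 'm) category_scheme \<Rightarrow> 'o \<Rightarrow> bool" where
  "is_initial C Z \<longleftrightarrow> Z \<in> Obj C \<and> (\<forall>X \<in> Obj C. \<exists>!f. f \<in> Hom C Z X)"

definition is_product ::
  "('o, 'a, 'm) category_scheme \<Rightarrow> 'o \<Rightarrow> 'o \<Rightarrow> 'o \<Rightarrow> 'a \<Rightarrow> 'a \<Rightarrow> bool" where
  "is_product C A B P p q \<longleftrightarrow> p \<in> Hom C P A \<and> q \<in> Hom C P B \<and>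
     (\<forall>X \<in> Obj C. \<forall>f \<in> Hom C X A. \<forall>g \<in> Hom C X B.
        \<exists>!u. u \<in> Hom C X P \<and> p \<cdot>\<^bsub>C\<^esub> u = f \<and> q \<cdot>\<^bsub>C\<^esub> u = g)"

definition is_coproduct ::
  "('o, 'a, 'm) category_scheme \<Rightarrow> 'o \<Rightarrow> 'o \<Rightarrow> 'o \<Rightarrow> 'a \<Rightarrow> 'a \<Rightarrow> bool" where
  "is_coproduct C A B S i j \<longleftrightarrow> i \<in> Hom C A S \<and> j \<in> Hom C B S \<and>
     (\<forall>X \<in> Obj C. \<forall>f \<in> Hom C A X. \<forall>g \<in> Hom C B X.
        \<exists>!u. u \<in> Hom C S X \<and> u \<cdot>\<^bsub>C\<^esub> i = f \<and> u \<cdot>\<^bsub>C\<^esub> j = g)"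

definition is_equalizer ::
  "('o, 'a, 'm) category_scheme \<Rightarrow> 'a \<Rightarrow> 'a \<Rightarrow> 'o \<Rightarrow> 'a \<Rightarrow> bool" where
  "is_equalizer C f g E e \<longleftrightarrow> e \<in> Hom C E (Dom C f) \<and> f \<cdot>\<^bsub>C\<^esub> e = g \<cdot>\<^bsub>C\<^esub> e \<and>
     (\<forall>X \<in> Obj C. \<forall>k \<in> Hom C X (Dom C f). f \<cdot>\<^bsub>C\<^esub> k = g \<cdot>\<^bsub>C\<^esub> k \<longrightarrow>
        (\<exists>!u. u \<in> Hom C X E \<and> e \<cdot>\<^bsub>C\<^esub> u = k))"

definition is_pullback ::
  "('o, 'a, 'm) category_scheme \<Rightarrow> 'a \<Rightarrow> 'a \<Rightarrow> 'o \<Rightarrow> 'a \<Rightarrow> 'a \<Rightarrow> bool" where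
  "is_pullback C f g P p q \<longleftrightarrow>
     p \<in> Hom C P (Dom C f) \<and> q \<in> Hom C P (Dom C g) \<and> f \<cdot>\<^bsub>C\<^esub> p = g \<cdot>\<^bsub>C\<^esub> q \<and>
     (\<forall>X \<in> Obj C. \<forall>h \<in> Hom C X (Dom C f). \<forall>k \<in> Hom C X (Dom C g).
        f \<cdot>\<^bsub>C\<^esub> h = g \<cdot>\<^bsub>C\<^esub> k \<longrightarrow>
        (\<exists>!u. u \<in> Hom C X P \<and> p \<cdot>\<^bsub>C\<^esub> u = h \<and> q \<cdot>\<^bsub>C\<^esub> u = k))"

text \<open>Extensivity in the sense of Carboni, Lack and Walters: finite coproducts exist, pullbacks
  along coproduct injections exist, and for a commutative diagram
  \begin{verbatim}
      A' --i'--> S' <--j'-- B'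
      |a         |s         |b
      v          v          v
      A  --i-->  S  <--j--  B
  \end{verbatim}
  whose bottom row is a coproduct diagram, the top row is a coproduct diagram if and only if both
  squares are pullbacks.\<close>

locale extensive_category = category C
  for C :: "('o, 'a, 'm) category_scheme" (structure) +
  assumes ex_initial: "\<exists>Z. is_initial C Z"
    and ex_coproduct: "A \<in> Obj C \<Longrightarrow> B \<in> Obj C \<Longrightarrow> \<exists>S i j. is_coproduct C A B S i j"
    and ex_pullback_injection: "is_coproduct C A B S i j \<Longrightarrow> s \<in> Arr C \<Longrightarrow> Cod C s = S \<Longrightarrow>
      (\<exists>P p q. is_pullback C s i P p q) \<and> (\<exists>P p q. is_pullback C s j P p q)"
    and coproduct_iff_pullbacks: "is_coproduct C A B S i j \<Longrightarrow>
      a \<in> Hom C A' A \<Longrightarrow> b \<in> Hom C B' B \<Longrightarrow> s \<in> Hom C S' S \<Longrightarrow>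
      i' \<in> Hom C A' S' \<Longrightarrow> j' \<in> Hom C B' S' \<Longrightarrow>
      s \<cdot> i' = i \<cdot> a \<Longrightarrow> s \<cdot> j' = j \<cdot> b \<Longrightarrow>
      is_coproduct C A' B' S' i' j' \<longleftrightarrow> is_pullback C s i A' i' a \<and> is_pullback C s j B' j' b"

text \<open>Finite limits, with the terminal object and binary products carried as chosen structure
  (arbitrary choices) because list objects refer to them.\<close>

record ('o, 'a) cartesian_category = "('o, 'a) category" +
  One :: 'o
  Prod :: "'o \<Rightarrow> 'o \<Rightarrow> 'o"
  Fst :: "'o \<Rightarrow> 'o \<Rightarrow> 'a"
  Snd :: "'o \<Rightarrow> 'o \<Rightarrow> 'a"

locale finite_limit_category = category C
  for C :: "('o, 'a, 'm) cartesian_category_scheme" (structure) +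
  assumes One_terminal: "is_terminal C (One C)"
    and Prod_product: "A \<in> Obj C \<Longrightarrow> B \<in> Obj C \<Longrightarrow>
      is_product C A B (Prod C A B) (Fst C A B) (Snd C A B)"
    and ex_equalizer: "f \<in> Hom C A B \<Longrightarrow> g \<in> Hom C A B \<Longrightarrow> \<exists>E e. is_equalizer C f g E e"

definition bang :: "('o, 'a, 'm) cartesian_category_scheme \<Rightarrow> 'o \<Rightarrow> 'a" where
  "bang C X = (THE f. f \<in> Hom C X (One C))"

definition pair :: "('o, 'a, 'm) cartesian_category_scheme \<Rightarrow> 'a \<Rightarrow> 'a \<Rightarrow> 'a" where
  "pair C f g = (THE u. u \<in> Hom C (Dom C f) (Prod C (Cod C f) (Cod C g)) \<and>
     Fst C (Cod C f) (Cod C g) \<cdot>\<^bsub>C\<^esub> u = f \<and> Snd C (Cod C f) (Cod C g) \<cdot>\<^bsub>C\<^esub> u = g)"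

definition prod_arr :: "('o, 'a, 'm) cartesian_category_scheme \<Rightarrow> 'a \<Rightarrow> 'a \<Rightarrow> 'a" where
  "prod_arr C f g =
     pair C (f \<cdot>\<^bsub>C\<^esub> Fst C (Dom C f) (Dom C g)) (g \<cdot>\<^bsub>C\<^esub> Snd C (Dom C f) (Dom C g))"


section \<open>Parametrized list objects\<close>

text \<open>Equations with variables are read over the product of the types of the variables:
  \<open>f(a, [])\<close> is an arrow out of \<open>A\<close>, and both sides of the equation for \<open>f(a, x :: l)\<close> are arrows
  out of \<open>A \<times> (X \<times> L(X))\<close>.\<close>

definition is_parametrized_list_object ::
  "('o, 'a, 'm) cartesian_category_scheme \<Rightarrow> 'o \<Rightarrow> 'o \<Rightarrow> 'a \<Rightarrow> 'a \<Rightarrow> bool" where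
  "is_parametrized_list_object C X LX e c \<longleftrightarrow>
     X \<in> Obj C \<and> LX \<in> Obj C \<and> e \<in> Hom C (One C) LX \<and> c \<in> Hom C (Prod C X LX) LX \<and>
     (\<forall>A \<in> Obj C. \<forall>B \<in> Obj C. \<forall>g \<in> Hom C A B. \<forall>h \<in> Hom C (Prod C X B) B.
        \<exists>!f. f \<in> Hom C (Prod C A LX) B \<and>
          f \<cdot>\<^bsub>C\<^esub> pair C (Id C A) (e \<cdot>\<^bsub>C\<^esub> bang C A) = g \<and>
          f \<cdot>\<^bsub>C\<^esub> prod_arr C (Id C A) c =
            h \<cdot>\<^bsub>C\<^esub> pair C
              (Fst C X LX \<cdot>\<^bsub>C\<^esub> Snd C A (Prod C X LX))
              (f \<cdot>\<^bsub>C\<^esub> prod_arr C (Id C A) (Snd C X LX)))"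

record ('o, 'a) list_category = "('o, 'a) cartesian_category" +
  L :: "'o \<Rightarrow> 'o"
  r0 :: "'o \<Rightarrow> 'a"
  r1 :: "'o \<Rightarrow> 'a"

locale parametrized_list_category = finite_limit_category C
  for C :: "('o, 'a, 'm) list_category_scheme" (structure) +
  assumes list_object: "X \<in> Obj C \<Longrightarrow> is_parametrized_list_object C X (L C X) (r0 C X) (r1 C X)"

definition list_arr :: "('o, 'a, 'm) list_category_scheme \<Rightarrow> 'a \<Rightarrow> 'a" where
  "list_arr C f = (THE k. k \<in> Hom C (L C (Dom C f)) (L C (Cod C f)) \<and>
     k \<cdot>\<^bsub>C\<^esub> r0 C (Dom C f) = r0 C (Cod C f) \<and>
     k \<cdot>\<^bsub>C\<^esub> r1 C (Dom C f) = r1 C (Cod C f) \<cdot>\<^bsub>C\<^esub> prod_arr C f k)"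

definition list_functor ::
  "('o, 'a, 'm) list_category_scheme \<Rightarrow> ('o, 'a, 'o, 'a) functor_data" where
  "list_functor C = \<lparr>Omap = L C, Amap = list_arr C\<rparr>"

definition NN :: "('o, 'a, 'm) list_category_scheme \<Rightarrow> 'o" where
  "NN C = L C (One C)"

definition zero :: "('o, 'a, 'm) list_category_scheme \<Rightarrow> 'a" where
  "zero C = r0 C (One C)"

definition succ :: "('o, 'a, 'm) list_category_scheme \<Rightarrow> 'a" where
  "succ C = r1 C (One C) \<cdot>\<^bsub>C\<^esub> pair C (bang C (NN C)) (Id C (NN C))"

definition predecessor :: "('o, 'a, 'm) list_category_scheme \<Rightarrow> 'a" where
  "predecessor C = (THE p. p \<in> Hom C (NN C) (NN C) \<and>
     p \<cdot>\<^bsub>C\<^esub> zero C = zero C \<and> p \<cdot>\<^bsub>C\<^esub> succ C = Id C (NN C))"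

definition truncated_minus :: "('o, 'a, 'm) list_category_scheme \<Rightarrow> 'a" where
  "truncated_minus C = (THE d. d \<in> Hom C (Prod C (NN C) (NN C)) (NN C) \<and>
     d \<cdot>\<^bsub>C\<^esub> pair C (Id C (NN C)) (zero C \<cdot>\<^bsub>C\<^esub> bang C (NN C)) = Id C (NN C) \<and>
     d \<cdot>\<^bsub>C\<^esub> prod_arr C (Id C (NN C)) (succ C) = predecessor C \<cdot>\<^bsub>C\<^esub> d)"

text \<open>\<open>\<epsilon> : E \<rightarrow> N \<times> N\<close> exhibits \<open>E\<close> as \<open>{m n. m < n}\<close>, that is, \<open>{m n. s(m) - n = 0}\<close>.\<close>

definition is_less_than_object ::
  "('o, 'a, 'm) list_category_scheme \<Rightarrow> 'o \<Rightarrow> 'a \<Rightarrow> bool" where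
  "is_less_than_object C E \<epsilon> \<longleftrightarrow>
     is_equalizer C
       (truncated_minus C \<cdot>\<^bsub>C\<^esub> prod_arr C (succ C) (Id C (NN C)))
       (zero C \<cdot>\<^bsub>C\<^esub> bang C (Prod C (NN C) (NN C)))
       E \<epsilon>"


section \<open>Slices and polynomial functors\<close>

text \<open>An arrow of the slice from \<open>f\<close> to \<open>g\<close> is a triple \<open>(f, h, g)\<close> with \<open>g \<cdot> h = f\<close>.\<close>

definition slice ::
  "('o, 'a, 'm) category_scheme \<Rightarrow> 'o \<Rightarrow> ('a, 'a \<times> 'a \<times> 'a) category" where
  "slice C A =
     \<lparr>Obj = {f \<in> Arr C. Cod C f = A},
      Arr = {(f, h, g). f \<in> Arr C \<and> Cod C f = A \<and> g \<in> Arr C \<and> Cod C g = A \<and>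
               h \<in> Hom C (Dom C f) (Dom C g) \<and> g \<cdot>\<^bsub>C\<^esub> h = f},
      Dom = (\<lambda>(f, h, g). f),
      Cod = (\<lambda>(f, h, g). g),
      Id = (\<lambda>f. (f, Id C (Dom C f), f)),
      Comp = (\<lambda>(f', h', g') (f, h, g). (f, h' \<cdot>\<^bsub>C\<^esub> h, g'))\<rparr>"

definition Sigma_functor ::
  "('o, 'a, 'm) category_scheme \<Rightarrow> 'a \<Rightarrow> ('a, 'a \<times> 'a \<times> 'a, 'a, 'a \<times> 'a \<times> 'a) functor_data" where
  "Sigma_functor C f =
     \<lparr>Omap = (\<lambda>u. f \<cdot>\<^bsub>C\<^esub> u),
      Amap = (\<lambda>(u, h, v). (f \<cdot>\<^bsub>C\<^esub> u, h, f \<cdot>\<^bsub>C\<^esub> v))\<rparr>"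

text \<open>\<open>\<Delta>\<^sub>f\<close> is a right adjoint of \<open>\<Sigma>\<^sub>f\<close> and \<open>\<Pi>\<^sub>f\<close> a right adjoint of \<open>\<Delta>\<^sub>f\<close>, for \<open>f : A \<rightarrow> B\<close>.
  Both are determined up to natural isomorphism only, so they appear as predicates.\<close>

definition is_Delta ::
  "('o, 'a, 'm) category_scheme \<Rightarrow> 'a
    \<Rightarrow> ('a, 'a \<times> 'a \<times> 'a, 'a, 'a \<times> 'a \<times> 'a) functor_data \<Rightarrow> bool" where
  "is_Delta C f \<Delta> \<longleftrightarrow>
     adjunction (slice C (Dom C f)) (slice C (Cod C f)) (Sigma_functor C f) \<Delta>"

definition is_Pi ::
  "('o, 'a, 'm) category_scheme \<Rightarrow> 'a
    \<Rightarrow> ('a, 'a \<times> 'a \<times> 'a, 'a, 'a \<times> 'a \<times> 'a) functor_data \<Rightarrow> bool" where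
  "is_Pi C f \<Pi> \<longleftrightarrow>
     (\<exists>\<Delta>. is_Delta C f \<Delta> \<and> adjunction (slice C (Cod C f)) (slice C (Dom C f)) \<Delta> \<Pi>)"

text \<open>The polynomial \<open>I \<longleftarrow> A \<longrightarrow> B \<longrightarrow> J\<close> with arrows \<open>s\<close>, \<open>f\<close>, \<open>t\<close> represents \<open>F : C/I \<rightarrow> C/J\<close>.\<close>

definition represents ::
  "('o, 'a, 'm) category_scheme \<Rightarrow> 'a \<Rightarrow> 'a \<Rightarrow> 'a
    \<Rightarrow> ('a, 'a \<times> 'a \<times> 'a, 'a, 'a \<times> 'a \<times> 'a) functor_data \<Rightarrow> bool" where
  "represents C s f t F \<longleftrightarrow>
     s \<in> Arr C \<and> f \<in> Arr C \<and> t \<in> Arr C \<and> Dom C s = Dom C f \<and> Cod C f = Dom C t \<and>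
     (\<exists>\<Delta> \<Pi>. is_Delta C s \<Delta> \<and> is_Pi C f \<Pi> \<and>
        naturally_isomorphic (slice C (Cod C s)) (slice C (Cod C t))
          F (Sigma_functor C t \<circ>\<^sub>F \<Pi> \<circ>\<^sub>F \<Delta>))"

text \<open>The identification of \<open>C/\<one>\<close> with \<open>C\<close>: the two mutually inverse functors.\<close>

definition from_slice_One ::
  "('o, 'a, 'm) cartesian_category_scheme \<Rightarrow> ('a, 'a \<times> 'a \<times> 'a, 'o, 'a) functor_data" where
  "from_slice_One C = \<lparr>Omap = Dom C, Amap = (\<lambda>(u, h, v). h)\<rparr>"

definition to_slice_One ::
  "('o, 'a, 'm) cartesian_category_scheme \<Rightarrow> ('o, 'a, 'a, 'a \<times> 'a \<times> 'a) functor_data" where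
  "to_slice_One C =
     \<lparr>Omap = bang C, Amap = (\<lambda>h. (bang C (Dom C h), h, bang C (Cod C h)))\<rparr>"

definition Sigma_obj ::
  "('o, 'a, 'm) cartesian_category_scheme \<Rightarrow> 'o
    \<Rightarrow> ('a, 'a \<times> 'a \<times> 'a, 'o, 'a) functor_data" where
  "Sigma_obj C A = from_slice_One C \<circ>\<^sub>F Sigma_functor C (bang C A)"

definition is_Delta_obj ::
  "('o, 'a, 'm) cartesian_category_scheme \<Rightarrow> 'o
    \<Rightarrow> ('o, 'a, 'a, 'a \<times> 'a \<times> 'a) functor_data \<Rightarrow> bool" where
  "is_Delta_obj C A \<Delta> \<longleftrightarrow> (\<exists>\<Delta>'. is_Delta C (bang C A) \<Delta>' \<and> \<Delta> = \<Delta>' \<circ>\<^sub>F to_slice_One C)"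

definition over_One ::
  "('o, 'a, 'm) cartesian_category_scheme \<Rightarrow> ('o, 'a, 'o, 'a) functor_data
    \<Rightarrow> ('a, 'a \<times> 'a \<times> 'a, 'a, 'a \<times> 'a \<times> 'a) functor_data" where
  "over_One C F = to_slice_One C \<circ>\<^sub>F F \<circ>\<^sub>F from_slice_One C"

end

theory Submission
  imports Defs
begin

text \<open>
  Equations between arrows are checked on generalized elements \<open>x : T \<rightarrow> X\<close>. Extensivity splits a
  stage \<open>T\<close> along \<open>L X = 1 + X \<times> L X\<close>, which gives case distinctions, and equalizers give induction
  over \<open>N\<close> for equations. The heart of the matter is that for \<open>n : Y \<rightarrow> N\<close> the lists \<open>l : Y \<rightarrow> L X\<close> of
  length \<open>n\<close> correspond bijectively to the arrows \<open>{y, i. i < n y} \<rightarrow> X\<close>, whose domain is the pullback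
  of \<open>\<pi>\<close> along \<open>n\<close>: a list is determined by its entries, and a family \<open>v\<close> of entries is assembled by
  the recursion \<open>f (y, 0) = []\<close>, \<open>f (y, k + 1) = v (y, k) :: f (y, k)\<close> for \<open>k < n y\<close>. For \<open>u : U \<rightarrow> E\<close>
  the dependent product \<open>\<Pi> u\<close> is then the equalizer of \<open>L u : L U \<rightarrow> L E\<close> with the arrow sending \<open>l\<close> to
  the list of all elements of \<open>E\<close> over \<open>len l\<close>, and \<open>len : L X \<rightarrow> N\<close> has the universal property of
  \<open>\<Pi> (\<Delta> X)\<close>.
\<close>

section \<open>Arrows, limits and coproducts\<close>

text \<open>Nothing is assumed exponentiable and the only internal statements are equations, so
  neither families nor properties can be treated as elements of an object. A family is instead a HOL
  function on generalized elements together with naturality, and a property such as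
  \<open>i < n\<close> is the equation \<open>suc i \<ominus> n = zero_at T\<close> at a stage. Its
  negation is replaced by the successor case of a case split, and a contradictory stage admits every
  equation. Recursion needs a total step, while entries are prescribed only for
  \<open>i < n y\<close>; the gap is closed by gluing in a default along the coproduct decomposition
  of the stage. Counting entries from the end suits this recursion: entry \<open>k\<close> is put in
  front of a list of length \<open>k\<close>, so an entry keeps its index while the list grows. For
  a nontrivial \<open>u : U \<rightarrow> E\<close> the length alone does not suffice, because the
  entry with index \<open>i\<close> must lie over \<open>(i, len l)\<close>; comparing
  \<open>L u\<close> with the list of all these pairs states this for all \<open>i\<close> in one
  equation, hence as an equalizer.\<close>

context category
begin

text \<open>The \<open>Obj\<close> conjuncts are derived here once, so that unfolding with
  \<open>hom_iff\<close> supplies the typing side conditions of the simp rules below.\<close>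

lemma hom_iff: "f \<in> Hom C X Y \<longleftrightarrow> f \<in> Arr C \<and> Dom C f = X \<and> Cod C f = Y \<and> X \<in> Obj C \<and> Y \<in> Obj C"
  using Dom_Obj Cod_Obj by (auto simp: Hom_def)

lemma Dom_in_Obj [simp]: "f \<in> Arr C \<Longrightarrow> Dom C f \<in> Obj C"
  by (rule Dom_Obj)

lemma Cod_in_Obj [simp]: "f \<in> Arr C \<Longrightarrow> Cod C f \<in> Obj C"
  by (rule Cod_Obj)

lemma Id_simps [simp]:
  assumes "X \<in> Obj C"
  shows "Id C X \<in> Arr C" "Dom C (Id C X) = X" "Cod C (Id C X) = X"
  using Id_Hom[OF assms] by (auto simp: Hom_def)

lemma Comp_simps [simp]:
  assumes "f \<in> Arr C" "g \<in> Arr C" "Dom C g = Cod C f"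
  shows "g \<cdot> f \<in> Arr C" "Dom C (g \<cdot> f) = Dom C f" "Cod C (g \<cdot> f) = Cod C g"
  using Comp_Hom[of f "Dom C f" "Cod C f" g "Cod C g"] assms by (auto simp: Hom_def)

lemma Comp_Id_simp [simp]: "f \<in> Arr C \<Longrightarrow> Dom C f = X \<Longrightarrow> f \<cdot> Id C X = f"
  using Comp_Id[of f X "Cod C f"] by (auto simp: Hom_def)

lemma Id_Comp_simp [simp]: "f \<in> Arr C \<Longrightarrow> Cod C f = X \<Longrightarrow> Id C X \<cdot> f = f"
  using Id_Comp[of f "Dom C f" X] by (auto simp: Hom_def)

text \<open>Composites are normalized to the right. A fact of the shape
  \<open>g \<cdot> f = k\<close> then no longer matches inside a longer composite, hence the detours
  through \<open>(g \<cdot> f) \<cdot> t\<close> and \<open>flip: assoc\<close> in later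
  proofs.\<close>

lemma assoc [simp]:
  "f \<in> Arr C \<Longrightarrow> g \<in> Arr C \<Longrightarrow> h \<in> Arr C \<Longrightarrow> Dom C g = Cod C f \<Longrightarrow> Dom C h = Cod C g
    \<Longrightarrow> (h \<cdot> g) \<cdot> f = h \<cdot> (g \<cdot> f)"
  using Comp_assoc[of f "Dom C f" "Cod C f" g "Cod C g" h "Cod C h"] by (auto simp: Hom_def)

lemma coproductD:
  assumes "is_coproduct C A B S i j"
  shows "i \<in> Hom C A S" "j \<in> Hom C B S"
  using assms by (simp_all add: is_coproduct_def)

lemma pullbackD:
  assumes "is_pullback C f g P p q"
  shows "p \<in> Hom C P (Dom C f)" "q \<in> Hom C P (Dom C g)" "f \<cdot> p = g \<cdot> q"
  using assms by (simp_all add: is_pullback_def)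

lemma pullback_lift:
  assumes "is_pullback C f g P p q" "h \<in> Hom C X (Dom C f)" "k \<in> Hom C X (Dom C g)" "f \<cdot> h = g \<cdot> k"
  shows "\<exists>!u. u \<in> Hom C X P \<and> p \<cdot> u = h \<and> q \<cdot> u = k"
proof -
  have "X \<in> Obj C" using assms(2) by (simp add: hom_iff)
  with assms show ?thesis unfolding is_pullback_def by simp
qed

lemma equalizerD:
  assumes "is_equalizer C f g E e"
  shows "e \<in> Hom C E (Dom C f)" "f \<cdot> e = g \<cdot> e"
  using assms by (simp_all add: is_equalizer_def)

lemma equalizer_lift:
  assumes "is_equalizer C f g E e" "k \<in> Hom C X (Dom C f)" "f \<cdot> k = g \<cdot> k"
  shows "\<exists>!u. u \<in> Hom C X E \<and> e \<cdot> u = k"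
proof -
  have "X \<in> Obj C" using assms(2) by (simp add: hom_iff)
  with assms show ?thesis unfolding is_equalizer_def by simp
qed

lemma coproduct_eqI:
  assumes "is_coproduct C A B S i j" "u \<in> Hom C S Z" "v \<in> Hom C S Z" "u \<cdot> i = v \<cdot> i" "u \<cdot> j = v \<cdot> j"
  shows "u = v"
proof -
  have Z: "Z \<in> Obj C" and f: "u \<cdot> i \<in> Hom C A Z" and g: "u \<cdot> j \<in> Hom C B Z"
    using assms coproductD[OF assms(1)] by (auto simp: hom_iff)
  have "\<exists>!w. w \<in> Hom C S Z \<and> w \<cdot> i = u \<cdot> i \<and> w \<cdot> j = u \<cdot> j"
    using assms(1) Z f g unfolding is_coproduct_def by blast
  with assms show ?thesis by metis
qed

end

section \<open>Terminal arrows, pairing, and pullbacks\<close>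

context finite_limit_category
begin

abbreviation pr :: "'a \<Rightarrow> 'a \<Rightarrow> 'a" ("\<langle>_,/ _\<rangle>") where
  "\<langle>f, g\<rangle> \<equiv> pair C f g"

lemma One_Obj [simp]: "One C \<in> Obj C"
  using One_terminal by (simp add: is_terminal_def)

lemma bang_unique: "f \<in> Arr C \<Longrightarrow> Cod C f = One C \<Longrightarrow> f = bang C (Dom C f)"
  unfolding bang_def using One_terminal
  by (intro the1_equality[symmetric]) (auto simp: is_terminal_def hom_iff)

lemma bang_eqI: "f \<in> Hom C T (One C) \<Longrightarrow> f = bang C T"
  using bang_unique[of f] by (simp add: hom_iff)

lemma bang_simps [simp]:
  assumes "X \<in> Obj C"
  shows "bang C X \<in> Arr C" "Dom C (bang C X) = X" "Cod C (bang C X) = One C"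
proof -
  have "\<exists>!f. f \<in> Hom C X (One C)"
    using One_terminal assms by (simp add: is_terminal_def)
  from theI'[OF this] show "bang C X \<in> Arr C" "Dom C (bang C X) = X" "Cod C (bang C X) = One C"
    by (auto simp: bang_def hom_iff)
qed

lemma bang_comp [simp]: "t \<in> Arr C \<Longrightarrow> Cod C t = X \<Longrightarrow> bang C X \<cdot> t = bang C (Dom C t)"
  using bang_unique[of "bang C X \<cdot> t"] by fastforce

lemma bang_One [simp]: "bang C (One C) = Id C (One C)"
  using bang_unique[of "Id C (One C)"] by simp

lemma Prod_simps [simp]:
  assumes "A \<in> Obj C" "B \<in> Obj C"
  shows "Prod C A B \<in> Obj C"
    "Fst C A B \<in> Arr C" "Dom C (Fst C A B) = Prod C A B" "Cod C (Fst C A B) = A"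
    "Snd C A B \<in> Arr C" "Dom C (Snd C A B) = Prod C A B" "Cod C (Snd C A B) = B"
  using Prod_product[OF assms] by (auto simp: is_product_def hom_iff)

lemma pair_ex1:
  assumes "f \<in> Arr C" "g \<in> Arr C" "Dom C g = Dom C f"
  shows "\<exists>!u. u \<in> Hom C (Dom C f) (Prod C (Cod C f) (Cod C g)) \<and>
     Fst C (Cod C f) (Cod C g) \<cdot> u = f \<and> Snd C (Cod C f) (Cod C g) \<cdot> u = g"
  using Prod_product[of "Cod C f" "Cod C g"] assms unfolding is_product_def
  by (simp add: Hom_def)

lemma pair_simps [simp]:
  assumes "f \<in> Arr C" "g \<in> Arr C" "Dom C g = Dom C f"
  shows "\<langle>f, g\<rangle> \<in> Arr C" "Dom C \<langle>f, g\<rangle> = Dom C f" "Cod C \<langle>f, g\<rangle> = Prod C (Cod C f) (Cod C g)"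
    "Cod C f = A \<Longrightarrow> Cod C g = B \<Longrightarrow> Fst C A B \<cdot> \<langle>f, g\<rangle> = f"
    "Cod C f = A \<Longrightarrow> Cod C g = B \<Longrightarrow> Snd C A B \<cdot> \<langle>f, g\<rangle> = g"
  using theI'[OF pair_ex1[OF assms]] by (auto simp: pair_def hom_iff)

lemma pair_ext:
  assumes "u \<in> Hom C T (Prod C A B)" "v \<in> Hom C T (Prod C A B)" "A \<in> Obj C" "B \<in> Obj C"
    "Fst C A B \<cdot> u = Fst C A B \<cdot> v" "Snd C A B \<cdot> u = Snd C A B \<cdot> v"
  shows "u = v"
  using pair_ex1[of "Fst C A B \<cdot> u" "Snd C A B \<cdot> u"] assms by (auto simp: hom_iff)

text \<open>Substitution: with this rule, evaluating an equation with variables at a stage is plain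
  rewriting.\<close>

lemma pair_comp [simp]:
  assumes "f \<in> Arr C" "g \<in> Arr C" "Dom C g = Dom C f" "t \<in> Arr C" "Cod C t = Dom C f"
  shows "\<langle>f, g\<rangle> \<cdot> t = \<langle>f \<cdot> t, g \<cdot> t\<rangle>"
  by (rule pair_ext[of _ "Dom C t" "Cod C f" "Cod C g"])
    (use assms in \<open>auto simp: hom_iff assoc[symmetric] simp del: assoc\<close>)

lemma pair_eta:
  assumes "u \<in> Arr C" "Cod C u = Prod C A B" "A \<in> Obj C" "B \<in> Obj C"
  shows "\<langle>Fst C A B \<cdot> u, Snd C A B \<cdot> u\<rangle> = u"
  by (rule pair_ext[of _ "Dom C u" A B]) (use assms in \<open>auto simp: hom_iff\<close>)

lemma pair_Fst_Snd [simp]: "A \<in> Obj C \<Longrightarrow> B \<in> Obj C \<Longrightarrow> \<langle>Fst C A B, Snd C A B\<rangle> = Id C (Prod C A B)"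
  using pair_eta[of "Id C (Prod C A B)" A B] by simp

lemma pair_eq_iff:
  assumes "f \<in> Hom C T A" "g \<in> Hom C T B" "f' \<in> Hom C T A" "g' \<in> Hom C T B"
  shows "\<langle>f, g\<rangle> = \<langle>f', g'\<rangle> \<longleftrightarrow> f = f' \<and> g = g'"
proof
  assume eq: "\<langle>f, g\<rangle> = \<langle>f', g'\<rangle>"
  have "Fst C A B \<cdot> \<langle>f, g\<rangle> = f" "Fst C A B \<cdot> \<langle>f', g'\<rangle> = f'"
    "Snd C A B \<cdot> \<langle>f, g\<rangle> = g" "Snd C A B \<cdot> \<langle>f', g'\<rangle> = g'"
    using assms by (auto simp: hom_iff)
  with eq show "f = f' \<and> g = g'" by metis
qed auto

text \<open>The usual construction: \<open>E\<close> equalizes \<open>f \<cdot> Fst C A B\<close>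
  and \<open>g \<cdot> Snd C A B\<close>. Arrows into the product are pairs, so \<open>**\<close>
  translates one universal property into the other.\<close>

lemma ex_is_pullback:
  assumes "f \<in> Hom C A D" "g \<in> Hom C B D"
  shows "\<exists>P p q. is_pullback C f g P p q"
proof -
  have [simp]: "A \<in> Obj C" "B \<in> Obj C" and f: "f \<in> Arr C" "Dom C f = A" "Cod C f = D"
    and g: "g \<in> Arr C" "Dom C g = B" "Cod C g = D"
    using assms by (auto simp: hom_iff)
  obtain E e where e: "is_equalizer C (f \<cdot> Fst C A B) (g \<cdot> Snd C A B) E e"
    using ex_equalizer[of "f \<cdot> Fst C A B" "Prod C A B" D "g \<cdot> Snd C A B"] f g by (auto simp: hom_iff)
  have e': "e \<in> Arr C" "Dom C e = E" "Cod C e = Prod C A B" "E \<in> Obj C"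
    and eq: "f \<cdot> (Fst C A B \<cdot> e) = g \<cdot> (Snd C A B \<cdot> e)"
    using e f g by (auto simp: is_equalizer_def hom_iff)
  have "is_pullback C f g E (Fst C A B \<cdot> e) (Snd C A B \<cdot> e)"
    unfolding is_pullback_def
  proof (intro conjI ballI impI)
    fix X h k
    assume X: "X \<in> Obj C" and h: "h \<in> Hom C X (Dom C f)" and k: "k \<in> Hom C X (Dom C g)"
      and hk: "f \<cdot> h = g \<cdot> k"
    have hk': "h \<in> Arr C" "Dom C h = X" "Cod C h = A" "k \<in> Arr C" "Dom C k = X" "Cod C k = B"
      using h k f g by (auto simp: hom_iff)
    have "\<langle>h, k\<rangle> \<in> Hom C X (Dom C (f \<cdot> Fst C A B))"
      "(f \<cdot> Fst C A B) \<cdot> \<langle>h, k\<rangle> = (g \<cdot> Snd C A B) \<cdot> \<langle>h, k\<rangle>"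
      using hk' f g X hk by (auto simp: hom_iff)
    then have *: "\<exists>!u. u \<in> Hom C X E \<and> e \<cdot> u = \<langle>h, k\<rangle>"
      using e X unfolding is_equalizer_def by blast
    have **: "e \<cdot> u = \<langle>h, k\<rangle> \<longleftrightarrow> (Fst C A B \<cdot> e) \<cdot> u = h \<and> (Snd C A B \<cdot> e) \<cdot> u = k"
      if "u \<in> Hom C X E" for u
    proof -
      have "e \<cdot> u = \<langle>Fst C A B \<cdot> (e \<cdot> u), Snd C A B \<cdot> (e \<cdot> u)\<rangle>"
        using that e' by (subst pair_eta) (auto simp: hom_iff)
      then show ?thesis
        using that e' hk' pair_eq_iff[of "Fst C A B \<cdot> (e \<cdot> u)" X A "Snd C A B \<cdot> (e \<cdot> u)" B h k]
        by (auto simp: hom_iff)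
    qed
    show "\<exists>!u. u \<in> Hom C X E \<and> (Fst C A B \<cdot> e) \<cdot> u = h \<and> (Snd C A B \<cdot> e) \<cdot> u = k"
      using * ** by metis
  qed (use e' f g eq in \<open>auto simp: hom_iff\<close>)
  then show ?thesis by blast
qed

end

section \<open>Disjointness of coproducts and the second injection\<close>

context extensive_category
begin

text \<open>Disjointness and monicity of the second injection both come from extensivity, applied to the
  coproduct diagram \<open>Z \<rightarrow> B \<leftarrow> B\<close> with \<open>Z\<close> initial.\<close>

lemma coproduct_inr_pullbacks:
  assumes cop: "is_coproduct C A B S i j" and Z: "is_initial C Z" and z: "zA \<in> Hom C Z A" "zB \<in> Hom C Z B"
  shows "is_pullback C j i Z zB zA" "is_pullback C j j B (Id C B) (Id C B)"
proof -
  have [simp]: "A \<in> Obj C" "B \<in> Obj C" "S \<in> Obj C" and ij: "i \<in> Hom C A S" "j \<in> Hom C B S"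
    using coproductD[OF cop] by (auto simp: hom_iff)
  have Zu: "\<exists>!f. f \<in> Hom C Z X" if "X \<in> Obj C" for X
    using Z that by (auto simp: is_initial_def)
  have c: "is_coproduct C Z B B zB (Id C B)"
    unfolding is_coproduct_def
  proof (intro conjI ballI)
    fix X f g assume X: "X \<in> Obj C" and f: "f \<in> Hom C Z X" and g: "g \<in> Hom C B X"
    have "g \<cdot> zB \<in> Hom C Z X" using g z by (auto simp: hom_iff)
    then have "g \<cdot> zB = f" using Zu[OF X] f by blast
    then show "\<exists>!u. u \<in> Hom C B X \<and> u \<cdot> zB = f \<and> u \<cdot> Id C B = g"
      using g by (intro ex1I[of _ g]) (auto simp: hom_iff)
  qed (use z in \<open>auto simp: hom_iff\<close>)
  have "j \<cdot> zB = i \<cdot> zA"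
    using Zu[of S] ij z by (metis Comp_Hom \<open>S \<in> Obj C\<close>)
  \<comment> \<open>The top row is \<open>c\<close> and the vertical arrows are \<open>zA\<close>,
    \<open>j\<close> and \<open>Id C B\<close>. The two squares say that the injections meet in the
    initial object and that \<open>j\<close> has a trivial kernel pair.\<close>
  then show "is_pullback C j i Z zB zA" "is_pullback C j j B (Id C B) (Id C B)"
    using coproduct_iff_pullbacks[OF cop z(1) Id_Hom ij(2) z(2) Id_Hom] c ij by (simp_all add: hom_iff)
qed

lemma ex_initial_arrows:
  obtains Z where "is_initial C Z" "\<And>X. X \<in> Obj C \<Longrightarrow> \<exists>f. f \<in> Hom C Z X"
  using ex_initial unfolding is_initial_def by blast

text \<open>The kernel pair of \<open>j\<close> is \<open>(Id C B, Id C B)\<close>, and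
  \<open>(a, b)\<close> factors through it.\<close>

lemma coproduct_inr_mono:
  assumes cop: "is_coproduct C A B S i j" and ab: "a \<in> Hom C T B" "b \<in> Hom C T B" and eq: "j \<cdot> a = j \<cdot> b"
  shows "a = b"
proof -
  have AB: "A \<in> Obj C" "B \<in> Obj C" and j: "j \<in> Hom C B S"
    using coproductD[OF cop] by (auto simp: hom_iff)
  obtain Z zA zB where "is_initial C Z" "zA \<in> Hom C Z A" "zB \<in> Hom C Z B"
    using ex_initial_arrows AB by metis
  note pb = coproduct_inr_pullbacks(2)[OF cop this]
  have "a \<in> Hom C T (Dom C j)" "b \<in> Hom C T (Dom C j)" using ab j by (auto simp: hom_iff)
  from pullback_lift[OF pb this eq]
  obtain u where "u \<in> Hom C T B" "Id C B \<cdot> u = a" "Id C B \<cdot> u = b" by blast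
  then show ?thesis by simp
qed

text \<open>\<open>T\<close> maps to the pullback of the two injections, which is initial and so
  reaches every \<open>W\<close>. Existence is what is needed later: it supplies a value on a piece
  of a stage that cannot occur.\<close>

lemma coproduct_disjoint:
  assumes cop: "is_coproduct C A B S i j" and ab: "a \<in> Hom C T A" "b \<in> Hom C T B" and eq: "i \<cdot> a = j \<cdot> b"
    and W: "W \<in> Obj C"
  shows "\<exists>f. f \<in> Hom C T W"
proof -
  have AB: "A \<in> Obj C" "B \<in> Obj C" and ij: "i \<in> Hom C A S" "j \<in> Hom C B S"
    using coproductD[OF cop] by (auto simp: hom_iff)
  obtain Z zA zB where Z: "is_initial C Z" "zA \<in> Hom C Z A" "zB \<in> Hom C Z B" and zW: "\<exists>f. f \<in> Hom C Z W"
    using ex_initial_arrows AB W by metis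
  have "b \<in> Hom C T (Dom C j)" "a \<in> Hom C T (Dom C i)" using ab ij by (auto simp: hom_iff)
  from pullback_lift[OF coproduct_inr_pullbacks(1)[OF cop Z] this eq[symmetric]]
  obtain u where "u \<in> Hom C T Z" by blast
  then show ?thesis using zW Comp_Hom by blast
qed

end

section \<open>Recursion and induction\<close>

locale extensive_list_category = extensive_category C + parametrized_list_category C
  for C :: "('o, 'a, 'm) list_category_scheme" (structure)
begin

abbreviation N :: 'o where
  "N \<equiv> NN C"

abbreviation pre :: "'a \<Rightarrow> 'a" where
  "pre k \<equiv> predecessor C \<cdot> k"

abbreviation suc :: "'a \<Rightarrow> 'a" where
  "suc k \<equiv> succ C \<cdot> k"

lemma L_Obj [simp]: "X \<in> Obj C \<Longrightarrow> L C X \<in> Obj C"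
  using list_object[of X] by (simp add: is_parametrized_list_object_def)

lemma r0_simps [simp]:
  assumes "X \<in> Obj C"
  shows "r0 C X \<in> Arr C" "Dom C (r0 C X) = One C" "Cod C (r0 C X) = L C X"
  using list_object[OF assms] by (auto simp: is_parametrized_list_object_def hom_iff)

lemma r1_simps [simp]:
  assumes "X \<in> Obj C"
  shows "r1 C X \<in> Arr C" "Dom C (r1 C X) = Prod C X (L C X)" "Cod C (r1 C X) = L C X"
  using list_object[OF assms] by (auto simp: is_parametrized_list_object_def hom_iff)

abbreviation empty :: "'o \<Rightarrow> 'o \<Rightarrow> 'a" where
  "empty X T \<equiv> r0 C X \<cdot> bang C T"

abbreviation cons :: "'o \<Rightarrow> 'a \<Rightarrow> 'a \<Rightarrow> 'a" where
  "cons X x l \<equiv> r1 C X \<cdot> \<langle>x, l\<rangle>"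

text \<open>The recursion equations of a list object, read at every stage \<open>T\<close>. In this
  form they can be instantiated at arbitrary generalized elements, without projections out of
  \<open>A \<times> (X \<times> L X)\<close>.\<close>

definition list_recursive :: "'o \<Rightarrow> 'o \<Rightarrow> 'o \<Rightarrow> 'a \<Rightarrow> 'a \<Rightarrow> 'a \<Rightarrow> bool" where
  "list_recursive X A B g h f \<longleftrightarrow> f \<in> Hom C (Prod C A (L C X)) B \<and>
     (\<forall>T. \<forall>a \<in> Hom C T A. f \<cdot> \<langle>a, empty X T\<rangle> = g \<cdot> a) \<and>
     (\<forall>T. \<forall>a \<in> Hom C T A. \<forall>x \<in> Hom C T X. \<forall>l \<in> Hom C T (L C X).
        f \<cdot> \<langle>a, cons X x l\<rangle> = h \<cdot> \<langle>x, f \<cdot> \<langle>a, l\<rangle>\<rangle>)"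

text \<open>Yoneda: the equations in the definition of a list object are those at the generic
  elements, namely the identity of \<open>A\<close> and the projections out of
  \<open>A \<times> (X \<times> L X)\<close>. All other instances follow by precomposition.\<close>

lemma list_recursive_ex1:
  assumes X: "X \<in> Obj C" and g: "g \<in> Hom C A B" and h: "h \<in> Hom C (Prod C X B) B"
  shows "\<exists>!f. list_recursive X A B g h f"
proof -
  have A: "A \<in> Obj C" and B: "B \<in> Obj C" and g': "g \<in> Arr C" "Dom C g = A" "Cod C g = B"
    and h': "h \<in> Arr C" "Dom C h = Prod C X B" "Cod C h = B"
    using g h by (auto simp: hom_iff)
  let ?LX = "L C X"
  have "list_recursive X A B g h f \<longleftrightarrow> f \<in> Hom C (Prod C A ?LX) B \<and>
          f \<cdot> \<langle>Id C A, r0 C X \<cdot> bang C A\<rangle> = g \<and>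
          f \<cdot> prod_arr C (Id C A) (r1 C X) = h \<cdot> \<langle>Fst C X ?LX \<cdot> Snd C A (Prod C X ?LX),
              f \<cdot> prod_arr C (Id C A) (Snd C X ?LX)\<rangle>" (is "_ \<longleftrightarrow> ?P f") for f
  proof (cases "f \<in> Hom C (Prod C A ?LX) B")
    case True
    then have f: "f \<in> Arr C" "Dom C f = Prod C A ?LX" "Cod C f = B"
      using A X by (auto simp: hom_iff)
    show ?thesis
    proof
      assume l: "list_recursive X A B g h f"
      show "?P f"
      proof (intro conjI)
        show "f \<cdot> \<langle>Id C A, r0 C X \<cdot> bang C A\<rangle> = g"
          using l Id_Hom[OF A] g' unfolding list_recursive_def by force
        let ?Q = "Prod C X ?LX"
        have r: "f \<cdot> \<langle>a, cons X x l\<rangle> = h \<cdot> \<langle>x, f \<cdot> \<langle>a, l\<rangle>\<rangle>"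
          if "a \<in> Hom C T A" "x \<in> Hom C T X" "l \<in> Hom C T (L C X)" for T a x l
          using l that unfolding list_recursive_def by blast
        have e: "\<langle>Fst C X ?LX \<cdot> Snd C A ?Q, Snd C X ?LX \<cdot> Snd C A ?Q\<rangle> = Snd C A ?Q"
          using A X by (subst pair_eta) auto
        show "f \<cdot> prod_arr C (Id C A) (r1 C X) = h \<cdot> \<langle>Fst C X ?LX \<cdot> Snd C A (Prod C X ?LX),
              f \<cdot> prod_arr C (Id C A) (Snd C X ?LX)\<rangle>"
          using r[of "Fst C A ?Q" "Prod C A ?Q" "Fst C X ?LX \<cdot> Snd C A ?Q" "Snd C X ?LX \<cdot> Snd C A ?Q"] A X e
          by (simp add: hom_iff prod_arr_def)
      qed fact
    next
      assume p: "?P f"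
      let ?Q = "Prod C X ?LX"
      show "list_recursive X A B g h f"
        unfolding list_recursive_def
      proof (intro conjI allI ballI)
        fix T a assume a: "a \<in> Hom C T A"
        have "f \<cdot> \<langle>a, empty X T\<rangle> = (f \<cdot> \<langle>Id C A, r0 C X \<cdot> bang C A\<rangle>) \<cdot> a"
          using a f A X by (simp add: hom_iff)
        then show "f \<cdot> \<langle>a, empty X T\<rangle> = g \<cdot> a" using p by simp
      next
        fix T a x l assume a: "a \<in> Hom C T A" and x: "x \<in> Hom C T X" and l: "l \<in> Hom C T (L C X)"
        have "f \<cdot> \<langle>a, cons X x l\<rangle> = (f \<cdot> prod_arr C (Id C A) (r1 C X)) \<cdot> \<langle>a, \<langle>x, l\<rangle>\<rangle>"
          using a x l f A X by (simp add: hom_iff prod_arr_def)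
        also have "\<dots> = h \<cdot> \<langle>x, f \<cdot> \<langle>a, l\<rangle>\<rangle>"
          using p a x l f A X h' by (simp add: hom_iff prod_arr_def)
        finally show "f \<cdot> \<langle>a, cons X x l\<rangle> = h \<cdot> \<langle>x, f \<cdot> \<langle>a, l\<rangle>\<rangle>" .
      qed fact
    qed
  qed (simp add: list_recursive_def)
  moreover have "\<exists>!f. ?P f"
    using list_object[OF X] A B g h unfolding is_parametrized_list_object_def by blast
  ultimately show ?thesis by simp
qed

lemma list_recursive_unique:
  "X \<in> Obj C \<Longrightarrow> g \<in> Hom C A B \<Longrightarrow> h \<in> Hom C (Prod C X B) B \<Longrightarrow>
    list_recursive X A B g h f \<Longrightarrow> list_recursive X A B g h f' \<Longrightarrow> f = f'"
  using list_recursive_ex1 by blast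

text \<open>A form of Lambek's lemma. A case distinction needs the tail, which the recursion does
  not pass to its step. The recursion therefore runs in \<open>L X \<times> Z\<close>, whose first
  component rebuilds the list.\<close>

lemma list_coproduct:
  assumes X: "X \<in> Obj C"
  shows "is_coproduct C (One C) (Prod C X (L C X)) (L C X) (r0 C X) (r1 C X)"
  unfolding is_coproduct_def
proof (intro conjI ballI)
  let ?LX = "L C X"
  fix Z f g assume Z: "Z \<in> Obj C" and f: "f \<in> Hom C (One C) Z" and g: "g \<in> Hom C (Prod C X ?LX) Z"
  let ?B = "Prod C ?LX Z"
  \<comment> \<open>\<open>v\<close> extracts the head and the rebuilt tail from the argument of the
    step; \<open>h\<close> conses them in the first component and applies \<open>g\<close> to them
    in the second, ignoring the previous value in \<open>Z\<close>.\<close>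
  define g0 where "g0 = \<langle>r0 C X, f\<rangle>"
  define v where "v = \<langle>Fst C X ?B, Fst C ?LX Z \<cdot> Snd C X ?B\<rangle>"
  define h where "h = \<langle>r1 C X \<cdot> v, g \<cdot> v\<rangle>"
  have fg: "f \<in> Arr C" "Dom C f = One C" "Cod C f = Z" "g \<in> Arr C" "Dom C g = Prod C X ?LX" "Cod C g = Z"
    using f g by (auto simp: hom_iff)
  have g0: "g0 \<in> Hom C (One C) ?B" and h: "h \<in> Hom C (Prod C X ?B) ?B"
    unfolding g0_def h_def v_def using fg X Z by (auto simp: hom_iff)
  have hp: "h \<cdot> \<langle>x, w\<rangle> = \<langle>cons X x (Fst C ?LX Z \<cdot> w), g \<cdot> \<langle>x, Fst C ?LX Z \<cdot> w\<rangle>\<rangle>"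
    if "x \<in> Hom C T X" "w \<in> Hom C T ?B" for T x w
    unfolding h_def v_def using that X Z fg by (simp add: hom_iff)
  show "\<exists>!u. u \<in> Hom C ?LX Z \<and> u \<cdot> r0 C X = f \<and> u \<cdot> r1 C X = g"
  proof (rule ex_ex1I)
    obtain k where k: "list_recursive X (One C) ?B g0 h k"
      using list_recursive_ex1[OF X g0 h] by blast
    then have k': "k \<in> Arr C" "Dom C k = Prod C (One C) ?LX" "Cod C k = ?B"
      unfolding list_recursive_def by (auto simp: hom_iff)
    have k0: "k \<cdot> \<langle>a, empty X T\<rangle> = g0 \<cdot> a" if "a \<in> Hom C T (One C)" for T a
      using k that unfolding list_recursive_def by blast
    have k1: "k \<cdot> \<langle>a, cons X x l\<rangle> = h \<cdot> \<langle>x, k \<cdot> \<langle>a, l\<rangle>\<rangle>"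
      if "a \<in> Hom C T (One C)" "x \<in> Hom C T X" "l \<in> Hom C T ?LX" for T a x l
      using k that unfolding list_recursive_def by blast
    \<comment> \<open>The first component obeys the recursion with data \<open>r0 C X\<close> and
      \<open>r1 C X\<close>, and so does the projection: the rebuilt list is the given one.\<close>
    have "Fst C ?LX Z \<cdot> k = Snd C (One C) ?LX"
    proof (rule list_recursive_unique[OF X])
      show "r0 C X \<in> Hom C (One C) ?LX" "r1 C X \<in> Hom C (Prod C X ?LX) ?LX"
        using X by (auto simp: hom_iff)
      show "list_recursive X (One C) ?LX (r0 C X) (r1 C X) (Fst C ?LX Z \<cdot> k)"
        unfolding list_recursive_def
      proof (intro conjI allI ballI)
        fix T a assume a: "a \<in> Hom C T (One C)"
        show "(Fst C ?LX Z \<cdot> k) \<cdot> \<langle>a, empty X T\<rangle> = r0 C X \<cdot> a"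
          using a k' k0[OF a] fg X Z by (simp add: hom_iff g0_def)
      next
        fix T a x l assume a: "a \<in> Hom C T (One C)" "x \<in> Hom C T X" "l \<in> Hom C T ?LX"
        show "(Fst C ?LX Z \<cdot> k) \<cdot> \<langle>a, cons X x l\<rangle> = cons X x ((Fst C ?LX Z \<cdot> k) \<cdot> \<langle>a, l\<rangle>)"
          using a k' k1[OF a] hp[of x T "k \<cdot> \<langle>a, l\<rangle>"] fg X Z by (simp add: hom_iff)
      qed (use k' X Z in \<open>auto simp: hom_iff\<close>)
      show "list_recursive X (One C) ?LX (r0 C X) (r1 C X) (Snd C (One C) ?LX)"
        unfolding list_recursive_def
      proof (intro conjI allI ballI)
        fix T a assume a: "a \<in> Hom C T (One C)"
        then have "a = bang C T"
          using bang_unique by (auto simp: hom_iff)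
        then show "Snd C (One C) ?LX \<cdot> \<langle>a, empty X T\<rangle> = r0 C X \<cdot> a"
          using a X by (simp add: hom_iff)
      qed (use X in \<open>auto simp: hom_iff\<close>)
    qed
    then have kS: "Fst C ?LX Z \<cdot> (k \<cdot> t) = Snd C (One C) ?LX \<cdot> t"
      if "t \<in> Hom C T (Prod C (One C) ?LX)" for t T
      using that k' X Z by (simp add: hom_iff flip: assoc)
    \<comment> \<open>On a cons the first component of the recursive call is the true tail, by
      \<open>kS\<close>, so the second component becomes \<open>g\<close>.\<close>
    have idLX: "k \<cdot> \<langle>bang C (Prod C X ?LX), r1 C X\<rangle> = \<langle>r1 C X, g\<rangle>"
    proof -
      let ?Q = "Prod C X ?LX"
      have "k \<cdot> \<langle>bang C ?Q, r1 C X\<rangle> = h \<cdot> \<langle>Fst C X ?LX, k \<cdot> \<langle>bang C ?Q, Snd C X ?LX\<rangle>\<rangle>"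
        using k1[of "bang C ?Q" ?Q "Fst C X ?LX" "Snd C X ?LX"] X by (simp add: hom_iff)
      also have "\<dots> = \<langle>r1 C X, g\<rangle>"
        using hp[of "Fst C X ?LX" ?Q "k \<cdot> \<langle>bang C ?Q, Snd C X ?LX\<rangle>"]
          kS[of "\<langle>bang C ?Q, Snd C X ?LX\<rangle>" ?Q] k' X Z fg by (simp add: hom_iff)
      finally show ?thesis .
    qed
    define u where "u = Snd C ?LX Z \<cdot> (k \<cdot> \<langle>bang C ?LX, Id C ?LX\<rangle>)"
    have "u \<in> Hom C ?LX Z" "u \<cdot> r0 C X = f" "u \<cdot> r1 C X = g"
      using k' X Z fg k0[of "Id C (One C)" "One C"] idLX by (auto simp: u_def hom_iff g0_def)
    then show "\<exists>u. u \<in> Hom C ?LX Z \<and> u \<cdot> r0 C X = f \<and> u \<cdot> r1 C X = g" by blast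
  next
    \<comment> \<open>Every candidate \<open>u\<close>, paired with the list itself, solves the same
      recursion, so its uniqueness carries over to \<open>u\<close>.\<close>
    have rec: "list_recursive X (One C) ?B g0 h \<langle>Snd C (One C) ?LX, u \<cdot> Snd C (One C) ?LX\<rangle>"
      if u: "u \<in> Hom C ?LX Z \<and> u \<cdot> r0 C X = f \<and> u \<cdot> r1 C X = g" for u
      unfolding list_recursive_def
    proof (intro conjI allI ballI)
      have u': "u \<in> Arr C" "Dom C u = ?LX" "Cod C u = Z" using u by (auto simp: hom_iff)
      have u0: "u \<cdot> (r0 C X \<cdot> t) = f \<cdot> t" if "t \<in> Hom C T (One C)" for T t
        using u u' that X by (auto simp: hom_iff simp flip: assoc)
      have u1: "u \<cdot> (r1 C X \<cdot> t) = g \<cdot> t" if "t \<in> Hom C T (Prod C X ?LX)" for T t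
        using u u' that X by (auto simp: hom_iff simp flip: assoc)
      show "\<langle>Snd C (One C) ?LX, u \<cdot> Snd C (One C) ?LX\<rangle> \<in> Hom C (Prod C (One C) ?LX) ?B"
        using u' X Z by (simp add: hom_iff)
      fix T a assume a: "a \<in> Hom C T (One C)"
      then have ab: "a = bang C T"
        using bang_unique by (auto simp: hom_iff)
      with a show "\<langle>Snd C (One C) ?LX, u \<cdot> Snd C (One C) ?LX\<rangle> \<cdot> \<langle>a, empty X T\<rangle> = g0 \<cdot> a"
        using X Z u' u0[OF a] fg by (simp add: hom_iff g0_def)
      fix x l assume xl: "x \<in> Hom C T X" "l \<in> Hom C T ?LX"
      let ?m = "\<langle>Snd C (One C) ?LX, u \<cdot> Snd C (One C) ?LX\<rangle>"
      show "?m \<cdot> \<langle>a, cons X x l\<rangle> = h \<cdot> \<langle>x, ?m \<cdot> \<langle>a, l\<rangle>\<rangle>"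
        using a xl X Z u' hp[of x T "\<langle>l, u \<cdot> l\<rangle>"] u1[of "\<langle>x,l\<rangle>" T] by (simp add: hom_iff)
    qed
    fix u u' assume u: "u \<in> Hom C ?LX Z \<and> u \<cdot> r0 C X = f \<and> u \<cdot> r1 C X = g"
      and u': "u' \<in> Hom C ?LX Z \<and> u' \<cdot> r0 C X = f \<and> u' \<cdot> r1 C X = g"
    have eq: "\<langle>Snd C (One C) ?LX, u \<cdot> Snd C (One C) ?LX\<rangle> = \<langle>Snd C (One C) ?LX, u' \<cdot> Snd C (One C) ?LX\<rangle>"
      by (rule list_recursive_unique[OF X g0 h rec[OF u] rec[OF u']])
    have "u = Snd C ?LX Z \<cdot> (\<langle>Snd C (One C) ?LX, u \<cdot> Snd C (One C) ?LX\<rangle> \<cdot> \<langle>bang C ?LX, Id C ?LX\<rangle>)"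
      using u X Z by (simp add: hom_iff)
    also have "\<dots> = u'"
      unfolding eq using u' X Z by (simp add: hom_iff)
    finally show "u = u'" .
  qed
qed (use X in \<open>auto simp: hom_iff\<close>)

text \<open>Extensivity, applied to the pullback of \<open>1 + X \<times> L X\<close> along
  \<open>l\<close>. The pullback property is recorded too: a stage over \<open>T\<close> at which
  \<open>l\<close> is empty, or a cons, factors through \<open>T0\<close>, or
  \<open>T1\<close>.\<close>

lemma list_split:
  assumes X: "X \<in> Obj C" and l: "l \<in> Hom C T (L C X)"
  obtains T0 T1 i j y where "is_coproduct C T0 T1 T i j"
    "is_pullback C l (r0 C X) T0 i (bang C T0)" "is_pullback C l (r1 C X) T1 j y"
    "i \<in> Hom C T0 T" "l \<cdot> i = empty X T0"
    "j \<in> Hom C T1 T" "l \<cdot> j = r1 C X \<cdot> y" "y \<in> Hom C T1 (Prod C X (L C X))"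
proof -
  note cop = list_coproduct[OF X]
  obtain T0 i q T1 j y where P: "is_pullback C l (r0 C X) T0 i q" "is_pullback C l (r1 C X) T1 j y"
    using ex_pullback_injection[OF cop, of l] l by (auto simp: hom_iff)
  note D = P[THEN pullbackD(1)] P[THEN pullbackD(2)] P[THEN pullbackD(3)]
  have "is_coproduct C T0 T1 T i j"
    using coproduct_iff_pullbacks[OF cop, of q T0 y T1 l T i j] l X P D by (simp add: hom_iff)
  moreover have "q = bang C T0"
    using D l X by (intro bang_eqI) (auto simp: hom_iff)
  ultimately show thesis
    using that[of T0 T1 i j y] P D l X by (simp add: hom_iff)
qed

text \<open>Arrows out of \<open>T\<close> are determined on the two pieces of
  \<open>list_split\<close>. Quantifying over all stages \<open>t\<close> of each kind spares later
  proofs from naming the pieces.\<close>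

lemma list_cases_eqI:
  assumes X: "X \<in> Obj C" and l: "l \<in> Hom C T (L C X)" and uv: "u \<in> Hom C T Z" "v \<in> Hom C T Z"
    and empty: "\<And>T' t. t \<in> Hom C T' T \<Longrightarrow> l \<cdot> t = empty X T' \<Longrightarrow> u \<cdot> t = v \<cdot> t"
    and cons: "\<And>T' t x r. t \<in> Hom C T' T \<Longrightarrow> x \<in> Hom C T' X \<Longrightarrow> r \<in> Hom C T' (L C X) \<Longrightarrow>
      l \<cdot> t = cons X x r \<Longrightarrow> u \<cdot> t = v \<cdot> t"
  shows "u = v"
proof -
  obtain T0 T1 i j y where P: "is_coproduct C T0 T1 T i j"
    and i: "i \<in> Hom C T0 T" "l \<cdot> i = empty X T0"
    and j: "j \<in> Hom C T1 T" "l \<cdot> j = r1 C X \<cdot> y" "y \<in> Hom C T1 (Prod C X (L C X))"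
    using list_split[OF X l] .
  have "u \<cdot> i = v \<cdot> i"
    by (rule empty[OF i])
  moreover have "u \<cdot> j = v \<cdot> j"
  proof (rule cons[OF j(1)])
    have "\<langle>Fst C X (L C X) \<cdot> y, Snd C X (L C X) \<cdot> y\<rangle> = y"
      using j X by (intro pair_eta) (auto simp: hom_iff)
    then show "l \<cdot> j = cons X (Fst C X (L C X) \<cdot> y) (Snd C X (L C X) \<cdot> y)"
      using j by simp
  qed (use j X in \<open>auto simp: hom_iff\<close>)
  ultimately show ?thesis
    using coproduct_eqI[OF P uv] by blast
qed

text \<open>A stage at which a list is both empty and nonempty is initial, so all parallel arrows
  out of it agree.\<close>

lemma empty_cons_absurd:
  assumes x: "x \<in> Hom C T X" and r: "r \<in> Hom C T (L C X)" and eq: "empty X T = cons X x r"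
    and uv: "u \<in> Hom C T Z" "v \<in> Hom C T Z"
  shows "u = v"
proof -
  have X: "X \<in> Obj C" and T: "T \<in> Obj C" and Z: "Z \<in> Obj C" using x uv by (auto simp: hom_iff)
  have l: "empty X T \<in> Hom C T (L C X)" using X T by (auto simp: hom_iff)
  obtain T0 T1 i j y where P: "is_coproduct C T0 T1 T i j"
    "is_pullback C (empty X T) (r0 C X) T0 i (bang C T0)" "is_pullback C (empty X T) (r1 C X) T1 j y"
    and ij: "i \<in> Hom C T0 T" "j \<in> Hom C T1 T"
    using list_split[OF X l] .
  have idT: "Id C T \<in> Hom C T (Dom C (empty X T))" "bang C T \<in> Hom C T (Dom C (r0 C X))"
    "\<langle>x, r\<rangle> \<in> Hom C T (Dom C (r1 C X))"
    using X T x r by (auto simp: hom_iff)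
  have idT': "empty X T \<cdot> Id C T = empty X T" using X T by simp
  obtain k0 where k0: "k0 \<in> Hom C T T0" "i \<cdot> k0 = Id C T"
    using P(2) T idT idT' unfolding is_pullback_def by metis
  obtain k1 where k1: "k1 \<in> Hom C T T1" "j \<cdot> k1 = Id C T"
    using P(3) T idT idT' eq unfolding is_pullback_def by metis
  have "u \<cdot> i \<in> Hom C T0 Z" "v \<cdot> j \<in> Hom C T1 Z" using uv ij by (auto simp: hom_iff)
  \<comment> \<open>\<open>w\<close> agrees with \<open>u\<close> on \<open>T0\<close> and with
    \<open>v\<close> on \<open>T1\<close>. The identity of \<open>T\<close> factors through both
    pieces, via \<open>k0\<close> and \<open>k1\<close>, so \<open>w\<close> equals both.\<close>
  then obtain w where w: "w \<in> Hom C T Z" "w \<cdot> i = u \<cdot> i" "w \<cdot> j = v \<cdot> j"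
    using P(1) Z unfolding is_coproduct_def by metis
  have "w = (w \<cdot> i) \<cdot> k0" using w(1) k0 ij by (simp add: hom_iff)
  also have "\<dots> = u" unfolding w(2) using uv k0 ij by (simp add: hom_iff)
  finally have "w = u" .
  moreover have "w = (w \<cdot> j) \<cdot> k1" using w(1) k1 ij by (simp add: hom_iff)
  then have "w = v" unfolding w(3) using uv k1 ij by (simp add: hom_iff)
  ultimately show ?thesis by simp
qed

text \<open>\<open>r1 C X\<close> is monic, being the second injection of the coproduct
  \<open>1 + X \<times> L X\<close>.\<close>

lemma cons_inject:
  assumes "x \<in> Hom C T X" "r \<in> Hom C T (L C X)" "x' \<in> Hom C T X" "r' \<in> Hom C T (L C X)"
    and "cons X x r = cons X x' r'"
  shows "x = x'" "r = r'"
proof -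
  have "\<langle>x, r\<rangle> = \<langle>x', r'\<rangle>"
    by (rule coproduct_inr_mono[OF list_coproduct, of X _ T]) (use assms in \<open>auto simp: hom_iff\<close>)
  then show "x = x'" "r = r'"
    using pair_eq_iff assms by metis+
qed

section \<open>The natural numbers as lists over the terminal object\<close>

lemma NN_Obj [simp]: "N \<in> Obj C"
  by (simp add: NN_def)

lemma zero_simps [simp]: "zero C \<in> Arr C" "Dom C (zero C) = One C" "Cod C (zero C) = N"
  by (simp_all add: zero_def NN_def)

lemma succ_simps [simp]: "succ C \<in> Arr C" "Dom C (succ C) = N" "Cod C (succ C) = N"
  by (simp_all add: succ_def NN_def)

abbreviation zero_at :: "'o \<Rightarrow> 'a" where
  "zero_at T \<equiv> zero C \<cdot> bang C T"

text \<open>A head in \<open>One C\<close> carries no information: it can only be the unique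
  arrow.\<close>

lemma cons_One: "x \<in> Arr C \<Longrightarrow> Cod C x = One C \<Longrightarrow> k \<in> Arr C \<Longrightarrow> Cod C k = N \<Longrightarrow> Dom C k = Dom C x
    \<Longrightarrow> cons (One C) x k = suc k"
  using bang_unique[of x] by (simp add: succ_def NN_def)

lemma nat_cases_eqI:
  assumes k: "k \<in> Hom C T N" and uv: "u \<in> Hom C T Z" "v \<in> Hom C T Z"
    and zero: "\<And>T' t. t \<in> Hom C T' T \<Longrightarrow> k \<cdot> t = zero_at T' \<Longrightarrow> u \<cdot> t = v \<cdot> t"
    and succ: "\<And>T' t n. t \<in> Hom C T' T \<Longrightarrow> n \<in> Hom C T' N \<Longrightarrow>
      k \<cdot> t = suc n \<Longrightarrow> u \<cdot> t = v \<cdot> t"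
  shows "u = v"
proof (rule list_cases_eqI[OF One_Obj _ uv])
  show "k \<in> Hom C T (L C (One C))" using k by (simp add: NN_def)
  show "u \<cdot> t = v \<cdot> t" if "t \<in> Hom C T' T" "k \<cdot> t = empty (One C) T'" for T' t
    using zero that by (simp add: zero_def)
  show "u \<cdot> t = v \<cdot> t"
    if "t \<in> Hom C T' T" "x \<in> Hom C T' (One C)" "r \<in> Hom C T' (L C (One C))" "k \<cdot> t = cons (One C) x r" for T' t x r
    using succ[OF that(1), of r] that cons_One[of x r] by (simp add: NN_def hom_iff)
qed

lemma zero_succ_absurd:
  assumes n: "n \<in> Hom C T N" and eq: "zero_at T = suc n"
    and uv: "u \<in> Hom C T Z" "v \<in> Hom C T Z"
  shows "u = v"
proof (rule empty_cons_absurd[OF _ _ _ uv])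
  show "bang C T \<in> Hom C T (One C)" "n \<in> Hom C T (L C (One C))"
    using n by (auto simp: hom_iff NN_def)
  show "empty (One C) T = cons (One C) (bang C T) n"
    using eq n cons_One[of "bang C T" n] by (simp add: hom_iff zero_def)
qed

text \<open>Stages at which \<open>c\<close> is zero are those that factor through \<open>i\<close>,
  so by Yoneda the natural family \<open>\<phi>\<close> is composition with \<open>\<phi> i\<close>;
  gluing this with \<open>b\<close> on the other piece gives \<open>h\<close>. Nothing is asked of
  \<open>\<phi>\<close> elsewhere, as befits entries that are prescribed only at indices below the
  length.\<close>

lemma if_zero:
  assumes c: "c \<in> Hom C W N" and b: "b \<in> Hom C W Z"
    and \<phi>: "\<And>T t. t \<in> Hom C T W \<Longrightarrow> c \<cdot> t = zero_at T \<Longrightarrow> \<phi> t \<in> Hom C T Z"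
    and natural: "\<And>T T' t r. t \<in> Hom C T W \<Longrightarrow> c \<cdot> t = zero_at T \<Longrightarrow> r \<in> Hom C T' T \<Longrightarrow>
      \<phi> (t \<cdot> r) = \<phi> t \<cdot> r"
  obtains h where "h \<in> Hom C W Z"
    "\<And>T t. t \<in> Hom C T W \<Longrightarrow> c \<cdot> t = zero_at T \<Longrightarrow> h \<cdot> t = \<phi> t"
    "\<And>T t n. t \<in> Hom C T W \<Longrightarrow> n \<in> Hom C T N \<Longrightarrow> c \<cdot> t = suc n \<Longrightarrow> h \<cdot> t = b \<cdot> t"
proof -
  have c': "c \<in> Hom C W (L C (One C))" using c by (simp add: NN_def)
  obtain T0 T1 i j y where P: "is_coproduct C T0 T1 W i j"
    "is_pullback C c (r0 C (One C)) T0 i (bang C T0)" "is_pullback C c (r1 C (One C)) T1 j y"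
    and i: "i \<in> Hom C T0 W" and ci: "c \<cdot> i = zero_at T0" and j: "j \<in> Hom C T1 W"
    using list_split[OF One_Obj c'] unfolding zero_def .
  have Z: "Z \<in> Obj C" and W: "W \<in> Obj C" using b by (auto simp: hom_iff)
  obtain h where h: "h \<in> Hom C W Z" "h \<cdot> i = \<phi> i" "h \<cdot> j = b \<cdot> j"
    using P(1) \<phi>[OF i ci] Comp_Hom[OF j b] Z unfolding is_coproduct_def by metis
  show thesis
  proof (rule that[OF h(1)])
    fix T t assume t: "t \<in> Hom C T W" and ct: "c \<cdot> t = zero_at T"
    have "t \<in> Hom C T (Dom C c)" "bang C T \<in> Hom C T (Dom C (r0 C (One C)))" "T \<in> Obj C"
      using t c by (auto simp: hom_iff)
    then obtain r where r: "r \<in> Hom C T T0" "i \<cdot> r = t"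
      using P(2) ct unfolding is_pullback_def zero_def by metis
    have "h \<cdot> t = (h \<cdot> i) \<cdot> r" using r h(1) i by (auto simp: hom_iff)
    with natural[OF i ci r(1)] show "h \<cdot> t = \<phi> t"
      unfolding h(2) r(2) by simp
  next
    fix T t n assume t: "t \<in> Hom C T W" and n: "n \<in> Hom C T N" and ct: "c \<cdot> t = suc n"
    have "t \<in> Hom C T (Dom C c)" "\<langle>bang C T, n\<rangle> \<in> Hom C T (Dom C (r1 C (One C)))" "T \<in> Obj C"
      using t n c by (auto simp: hom_iff NN_def)
    moreover have "c \<cdot> t = r1 C (One C) \<cdot> \<langle>bang C T, n\<rangle>"
      using ct n cons_One[of "bang C T" n] by (simp add: hom_iff)
    ultimately obtain r where r: "r \<in> Hom C T T1" "j \<cdot> r = t"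
      using P(3) unfolding is_pullback_def by metis
    have "h \<cdot> t = (h \<cdot> j) \<cdot> r" using r h(1) j by (auto simp: hom_iff)
    then show "h \<cdot> t = b \<cdot> t"
      unfolding h(3) using r b j by (auto simp: hom_iff)
  qed
qed

definition nat_recursive :: "'o \<Rightarrow> 'o \<Rightarrow> 'a \<Rightarrow> 'a \<Rightarrow> 'a \<Rightarrow> bool" where
  "nat_recursive A B g h f \<longleftrightarrow> f \<in> Hom C (Prod C A N) B \<and>
     (\<forall>T. \<forall>a \<in> Hom C T A. f \<cdot> \<langle>a, zero_at T\<rangle> = g \<cdot> a) \<and>
     (\<forall>T. \<forall>a \<in> Hom C T A. \<forall>k \<in> Hom C T N.
        f \<cdot> \<langle>a, suc k\<rangle> = h \<cdot> (f \<cdot> \<langle>a, k\<rangle>))"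

text \<open>List recursion over \<open>One C\<close> with a step that discards the head.\<close>

lemma nat_recursive_ex1:
  assumes g: "g \<in> Hom C A B" and h: "h \<in> Hom C B B"
  shows "\<exists>!f. nat_recursive A B g h f"
proof -
  have hS: "h \<cdot> Snd C (One C) B \<in> Hom C (Prod C (One C) B) B" using h by (auto simp: hom_iff)
  have "nat_recursive A B g h f \<longleftrightarrow> list_recursive (One C) A B g (h \<cdot> Snd C (One C) B) f" for f
  proof (cases "f \<in> Hom C (Prod C A N) B")
    case True
    have eq: "(h \<cdot> Snd C (One C) B) \<cdot> \<langle>x, f \<cdot> \<langle>a, l\<rangle>\<rangle> = h \<cdot> (f \<cdot> \<langle>a, l\<rangle>)" "cons (One C) x l = suc l"
      if "a \<in> Hom C T A" "x \<in> Hom C T (One C)" "l \<in> Hom C T N" for T a x l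
      using that True g h cons_One[of x l] by (auto simp: hom_iff)
    have "(\<forall>T. \<forall>a \<in> Hom C T A. \<forall>x \<in> Hom C T (One C). \<forall>l \<in> Hom C T (L C (One C)).
        f \<cdot> \<langle>a, cons (One C) x l\<rangle> = (h \<cdot> Snd C (One C) B) \<cdot> \<langle>x, f \<cdot> \<langle>a, l\<rangle>\<rangle>) \<longleftrightarrow>
      (\<forall>T. \<forall>a \<in> Hom C T A. \<forall>k \<in> Hom C T N.
        f \<cdot> \<langle>a, suc k\<rangle> = h \<cdot> (f \<cdot> \<langle>a, k\<rangle>))" (is "?l \<longleftrightarrow> ?r")
    proof
      assume l: ?l
      show ?r
      proof (intro allI ballI)
        fix T a k assume ak: "a \<in> Hom C T A" "k \<in> Hom C T N"
        have b: "bang C T \<in> Hom C T (One C)" using ak by (auto simp: hom_iff)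
        show "f \<cdot> \<langle>a, suc k\<rangle> = h \<cdot> (f \<cdot> \<langle>a, k\<rangle>)"
          using l ak b eq[OF ak(1) b ak(2)] unfolding NN_def by metis
      qed
    next
      assume r: ?r
      show ?l
      proof (intro allI ballI)
        fix T a x l assume a: "a \<in> Hom C T A" "x \<in> Hom C T (One C)" "l \<in> Hom C T (L C (One C))"
        then show "f \<cdot> \<langle>a, cons (One C) x l\<rangle> = (h \<cdot> Snd C (One C) B) \<cdot> \<langle>x, f \<cdot> \<langle>a, l\<rangle>\<rangle>"
          using r eq[of a T x l] unfolding NN_def by simp
      qed
    qed
    then show ?thesis
      unfolding nat_recursive_def list_recursive_def by (simp add: NN_def zero_def)
  qed (simp add: nat_recursive_def list_recursive_def NN_def)
  then show ?thesis
    using list_recursive_ex1[OF One_Obj g hS] by simp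
qed

text \<open>The equalizer of the two sides is closed under zero and successor, hence it is everything:
  the recursively defined section followed by the inclusion satisfies the recursion of the
  identity. Taking \<open>T\<close> itself as the parameter object allows hypotheses about the stage \<open>T\<close> in
  both the base and the step case.\<close>

lemma nat_induct_eqI:
  assumes k: "k \<in> Hom C T N"
    and F: "\<And>T' t k. t \<in> Hom C T' T \<Longrightarrow> k \<in> Hom C T' N \<Longrightarrow> F t k \<in> Hom C T' Z"
      "\<And>T' T'' t k r. t \<in> Hom C T' T \<Longrightarrow> k \<in> Hom C T' N \<Longrightarrow> r \<in> Hom C T'' T' \<Longrightarrow>
        F (t \<cdot> r) (k \<cdot> r) = F t k \<cdot> r"
    and G: "\<And>T' t k. t \<in> Hom C T' T \<Longrightarrow> k \<in> Hom C T' N \<Longrightarrow> G t k \<in> Hom C T' Z"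
      "\<And>T' T'' t k r. t \<in> Hom C T' T \<Longrightarrow> k \<in> Hom C T' N \<Longrightarrow> r \<in> Hom C T'' T' \<Longrightarrow>
        G (t \<cdot> r) (k \<cdot> r) = G t k \<cdot> r"
    and zero: "\<And>T' t. t \<in> Hom C T' T \<Longrightarrow> F t (zero_at T') = G t (zero_at T')"
    and succ: "\<And>T' t k. t \<in> Hom C T' T \<Longrightarrow> k \<in> Hom C T' N \<Longrightarrow> F t k = G t k \<Longrightarrow>
      F t (suc k) = G t (suc k)"
  shows "F (Id C T) k = G (Id C T) k"
proof -
  have T: "T \<in> Obj C" using k by (simp add: hom_iff)
  let ?P = "Prod C T N"
  \<comment> \<open>The values of \<open>F\<close> and \<open>G\<close> at the generic point of
    \<open>T \<times> N\<close>. By naturality every other value is obtained from \<open>u\<close>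
    or \<open>v\<close> by composition, so the claim becomes \<open>u = v\<close>.\<close>
  define u where "u = F (Fst C T N) (Snd C T N)"
  define v where "v = G (Fst C T N) (Snd C T N)"
  have uv: "u \<in> Hom C ?P Z" "v \<in> Hom C ?P Z"
    using F(1)[of "Fst C T N" ?P "Snd C T N"] G(1)[of "Fst C T N" ?P "Snd C T N"] T
    unfolding u_def v_def by (simp_all add: hom_iff)
  have uF: "u \<cdot> w = F (Fst C T N \<cdot> w) (Snd C T N \<cdot> w)"
    and vG: "v \<cdot> w = G (Fst C T N \<cdot> w) (Snd C T N \<cdot> w)" if "w \<in> Hom C S ?P" for w S
    using F(2)[of "Fst C T N" ?P "Snd C T N" w S] G(2)[of "Fst C T N" ?P "Snd C T N" w S] that T
    unfolding u_def v_def by (auto simp: hom_iff)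
  obtain S e where e: "is_equalizer C u v S e" using ex_equalizer[OF uv] by blast
  then have e': "e \<in> Hom C S ?P" "u \<cdot> e = v \<cdot> e" using uv by (auto simp: is_equalizer_def hom_iff)
  then have S: "S \<in> Obj C" by (simp add: hom_iff)
  have lift: "\<exists>w. w \<in> Hom C X S \<and> e \<cdot> w = y" if "y \<in> Hom C X ?P" "u \<cdot> y = v \<cdot> y" for X y
    using equalizer_lift[OF e] that uv by (metis hom_iff)
  define g where "g = \<langle>Id C T, zero_at T\<rangle>"
  define h where "h = \<langle>Fst C T N, succ C \<cdot> Snd C T N\<rangle>"
  have g: "g \<in> Hom C T ?P" and h: "h \<in> Hom C ?P ?P"
    using T by (auto simp: g_def h_def hom_iff)
  have "u \<cdot> g = v \<cdot> g"
    unfolding uF[OF g] vG[OF g] using zero[OF Id_Hom[OF T]] T by (simp add: g_def)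
  then obtain g' where g': "g' \<in> Hom C T S" "e \<cdot> g' = g" using lift[OF g] by blast
  have he: "h \<cdot> e \<in> Hom C S ?P" using h e' by (auto simp: hom_iff)
  \<comment> \<open>The equalizer itself serves as the stage: there \<open>F\<close> and
    \<open>G\<close> agree by construction, and the step case carries this to the successor.\<close>
  have "u \<cdot> (h \<cdot> e) = v \<cdot> (h \<cdot> e)"
    unfolding uF[OF he] vG[OF he]
    using succ[of "Fst C T N \<cdot> e" S "Snd C T N \<cdot> e"] e' T uF[OF e'(1)] vG[OF e'(1)]
    by (simp add: h_def hom_iff)
  then obtain h' where h': "h' \<in> Hom C S S" "e \<cdot> h' = h \<cdot> e" using lift[OF he] by blast
  obtain f where f: "nat_recursive T S g' h' f"
    using nat_recursive_ex1[OF g'(1) h'(1)] by blast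
  have f': "f \<in> Hom C ?P S" using f by (simp add: nat_recursive_def)
  have "nat_recursive T ?P g h (e \<cdot> f)"
    unfolding nat_recursive_def
  proof (intro conjI allI ballI)
    show "e \<cdot> f \<in> Hom C ?P ?P" using e' f' by (auto simp: hom_iff)
    fix T' a assume a: "a \<in> Hom C T' T"
    have "f \<cdot> \<langle>a, zero_at T'\<rangle> = g' \<cdot> a" using f a by (simp add: nat_recursive_def)
    then have "(e \<cdot> f) \<cdot> \<langle>a, zero_at T'\<rangle> = (e \<cdot> g') \<cdot> a"
      using e' f' a g'(1) by (simp add: hom_iff)
    then show "(e \<cdot> f) \<cdot> \<langle>a, zero_at T'\<rangle> = g \<cdot> a" using g' by simp
    fix k assume k: "k \<in> Hom C T' N"
    have "f \<cdot> \<langle>a, suc k\<rangle> = h' \<cdot> (f \<cdot> \<langle>a, k\<rangle>)" using f a k by (simp add: nat_recursive_def)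
    then have "(e \<cdot> f) \<cdot> \<langle>a, suc k\<rangle> = (e \<cdot> h') \<cdot> (f \<cdot> \<langle>a, k\<rangle>)"
      using e' f' a h'(1) k by (simp add: hom_iff)
    then show "(e \<cdot> f) \<cdot> \<langle>a, suc k\<rangle> = h \<cdot> ((e \<cdot> f) \<cdot> \<langle>a, k\<rangle>)"
      using h'(2) e' f' a h k by (simp add: hom_iff)
  qed
  moreover have "nat_recursive T ?P g h (Id C ?P)"
    unfolding nat_recursive_def g_def h_def using T by (auto simp: hom_iff)
  ultimately have ef: "e \<cdot> f = Id C ?P"
    using nat_recursive_ex1[OF g h] by blast
  have "u = (u \<cdot> e) \<cdot> f" using ef uv e'(1) f' by (auto simp: hom_iff)
  also have "\<dots> = (v \<cdot> e) \<cdot> f" unfolding e'(2) ..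
  also have "\<dots> = v" using ef uv e'(1) f' by (auto simp: hom_iff)
  finally have "u = v" .
  moreover have w: "\<langle>Id C T, k\<rangle> \<in> Hom C T ?P" using k T by (auto simp: hom_iff)
  ultimately show ?thesis
    using uF[OF w] vG[OF w] k T by (simp add: hom_iff)
qed

text \<open>The step of \<open>nat_recursive\<close> sees only the previous value. Parameter and
  counter are therefore carried along in \<open>(A \<times> N) \<times> B\<close>, and uniqueness of
  recursion shows that the carried copy is the actual argument.\<close>

lemma primitive_recursion:
  assumes g: "g \<in> Hom C A B" and h: "h \<in> Hom C (Prod C (Prod C A N) B) B"
  obtains f where "f \<in> Hom C (Prod C A N) B"
    "\<And>T a. a \<in> Hom C T A \<Longrightarrow> f \<cdot> \<langle>a, zero_at T\<rangle> = g \<cdot> a"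
    "\<And>T a k. a \<in> Hom C T A \<Longrightarrow> k \<in> Hom C T N \<Longrightarrow>
      f \<cdot> \<langle>a, suc k\<rangle> = h \<cdot> \<langle>\<langle>a, k\<rangle>, f \<cdot> \<langle>a, k\<rangle>\<rangle>"
proof -
  let ?P = "Prod C A N" let ?S = "Prod C ?P B"
  have A: "A \<in> Obj C" and B: "B \<in> Obj C" using g by (auto simp: hom_iff)
  define s where "s = \<langle>Fst C A N, succ C \<cdot> Snd C A N\<rangle>"
  define g' where "g' = \<langle>\<langle>Id C A, zero_at A\<rangle>, g\<rangle>"
  define h' where "h' = \<langle>s \<cdot> Fst C ?P B, h\<rangle>"
  have s: "s \<in> Hom C ?P ?P" using A by (auto simp: s_def hom_iff)
  have z: "\<langle>Id C A, zero_at A\<rangle> \<in> Hom C A ?P" using A by (auto simp: hom_iff)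
  have g': "g' \<in> Hom C A ?S" and h': "h' \<in> Hom C ?S ?S"
    using A B g h s by (auto simp: g'_def h'_def hom_iff)
  obtain f' where f': "nat_recursive A ?S g' h' f'" using nat_recursive_ex1[OF g' h'] by blast
  have F: "f' \<in> Hom C ?P ?S" using f' by (simp add: nat_recursive_def)
  have f0: "f' \<cdot> \<langle>a, zero_at T\<rangle> = g' \<cdot> a" if "a \<in> Hom C T A" for a T
    using f' that by (simp add: nat_recursive_def)
  have f1: "f' \<cdot> \<langle>a, suc k\<rangle> = h' \<cdot> (f' \<cdot> \<langle>a, k\<rangle>)" if "a \<in> Hom C T A" "k \<in> Hom C T N" for a k T
    using f' that by (simp add: nat_recursive_def)
  have "nat_recursive A ?P \<langle>Id C A, zero_at A\<rangle> s (Fst C ?P B \<cdot> f')"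
    unfolding nat_recursive_def
  proof (intro conjI allI ballI)
    show "Fst C ?P B \<cdot> f' \<in> Hom C ?P ?P" using A B F by (auto simp: hom_iff)
    fix T a assume a: "a \<in> Hom C T A"
    show "(Fst C ?P B \<cdot> f') \<cdot> \<langle>a, zero_at T\<rangle> = \<langle>Id C A, zero_at A\<rangle> \<cdot> a"
      using A B F a f0[OF a] g by (simp add: hom_iff g'_def)
    fix k assume k: "k \<in> Hom C T N"
    show "(Fst C ?P B \<cdot> f') \<cdot> \<langle>a, suc k\<rangle> = s \<cdot> ((Fst C ?P B \<cdot> f') \<cdot> \<langle>a, k\<rangle>)"
      using A B F a k f1[OF a k] s h by (simp add: hom_iff h'_def)
  qed
  moreover have "nat_recursive A ?P \<langle>Id C A, zero_at A\<rangle> s (Id C ?P)"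
    unfolding nat_recursive_def s_def using A by (auto simp: hom_iff)
  ultimately have id: "Fst C ?P B \<cdot> f' = Id C ?P"
    using nat_recursive_ex1[OF z s] by blast
  have eta: "f' \<cdot> w = \<langle>w, Snd C ?P B \<cdot> (f' \<cdot> w)\<rangle>" if "w \<in> Hom C T ?P" for w T
  proof -
    have "(Fst C ?P B \<cdot> f') \<cdot> w = w" unfolding id using that by (auto simp: hom_iff)
    then have "Fst C ?P B \<cdot> (f' \<cdot> w) = w" using that F A B by (simp add: hom_iff)
    with pair_eta[of "f' \<cdot> w" ?P B] show ?thesis using that F A B by (simp add: hom_iff)
  qed
  show thesis
  proof (rule that[of "Snd C ?P B \<cdot> f'"])
    show "Snd C ?P B \<cdot> f' \<in> Hom C ?P B" using A B F by (auto simp: hom_iff)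
    fix T a assume a: "a \<in> Hom C T A"
    show "(Snd C ?P B \<cdot> f') \<cdot> \<langle>a, zero_at T\<rangle> = g \<cdot> a"
      using A B F a f0[OF a] g by (simp add: hom_iff g'_def)
    fix k assume k: "k \<in> Hom C T N"
    show "(Snd C ?P B \<cdot> f') \<cdot> \<langle>a, suc k\<rangle> = h \<cdot> \<langle>\<langle>a, k\<rangle>, (Snd C ?P B \<cdot> f') \<cdot> \<langle>a, k\<rangle>\<rangle>"
      using A B F a k f1[OF a k] s h eta[of "\<langle>a, k\<rangle>" T] by (simp add: hom_iff h'_def)
  qed
qed

end

section \<open>Arithmetic\<close>

context extensive_list_category
begin

section \<open>Predecessor and truncated subtraction\<close>

abbreviation minus_at :: "'a \<Rightarrow> 'a \<Rightarrow> 'a" (infixl "\<ominus>" 65) where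
  "x \<ominus> y \<equiv> truncated_minus C \<cdot> \<langle>x, y\<rangle>"

text \<open>Shows that the \<open>THE\<close> in \<open>predecessor\<close> is well defined: by
  \<open>list_coproduct\<close>, \<open>N\<close> is \<open>1 + 1 \<times> N\<close>, and the arrow
  is zero on the left summand and the projection on the right one.\<close>

lemma predecessor_props:
  "predecessor C \<in> Hom C N N \<and> predecessor C \<cdot> zero C = zero C \<and>
    predecessor C \<cdot> succ C = Id C N"
  unfolding predecessor_def
proof (rule theI', rule ex_ex1I)
  have "zero C \<in> Hom C (One C) N" "Snd C (One C) N \<in> Hom C (Prod C (One C) N) N" "N \<in> Obj C"
    by (auto simp: hom_iff)
  then obtain u where u: "u \<in> Hom C N N" "u \<cdot> zero C = zero C" "u \<cdot> r1 C (One C) = Snd C (One C) N"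
    using list_coproduct[OF One_Obj] unfolding is_coproduct_def zero_def NN_def by metis
  have "u \<cdot> succ C = (u \<cdot> r1 C (One C)) \<cdot> \<langle>bang C N, Id C N\<rangle>"
    using u(1) by (simp add: succ_def hom_iff NN_def)
  also have "\<dots> = Id C N"
    unfolding u(3) by simp
  finally show "\<exists>p. p \<in> Hom C N N \<and> p \<cdot> zero C = zero C \<and> p \<cdot> succ C = Id C N"
    using u by blast
  fix p q assume p: "p \<in> Hom C N N \<and> p \<cdot> zero C = zero C \<and> p \<cdot> succ C = Id C N"
    and q: "q \<in> Hom C N N \<and> q \<cdot> zero C = zero C \<and> q \<cdot> succ C = Id C N"
  show "p = q"
  proof (rule nat_cases_eqI[of "Id C N" N])
    fix T t assume t: "t \<in> Hom C T N" "Id C N \<cdot> t = zero_at T"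
    then have "t = zero_at T" "T \<in> Obj C" by (auto simp: hom_iff)
    then show "p \<cdot> t = q \<cdot> t" using p q by (simp add: hom_iff flip: assoc)
  next
    fix T t n assume t: "t \<in> Hom C T N" "n \<in> Hom C T N" "Id C N \<cdot> t = suc n"
    then have "t = suc n" by (auto simp: hom_iff)
    then show "p \<cdot> t = q \<cdot> t" using p q t(2) by (simp add: hom_iff flip: assoc)
  qed (use p q in \<open>auto simp: hom_iff\<close>)
qed

lemma predecessor_simps [simp]:
  "predecessor C \<in> Arr C" "Dom C (predecessor C) = N" "Cod C (predecessor C) = N"
  "t \<in> Arr C \<Longrightarrow> Cod C t = One C \<Longrightarrow> pre (zero C \<cdot> t) = zero C \<cdot> t"
  "k \<in> Arr C \<Longrightarrow> Cod C k = N \<Longrightarrow> pre (suc k) = k"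
proof -
  show *: "predecessor C \<in> Arr C" "Dom C (predecessor C) = N" "Cod C (predecessor C) = N"
    using predecessor_props by (auto simp: hom_iff)
  show "pre (zero C \<cdot> t) = zero C \<cdot> t" if "t \<in> Arr C" "Cod C t = One C"
    using predecessor_props that * by (simp flip: assoc)
  show "pre (suc k) = k" if "k \<in> Arr C" "Cod C k = N"
    using predecessor_props that * by (simp flip: assoc)
qed

text \<open>The defining equations are the generic instances of this recursion, so the
  \<open>THE\<close> in \<open>truncated_minus\<close> is well defined and its equations hold at
  every stage.\<close>

lemma truncated_minus_recursive:
  "nat_recursive N N (Id C N) (predecessor C) (truncated_minus C)"
proof -
  let ?P = "Prod C N N"
  have iff: "nat_recursive N N (Id C N) (predecessor C) d \<longleftrightarrow> d \<in> Hom C ?P N \<and>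
     d \<cdot> \<langle>Id C N, zero_at N\<rangle> = Id C N \<and>
     d \<cdot> prod_arr C (Id C N) (succ C) = pre d" (is "_ \<longleftrightarrow> ?R d") for d
  proof
    assume d: "nat_recursive N N (Id C N) (predecessor C) d"
    show "?R d"
    proof (intro conjI)
      show "d \<cdot> \<langle>Id C N, zero_at N\<rangle> = Id C N"
        using d Id_Hom[of N] unfolding nat_recursive_def by force
      have "Fst C N N \<in> Hom C ?P N" "Snd C N N \<in> Hom C ?P N" by (auto simp: hom_iff)
      then have "d \<cdot> \<langle>Fst C N N, succ C \<cdot> Snd C N N\<rangle> = pre (d \<cdot> \<langle>Fst C N N, Snd C N N\<rangle>)"
        using d unfolding nat_recursive_def by blast
      then show "d \<cdot> prod_arr C (Id C N) (succ C) = pre d"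
        using d by (simp add: prod_arr_def nat_recursive_def hom_iff)
    qed (use d in \<open>simp add: nat_recursive_def\<close>)
  next
    assume d: "?R d"
    then have d': "d \<in> Arr C" "Dom C d = ?P" "Cod C d = N" by (auto simp: hom_iff)
    show "nat_recursive N N (Id C N) (predecessor C) d"
      unfolding nat_recursive_def
    proof (intro conjI allI ballI)
      fix T a assume a: "a \<in> Hom C T N"
      have "(d \<cdot> \<langle>Id C N, zero_at N\<rangle>) \<cdot> a = Id C N \<cdot> a" using d by simp
      then show "d \<cdot> \<langle>a, zero_at T\<rangle> = Id C N \<cdot> a"
        using a d' by (simp add: hom_iff)
      fix k assume k: "k \<in> Hom C T N"
      have "(d \<cdot> prod_arr C (Id C N) (succ C)) \<cdot> \<langle>a, k\<rangle> = (pre d) \<cdot> \<langle>a, k\<rangle>" using d by simp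
      then show "d \<cdot> \<langle>a, suc k\<rangle> = pre (d \<cdot> \<langle>a, k\<rangle>)"
        using a k d' by (simp add: hom_iff prod_arr_def)
    qed (use d in simp)
  qed
  have "\<exists>!d. nat_recursive N N (Id C N) (predecessor C) d"
    by (rule nat_recursive_ex1) (auto simp: hom_iff)
  from theI'[OF this[unfolded iff]] show ?thesis
    unfolding iff truncated_minus_def .
qed

lemma truncated_minus_simps [simp]:
  "truncated_minus C \<in> Arr C" "Dom C (truncated_minus C) = Prod C N N"
  "Cod C (truncated_minus C) = N"
  using truncated_minus_recursive by (auto simp: nat_recursive_def hom_iff)

lemma minus_zero [simp]:
  "x \<in> Arr C \<Longrightarrow> Cod C x = N \<Longrightarrow> Dom C x = T \<Longrightarrow> x \<ominus> zero_at T = x"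
  using truncated_minus_recursive by (auto simp: nat_recursive_def hom_iff)

lemma minus_succ [simp]:
  assumes "x \<in> Arr C" "Cod C x = N" "y \<in> Arr C" "Cod C y = N" "Dom C y = Dom C x"
  shows "x \<ominus> suc y = pre (x \<ominus> y)"
proof -
  have "x \<in> Hom C (Dom C x) N" "y \<in> Hom C (Dom C x) N" using assms by (auto simp: hom_iff)
  then show ?thesis
    using truncated_minus_recursive unfolding nat_recursive_def by blast
qed

text \<open>The pattern of all inductions below: \<open>k\<close> is the induction variable and
  \<open>t\<close> the change of stage along which the other arguments are reindexed, which makes
  \<open>F\<close> and \<open>G\<close> natural. The cases are left to the simplifier.\<close>

lemma succ_minus_succ:
  assumes "x \<in> Hom C T N" "y \<in> Hom C T N"
  shows "suc x \<ominus> suc y = x \<ominus> y"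
  using nat_induct_eqI[OF assms(2), where Z = "N" and F = "\<lambda>t k. suc (x \<cdot> t) \<ominus> suc k"
      and G = "\<lambda>t k. (x \<cdot> t) \<ominus> k"] assms
  by (simp add: hom_iff)

text \<open>\<open>Dom C k\<close> recovers the stage, which \<open>F\<close> and \<open>G\<close>
  do not receive. \<open>minus_succ\<close> is removed because it would turn
  \<open>suc k \<ominus> suc k\<close> into a predecessor and compete with
  \<open>succ_minus_succ\<close>.\<close>

lemma minus_self:
  assumes "x \<in> Hom C T N"
  shows "x \<ominus> x = zero_at T"
  using nat_induct_eqI[OF assms(1), where Z = "N" and F = "\<lambda>t k. k \<ominus> k"
      and G = "\<lambda>t k. zero_at (Dom C k)"] assms
  by (simp add: hom_iff succ_minus_succ[of x "Dom C x" y for x y, unfolded hom_iff] del: minus_succ)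

lemma zero_minus:
  assumes "x \<in> Hom C T N"
  shows "zero_at T \<ominus> x = zero_at T"
  using nat_induct_eqI[OF assms(1), where Z = "N" and F = "\<lambda>t k. zero_at (Dom C k) \<ominus> k"
      and G = "\<lambda>t k. zero_at (Dom C k)"] assms
  by (simp add: hom_iff)

lemma predecessor_minus:
  assumes "x \<in> Hom C T N" "y \<in> Hom C T N"
  shows "pre x \<ominus> y = pre (x \<ominus> y)"
  using nat_induct_eqI[OF assms(2), where Z = "N" and F = "\<lambda>t k. pre (x \<cdot> t) \<ominus> k"
      and G = "\<lambda>t k. pre ((x \<cdot> t) \<ominus> k)"] assms
  by (simp add: hom_iff)

text \<open>The bound \<open>x \<ominus> y \<le> x\<close>, written as an equation.\<close>

lemma minus_minus_self:
  assumes "x \<in> Hom C T N" "y \<in> Hom C T N"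
  shows "(x \<ominus> y) \<ominus> x = zero_at T"
  using nat_induct_eqI[OF assms(2), where Z = "N" and F = "\<lambda>t k. ((x \<cdot> t) \<ominus> k) \<ominus> (x \<cdot> t)"
      and G = "\<lambda>t k. zero_at (Dom C k)"] assms
  by (simp add: hom_iff predecessor_minus[of x "Dom C x" y for x y, unfolded hom_iff] minus_self[of x "Dom C x" for x, unfolded hom_iff])

text \<open>Walk up the diagonal from \<open>(x - n, 0)\<close> to \<open>(x, n)\<close>: induction on \<open>k\<close> proves the claim at
  \<open>(x - (n - k), n - (n - k))\<close>, because truncated subtraction makes the walk stop at \<open>(x, n)\<close>.\<close>

lemma diagonal_induct_eqI:
  assumes x: "x \<in> Hom C T N" and n: "n \<in> Hom C T N"
    and F: "\<And>T x n. x \<in> Hom C T N \<Longrightarrow> n \<in> Hom C T N \<Longrightarrow> F x n \<in> Hom C T Z"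
      "\<And>T T' x n r. x \<in> Hom C T N \<Longrightarrow> n \<in> Hom C T N \<Longrightarrow> r \<in> Hom C T' T \<Longrightarrow>
        F (x \<cdot> r) (n \<cdot> r) = F x n \<cdot> r"
    and G: "\<And>T x n. x \<in> Hom C T N \<Longrightarrow> n \<in> Hom C T N \<Longrightarrow> G x n \<in> Hom C T Z"
      "\<And>T T' x n r. x \<in> Hom C T N \<Longrightarrow> n \<in> Hom C T N \<Longrightarrow> r \<in> Hom C T' T \<Longrightarrow>
        G (x \<cdot> r) (n \<cdot> r) = G x n \<cdot> r"
    and zero2: "\<And>T x. x \<in> Hom C T N \<Longrightarrow> F x (zero_at T) = G x (zero_at T)"
    and zero1: "\<And>T n. n \<in> Hom C T N \<Longrightarrow> F (zero_at T) n = G (zero_at T) n"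
    and succ: "\<And>T x n. x \<in> Hom C T N \<Longrightarrow> n \<in> Hom C T N \<Longrightarrow> F x n = G x n \<Longrightarrow>
      F (suc x) (suc n) = G (suc x) (suc n)"
  shows "F x n = G x n"
proof -
  \<comment> \<open>One step of the walk, upwards. If \<open>x\<close> or \<open>n\<close> is zero,
    a base case applies; otherwise both are successors, and \<open>succ\<close> passes from their
    predecessors to them.\<close>
  have pred: "F x n = G x n"
    if x: "x \<in> Hom C T N" and n: "n \<in> Hom C T N"
      and IH: "F (pre x) (pre n) = G (pre x) (pre n)"
    for x n T
  proof (rule nat_cases_eqI[OF x F(1)[OF x n] G(1)[OF x n]])
    fix T' t assume t: "t \<in> Hom C T' T" "x \<cdot> t = zero_at T'"
    have "n \<cdot> t \<in> Hom C T' N" using n t by (auto simp: hom_iff)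
    from zero1[OF this] show "F x n \<cdot> t = G x n \<cdot> t"
      using F(2)[OF x n t(1)] G(2)[OF x n t(1)] t(2) by simp
  next
    fix T' t y assume t: "t \<in> Hom C T' T" and y: "y \<in> Hom C T' N" "x \<cdot> t = suc y"
    have nt: "n \<cdot> t \<in> Hom C T' N" and xt: "x \<cdot> t \<in> Hom C T' N" using x n t by (auto simp: hom_iff)
    have "F (x \<cdot> t) (n \<cdot> t) = G (x \<cdot> t) (n \<cdot> t)"
    proof (rule nat_cases_eqI[OF nt F(1)[OF xt nt] G(1)[OF xt nt]])
      fix T'' t' assume t': "t' \<in> Hom C T'' T'" "(n \<cdot> t) \<cdot> t' = zero_at T''"
      have "(x \<cdot> t) \<cdot> t' \<in> Hom C T'' N" using xt t' by (auto simp: hom_iff)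
      from zero2[OF this] show "F (x \<cdot> t) (n \<cdot> t) \<cdot> t' = G (x \<cdot> t) (n \<cdot> t) \<cdot> t'"
        using F(2)[OF xt nt t'(1)] G(2)[OF xt nt t'(1)] t'(2) by simp
    next
      fix T'' t' m assume t': "t' \<in> Hom C T'' T'" and m: "m \<in> Hom C T'' N" "(n \<cdot> t) \<cdot> t' = suc m"
      have yt: "y \<cdot> t' \<in> Hom C T'' N" using y t' by (auto simp: hom_iff)
      have xtt: "(x \<cdot> t) \<cdot> t' = suc (y \<cdot> t')" unfolding y(2) using y(1) t' by (simp add: hom_iff)
      have p: "pre x \<in> Hom C T N" "pre n \<in> Hom C T N"
        and tt: "t \<cdot> t' \<in> Hom C T'' T" using x n t t' by (auto simp: hom_iff)
      have "(pre x) \<cdot> (t \<cdot> t') = pre ((x \<cdot> t) \<cdot> t')"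
        "(pre n) \<cdot> (t \<cdot> t') = pre ((n \<cdot> t) \<cdot> t')"
        using x n t t' by (simp_all add: hom_iff)
      then have pxt: "(pre x) \<cdot> (t \<cdot> t') = y \<cdot> t'" "(pre n) \<cdot> (t \<cdot> t') = m"
        unfolding xtt m(2) using yt m by (simp_all add: hom_iff)
      have "F (y \<cdot> t') m = G (y \<cdot> t') m"
        using F(2)[OF p tt] G(2)[OF p tt] IH pxt by simp
      from succ[OF yt m(1) this] show "F (x \<cdot> t) (n \<cdot> t) \<cdot> t' = G (x \<cdot> t) (n \<cdot> t) \<cdot> t'"
        using F(2)[OF xt nt t'] G(2)[OF xt nt t'] xtt m(2) by simp
    qed
    then show "F x n \<cdot> t = G x n \<cdot> t"
      using F(2)[OF x n t(1)] G(2)[OF x n t(1)] by simp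
  qed
  define D where "D t k = (n \<cdot> t) \<ominus> k" for t k
  have D: "D t k \<in> Hom C T' N" if "t \<in> Hom C T' T" "k \<in> Hom C T' N" for t k T'
    using that n unfolding D_def by (auto simp: hom_iff)
  have Dr: "D (t \<cdot> r) (k \<cdot> r) = D t k \<cdot> r" if "t \<in> Hom C T' T" "k \<in> Hom C T' N" "r \<in> Hom C T'' T'" for t k r T' T''
    using that n unfolding D_def by (auto simp: hom_iff)
  let ?x = "\<lambda>t k. (x \<cdot> t) \<ominus> D t k" and ?n = "\<lambda>t k. (n \<cdot> t) \<ominus> D t k"
  have xn: "?x t k \<in> Hom C T' N" "?n t k \<in> Hom C T' N" if "t \<in> Hom C T' T" "k \<in> Hom C T' N" for t k T'
    using that D[OF that] x n by (auto simp: hom_iff)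
  have xnr: "?x (t \<cdot> r) (k \<cdot> r) = ?x t k \<cdot> r" "?n (t \<cdot> r) (k \<cdot> r) = ?n t k \<cdot> r"
    if "t \<in> Hom C T' T" "k \<in> Hom C T' N" "r \<in> Hom C T'' T'" for t k r T' T''
    using that D[OF that(1,2)] x n unfolding Dr[OF that] by (auto simp: hom_iff)
  have "F (?x (Id C T) n) (?n (Id C T) n) = G (?x (Id C T) n) (?n (Id C T) n)"
  proof (rule nat_induct_eqI[OF n, where F = "\<lambda>t k. F (?x t k) (?n t k)" and G = "\<lambda>t k. G (?x t k) (?n t k)"])
    fix T' t k assume tk: "t \<in> Hom C T' T" "k \<in> Hom C T' N"
    show "F (?x t k) (?n t k) \<in> Hom C T' Z" "G (?x t k) (?n t k) \<in> Hom C T' Z"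
      using F(1) G(1) xn[OF tk] by blast+
    fix T'' r assume r: "r \<in> Hom C T'' T'"
    show "F (?x (t \<cdot> r) (k \<cdot> r)) (?n (t \<cdot> r) (k \<cdot> r)) = F (?x t k) (?n t k) \<cdot> r"
      "G (?x (t \<cdot> r) (k \<cdot> r)) (?n (t \<cdot> r) (k \<cdot> r)) = G (?x t k) (?n t k) \<cdot> r"
      unfolding xnr[OF tk r] using F(2) G(2) xn[OF tk] r by blast+
  next
    fix T' t assume t: "t \<in> Hom C T' T"
    then have nt: "n \<cdot> t \<in> Hom C T' N" and z: "zero_at T' \<in> Hom C T' N" using n by (auto simp: hom_iff)
    have "D t (zero_at T') = n \<cdot> t" using nt unfolding D_def by (auto simp: hom_iff)
    then have "?n t (zero_at T') = zero_at T'" using minus_self[OF nt] by simp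
    then show "F (?x t (zero_at T')) (?n t (zero_at T')) = G (?x t (zero_at T')) (?n t (zero_at T'))"
      using zero2 xn(1)[OF t z] by simp
  next
    fix T' t k assume t: "t \<in> Hom C T' T" and k: "k \<in> Hom C T' N"
      and IH: "F (?x t k) (?n t k) = G (?x t k) (?n t k)"
    have sk: "suc k \<in> Hom C T' N" using k by (auto simp: hom_iff)
    have Ds: "D t (suc k) = predecessor C \<cdot> D t k"
      using t k n unfolding D_def by (auto simp: hom_iff)
    note xs = xn[OF t sk]
    show "F (?x t (suc k)) (?n t (suc k)) = G (?x t (suc k)) (?n t (suc k))"
    proof (rule nat_cases_eqI[OF D[OF t k] F(1)[OF xs] G(1)[OF xs]])
      fix S r assume r: "r \<in> Hom C S T'" and z: "D t k \<cdot> r = zero_at S"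
      \<comment> \<open>The remaining distance is zero and \<open>P 0 = 0\<close>, so the walk
        stands still and the induction hypothesis is the goal.\<close>
      have "D t (suc k) \<cdot> r = D t k \<cdot> r"
        unfolding Ds using z r D[OF t k] by (simp add: hom_iff)
      moreover have "?x t (suc k) \<cdot> r = (x \<cdot> (t \<cdot> r)) \<ominus> (D t (suc k) \<cdot> r)"
          "?n t (suc k) \<cdot> r = (n \<cdot> (t \<cdot> r)) \<ominus> (D t (suc k) \<cdot> r)"
          "?x t k \<cdot> r = (x \<cdot> (t \<cdot> r)) \<ominus> (D t k \<cdot> r)" "?n t k \<cdot> r = (n \<cdot> (t \<cdot> r)) \<ominus> (D t k \<cdot> r)"
        using r t x n D[OF t k] D[OF t sk] by (simp_all add: hom_iff)
      ultimately have e: "?x t (suc k) \<cdot> r = ?x t k \<cdot> r" "?n t (suc k) \<cdot> r = ?n t k \<cdot> r"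
        by simp_all
      show "F (?x t (suc k)) (?n t (suc k)) \<cdot> r = G (?x t (suc k)) (?n t (suc k)) \<cdot> r"
        using F(2)[OF xs r] G(2)[OF xs r] F(2)[OF xn[OF t k] r] G(2)[OF xn[OF t k] r] IH e by simp
    next
      fix S r j assume r: "r \<in> Hom C S T'" and j: "j \<in> Hom C S N" and s: "D t k \<cdot> r = suc j"
      \<comment> \<open>The remaining distance falls from \<open>j + 1\<close> to \<open>j\<close>.
        The point reached at \<open>k\<close> is thus the componentwise predecessor of the point
        \<open>(x - j, n - j)\<close> reached at \<open>suc k\<close>, as \<open>pred\<close>
        requires.\<close>
      have Dj: "D t (suc k) \<cdot> r = j"
        unfolding Ds using s j r D[OF t k] by (simp add: hom_iff)
      have *: "?x t (suc k) \<cdot> r = (x \<cdot> (t \<cdot> r)) \<ominus> j"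
          "?n t (suc k) \<cdot> r = (n \<cdot> (t \<cdot> r)) \<ominus> j"
          "?x t k \<cdot> r = pre ((x \<cdot> (t \<cdot> r)) \<ominus> j)" "?n t k \<cdot> r = pre ((n \<cdot> (t \<cdot> r)) \<ominus> j)"
        using r t x n D[OF t k] D[OF t sk] Dj s j by (simp_all add: hom_iff)
      have xj: "(x \<cdot> (t \<cdot> r)) \<ominus> j \<in> Hom C S N" "(n \<cdot> (t \<cdot> r)) \<ominus> j \<in> Hom C S N"
        using x n t r j by (auto simp: hom_iff)
      have "F ((x \<cdot> (t \<cdot> r)) \<ominus> j) ((n \<cdot> (t \<cdot> r)) \<ominus> j) = G ((x \<cdot> (t \<cdot> r)) \<ominus> j) ((n \<cdot> (t \<cdot> r)) \<ominus> j)"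
        by (rule pred[OF xj]) (metis * F(2)[OF xn[OF t k] r] G(2)[OF xn[OF t k] r] IH)
      then show "F (?x t (suc k)) (?n t (suc k)) \<cdot> r = G (?x t (suc k)) (?n t (suc k)) \<cdot> r"
        using F(2)[OF xs r] G(2)[OF xs r] * by simp
    qed
  qed
  moreover have "D (Id C T) n = zero_at T" using n minus_self[OF n] unfolding D_def by (simp add: hom_iff)
  ultimately show ?thesis using x n by (simp add: hom_iff)
qed

section \<open>Addition, and order facts as equations between truncated differences\<close>

definition plus :: 'a where
  "plus = (THE f. nat_recursive N N (Id C N) (succ C) f)"

abbreviation plus_at :: "'a \<Rightarrow> 'a \<Rightarrow> 'a" (infixl "\<oplus>" 65) where
  "x \<oplus> y \<equiv> plus \<cdot> \<langle>x, y\<rangle>"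

lemma plus_recursive: "nat_recursive N N (Id C N) (succ C) plus"
  unfolding plus_def by (rule theI', rule nat_recursive_ex1) (auto simp: hom_iff)

lemma plus_simps [simp]:
  "plus \<in> Arr C" "Dom C plus = Prod C N N" "Cod C plus = N"
  using plus_recursive by (auto simp: nat_recursive_def hom_iff)

lemma plus_zero [simp]:
  "x \<in> Arr C \<Longrightarrow> Cod C x = N \<Longrightarrow> Dom C x = T \<Longrightarrow> x \<oplus> zero_at T = x"
  using plus_recursive by (auto simp: nat_recursive_def hom_iff)

lemma plus_succ [simp]:
  assumes "x \<in> Arr C" "Cod C x = N" "y \<in> Arr C" "Cod C y = N" "Dom C y = Dom C x"
  shows "x \<oplus> suc y = suc (x \<oplus> y)"
proof -
  have "x \<in> Hom C (Dom C x) N" "y \<in> Hom C (Dom C x) N" using assms by (auto simp: hom_iff)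
  then show ?thesis
    using plus_recursive unfolding nat_recursive_def by blast
qed

lemma zero_plus:
  assumes "x \<in> Hom C T N"
  shows "zero_at T \<oplus> x = x"
  using nat_induct_eqI[OF assms(1), where Z = "N" and F = "\<lambda>t k. zero_at (Dom C k) \<oplus> k"
      and G = "\<lambda>t k. k"] assms
  by (simp add: hom_iff)

lemma succ_plus:
  assumes "x \<in> Hom C T N" "y \<in> Hom C T N"
  shows "suc x \<oplus> y = suc (x \<oplus> y)"
  using nat_induct_eqI[OF assms(2), where Z = "N" and F = "\<lambda>t k. suc (x \<cdot> t) \<oplus> k"
      and G = "\<lambda>t k. suc ((x \<cdot> t) \<oplus> k)"] assms
  by (simp add: hom_iff)

lemma plus_minus_cancel_right:
  assumes "x \<in> Hom C T N" "y \<in> Hom C T N"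
  shows "(x \<oplus> y) \<ominus> y = x"
  using nat_induct_eqI[OF assms(2), where Z = "N" and F = "\<lambda>t k. ((x \<cdot> t) \<oplus> k) \<ominus> k"
      and G = "\<lambda>t k. x \<cdot> t"] assms
  by (simp add: hom_iff succ_minus_succ[of x "Dom C x" y for x y, unfolded hom_iff] del: minus_succ)

lemma plus_minus_cancel_left:
  assumes "x \<in> Hom C T N" "y \<in> Hom C T N"
  shows "(x \<oplus> y) \<ominus> x = y"
  using nat_induct_eqI[OF assms(1), where Z = "N" and F = "\<lambda>t k. (k \<oplus> (y \<cdot> t)) \<ominus> k"
      and G = "\<lambda>t k. y \<cdot> t"] assms
  by (simp add: hom_iff succ_minus_succ[of x "Dom C x" y for x y, unfolded hom_iff] succ_plus[of x "Dom C x" y for x y, unfolded hom_iff] zero_plus[unfolded hom_iff]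
      del: minus_succ)

text \<open>Both sides compute the maximum. This identity is the source of the order facts below:
  where one of the two differences vanishes, it says that the other subtraction is exact. Its step
  increases \<open>x\<close> and \<open>y\<close> together, whence the induction along the
  diagonal.\<close>

lemma plus_minus_commute:
  assumes "x \<in> Hom C T N" "y \<in> Hom C T N"
  shows "x \<oplus> (y \<ominus> x) = y \<oplus> (x \<ominus> y)"
  using diagonal_induct_eqI[OF assms, where Z = "N" and F = "\<lambda>x y. x \<oplus> (y \<ominus> x)"
      and G = "\<lambda>x y. y \<oplus> (x \<ominus> y)"] assms
  by (simp add: hom_iff succ_minus_succ[of x "Dom C x" y for x y, unfolded hom_iff] succ_plus[of x "Dom C x" y for x y, unfolded hom_iff] zero_plus[unfolded hom_iff]
      zero_minus[unfolded hom_iff] del: minus_succ)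

lemma le_imp_plus:
  assumes "x \<in> Hom C T N" "y \<in> Hom C T N" "x \<ominus> y = zero_at T"
  shows "x \<oplus> (y \<ominus> x) = y"
  using plus_minus_commute[OF assms(1,2)] assms by (simp add: hom_iff)

text \<open>Write \<open>y\<close> as \<open>x \<oplus> (y \<ominus> x)\<close> and cancel the right
  summand. Applied to lists: dropping \<open>n - k\<close> of \<open>n\<close> entries leaves
  \<open>k\<close>.\<close>

lemma le_imp_minus_minus:
  assumes x: "x \<in> Hom C T N" and y: "y \<in> Hom C T N" and le: "x \<ominus> y = zero_at T"
  shows "y \<ominus> (y \<ominus> x) = x"
proof -
  have "y \<ominus> x \<in> Hom C T N" using x y by (auto simp: hom_iff)
  from plus_minus_cancel_right[OF x this] show ?thesis
    unfolding le_imp_plus[OF assms] .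
qed

lemma less_imp_le:
  assumes "x \<in> Hom C T N" "y \<in> Hom C T N" "suc x \<ominus> y = zero_at T"
  shows "x \<ominus> y = zero_at T"
proof -
  have "suc x \<in> Hom C T N" using assms by (auto simp: hom_iff)
  from predecessor_minus[OF this assms(2)] show ?thesis
    using assms by (simp add: hom_iff)
qed

text \<open>With \<open>d\<close> the left-hand difference, \<open>y\<close> is
  \<open>suc x \<oplus> d\<close> and hence \<open>x \<oplus> suc d\<close>; cancelling
  \<open>x\<close> gives the claim. It says that passing from \<open>x\<close> to
  \<open>suc x\<close> loses nothing to truncation.\<close>

lemma less_imp_succ_minus:
  assumes x: "x \<in> Hom C T N" and y: "y \<in> Hom C T N" and le: "suc x \<ominus> y = zero_at T"
  shows "suc (y \<ominus> suc x) = y \<ominus> x"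
proof -
  define d where "d = y \<ominus> suc x"
  have d: "d \<in> Hom C T N" "suc d \<in> Hom C T N" "suc x \<in> Hom C T N"
    using x y unfolding d_def by (auto simp: hom_iff)
  have "y = suc x \<oplus> d"
    using le_imp_plus[OF d(3) y le] unfolding d_def by simp
  then have "y = x \<oplus> suc d"
    using succ_plus[OF x d(1)] x d by (simp add: hom_iff)
  then show ?thesis
    using plus_minus_cancel_left[OF x d(2)] unfolding d_def by simp
qed

text \<open>Linearity of the order, by cases on \<open>y \<ominus> x\<close>. If it is
  \<open>suc v\<close>, evaluating \<open>plus_minus_commute\<close> at \<open>(x, y)\<close> and at
  \<open>(suc x, y)\<close> gives \<open>x + v + 1 = y + w\<close> and
  \<open>x + v + 1 = y + w + 1\<close>. Such a stage is contradictory, so the required equation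
  holds there as well.\<close>

lemma not_less_imp_minus:
  assumes x: "x \<in> Hom C T N" and y: "y \<in> Hom C T N" and w: "w \<in> Hom C T N"
    and ge: "suc x \<ominus> y = suc w"
  shows "y \<ominus> x = zero_at T"
proof -
  have yx: "y \<ominus> x \<in> Hom C T N" and z: "zero_at T \<in> Hom C T N"
    using x y by (auto simp: hom_iff)
  show ?thesis
  proof (rule nat_cases_eqI[OF yx yx z])
    fix T' t v assume t: "t \<in> Hom C T' T" and v: "v \<in> Hom C T' N" and s: "(y \<ominus> x) \<cdot> t = suc v"
    define x' y' w' where "x' = x \<cdot> t" and "y' = y \<cdot> t" and "w' = w \<cdot> t"
    have h: "x' \<in> Hom C T' N" "y' \<in> Hom C T' N" "w' \<in> Hom C T' N" "suc x' \<in> Hom C T' N"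
      using x y w t unfolding x'_def y'_def w'_def by (auto simp: hom_iff)
    have "(suc x \<ominus> y) \<cdot> t = (suc w) \<cdot> t" unfolding ge ..
    then have ge': "suc x' \<ominus> y' = suc w'"
      using x y w t unfolding x'_def y'_def w'_def by (simp add: hom_iff)
    have s': "y' \<ominus> x' = suc v"
      using s x y t unfolding x'_def y'_def by (simp add: hom_iff)
    have "x' \<ominus> y' = w'"
    proof -
      have "x' \<ominus> y' = pre (suc x' \<ominus> y')"
        using predecessor_minus[OF h(4,2)] h by (simp add: hom_iff)
      then show ?thesis unfolding ge' using h by (simp add: hom_iff)
    qed
    then have e1: "suc (x' \<oplus> v) = y' \<oplus> w'"
      using plus_minus_commute[OF h(1,2)] s' h v by (simp add: hom_iff)
    have "y' \<ominus> suc x' = v"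
      using h v s' by (simp add: hom_iff)
    then have "suc (x' \<oplus> v) = suc (y' \<oplus> w')"
      using plus_minus_commute[OF h(4,2)] succ_plus[OF h(1) v] ge' h v by (simp add: hom_iff)
    then have e2: "y' \<oplus> w' = suc (y' \<oplus> w')"
      using e1 by simp
    define q where "q = y' \<oplus> w'"
    have q: "q \<in> Hom C T' N" "suc q = q"
      using e2 h unfolding q_def by (auto simp: hom_iff)
    \<comment> \<open>From \<open>q = q + 1\<close> follows
      \<open>0 = q - q = (q + 1) - q = 1\<close>.\<close>
    have "zero_at T' = suc q \<ominus> q"
      using minus_self[OF q(1)] unfolding q(2) by simp
    also have "\<dots> = suc (q \<oplus> zero_at T') \<ominus> q"
      using q by (simp add: hom_iff)
    also have "\<dots> = (q \<oplus> suc (zero_at T')) \<ominus> q"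
      using q by (simp add: hom_iff)
    also have "\<dots> = suc (zero_at T')"
      by (rule plus_minus_cancel_left) (use q in \<open>auto simp: hom_iff\<close>)
    finally show "(y \<ominus> x) \<cdot> t = zero_at T \<cdot> t"
      by (rule zero_succ_absurd[rotated]) (use x y t in \<open>auto simp: hom_iff\<close>)
  qed (use x y in \<open>auto simp: hom_iff\<close>)
qed

end

section \<open>Lists and their entries\<close>

context extensive_list_category
begin

text \<open>Recursion with trivial parameter object \<open>One C\<close>; the parameter is then
  removed by composing with \<open>\<langle>bang C (L C X), Id C (L C X)\<rangle>\<close>.\<close>

lemma list_fold_ex1:
  assumes X: "X \<in> Obj C" and g: "g \<in> Hom C (One C) B" and h: "h \<in> Hom C (Prod C X B) B"
  shows "\<exists>!k. k \<in> Hom C (L C X) B \<and> k \<cdot> r0 C X = g \<and>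
    (\<forall>T. \<forall>x \<in> Hom C T X. \<forall>l \<in> Hom C T (L C X). k \<cdot> cons X x l = h \<cdot> \<langle>x, k \<cdot> l\<rangle>)"
    (is "\<exists>!k. ?P k")
proof (rule ex_ex1I)
  let ?i = "\<langle>bang C (L C X), Id C (L C X)\<rangle>"
  obtain f where f: "list_recursive X (One C) B g h f"
    using list_recursive_ex1[OF X g h] by blast
  have f': "f \<in> Arr C" "Dom C f = Prod C (One C) (L C X)" "Cod C f = B"
    using f by (auto simp: list_recursive_def hom_iff)
  have f0: "f \<cdot> \<langle>a, empty X T\<rangle> = g \<cdot> a" if "a \<in> Hom C T (One C)" for T a
    using f that by (simp add: list_recursive_def)
  have f1: "f \<cdot> \<langle>a, cons X x l\<rangle> = h \<cdot> \<langle>x, f \<cdot> \<langle>a, l\<rangle>\<rangle>"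
    if "a \<in> Hom C T (One C)" "x \<in> Hom C T X" "l \<in> Hom C T (L C X)" for T a x l
    using f that by (simp add: list_recursive_def)
  have "?P (f \<cdot> ?i)"
  proof (intro conjI allI ballI)
    show "f \<cdot> ?i \<in> Hom C (L C X) B" using f' X g by (auto simp: hom_iff)
    show "(f \<cdot> ?i) \<cdot> r0 C X = g"
      using f' X g f0[of "Id C (One C)" "One C"] by (simp add: hom_iff)
    fix T x l assume xl: "x \<in> Hom C T X" "l \<in> Hom C T (L C X)"
    show "(f \<cdot> ?i) \<cdot> cons X x l = h \<cdot> \<langle>x, (f \<cdot> ?i) \<cdot> l\<rangle>"
      using f' X g f1[of "bang C T" T x l] xl by (simp add: hom_iff)
  qed
  then show "\<exists>k. ?P k" by blast
next
  fix k k' assume k: "?P k" and k': "?P k'"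
  let ?S = "Snd C (One C) (L C X)"
  have rec: "list_recursive X (One C) B g h (k \<cdot> ?S)" if k: "?P k" for k
    unfolding list_recursive_def
  proof (intro conjI allI ballI)
    have K: "k \<in> Arr C" "Dom C k = L C X" "Cod C k = B" using k by (auto simp: hom_iff)
    show "k \<cdot> ?S \<in> Hom C (Prod C (One C) (L C X)) B" using K X by (auto simp: hom_iff)
    fix T a assume a: "a \<in> Hom C T (One C)"
    have "(k \<cdot> r0 C X) \<cdot> a = g \<cdot> a" using k by simp
    then show "(k \<cdot> ?S) \<cdot> \<langle>a, empty X T\<rangle> = g \<cdot> a"
      using K X a bang_eqI[OF a] by (simp add: hom_iff)
    fix x l assume xl: "x \<in> Hom C T X" "l \<in> Hom C T (L C X)"
    then have "k \<cdot> cons X x l = h \<cdot> \<langle>x, k \<cdot> l\<rangle>" using k by blast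
    then show "(k \<cdot> ?S) \<cdot> \<langle>a, cons X x l\<rangle> = h \<cdot> \<langle>x, (k \<cdot> ?S) \<cdot> \<langle>a, l\<rangle>\<rangle>"
      using K X a xl by (simp add: hom_iff)
  qed
  have eq: "k \<cdot> ?S = k' \<cdot> ?S"
    by (rule list_recursive_unique[OF X g h rec[OF k] rec[OF k']])
  have "k = (k \<cdot> ?S) \<cdot> \<langle>bang C (L C X), Id C (L C X)\<rangle>"
    using k X by (simp add: hom_iff)
  also have "\<dots> = k'"
    unfolding eq using k' X by (simp add: hom_iff)
  finally show "k = k'" .
qed

text \<open>\<open>list_arr C f\<close> is the fold with step \<open>f x :: l\<close>, which shows
  that its \<open>THE\<close> is well defined. The cons equation in the definition is the generic
  instance of the one for folds.\<close>

lemma list_arr_iff: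
  assumes f: "f \<in> Hom C X Y"
  shows "k \<in> Hom C (L C X) (L C Y) \<and> k \<cdot> r0 C X = r0 C Y \<and> k \<cdot> r1 C X = r1 C Y \<cdot> prod_arr C f k \<longleftrightarrow>
    k = list_arr C f"
proof -
  let ?h = "r1 C Y \<cdot> \<langle>f \<cdot> Fst C X (L C Y), Snd C X (L C Y)\<rangle>"
  have f': "f \<in> Arr C" "Dom C f = X" "Cod C f = Y" and X: "X \<in> Obj C" and Y: "Y \<in> Obj C"
    using f by (auto simp: hom_iff)
  have h: "?h \<in> Hom C (Prod C X (L C Y)) (L C Y)" and g: "r0 C Y \<in> Hom C (One C) (L C Y)"
    using f' X Y by (auto simp: hom_iff)
  let ?P = "\<lambda>k. k \<in> Hom C (L C X) (L C Y) \<and> k \<cdot> r0 C X = r0 C Y \<and> k \<cdot> r1 C X = r1 C Y \<cdot> prod_arr C f k"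
  have "(\<forall>T. \<forall>x \<in> Hom C T X. \<forall>l \<in> Hom C T (L C X). k \<cdot> cons X x l = ?h \<cdot> \<langle>x, k \<cdot> l\<rangle>) \<longleftrightarrow>
      k \<cdot> r1 C X = r1 C Y \<cdot> prod_arr C f k" (is "?l \<longleftrightarrow> ?r")
    if k: "k \<in> Hom C (L C X) (L C Y)" for k
  proof
    assume ?l
    moreover have "Fst C X (L C X) \<in> Hom C (Prod C X (L C X)) X" "Snd C X (L C X) \<in> Hom C (Prod C X (L C X)) (L C X)"
      using X by (auto simp: hom_iff)
    ultimately have "k \<cdot> cons X (Fst C X (L C X)) (Snd C X (L C X)) = ?h \<cdot> \<langle>Fst C X (L C X), k \<cdot> Snd C X (L C X)\<rangle>"
      by blast
    then show ?r using k X Y f' by (simp add: hom_iff prod_arr_def)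
  next
    assume r: ?r
    show ?l
    proof (intro allI ballI)
      fix T x l assume xl: "x \<in> Hom C T X" "l \<in> Hom C T (L C X)"
      have "(k \<cdot> r1 C X) \<cdot> \<langle>x, l\<rangle> = (r1 C Y \<cdot> prod_arr C f k) \<cdot> \<langle>x, l\<rangle>" using r by simp
      then show "k \<cdot> cons X x l = ?h \<cdot> \<langle>x, k \<cdot> l\<rangle>"
        using k X Y f' xl by (simp add: hom_iff prod_arr_def)
    qed
  qed
  then have iff: "k \<in> Hom C (L C X) (L C Y) \<and> k \<cdot> r0 C X = r0 C Y \<and>
      (\<forall>T. \<forall>x \<in> Hom C T X. \<forall>l \<in> Hom C T (L C X). k \<cdot> cons X x l = ?h \<cdot> \<langle>x, k \<cdot> l\<rangle>) \<longleftrightarrow> ?P k" for k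
    by blast
  have ex1: "\<exists>!k. ?P k"
    using list_fold_ex1[OF X g h] unfolding iff .
  have "?P (list_arr C f)"
    unfolding list_arr_def f' by (rule theI'[OF ex1])
  moreover have "k = list_arr C f" if "?P k"
    using the1_equality[OF ex1 that] unfolding list_arr_def f' by simp
  ultimately show ?thesis by blast
qed

lemma list_arr_simps [simp]:
  assumes f: "f \<in> Arr C"
  shows "list_arr C f \<in> Arr C" "Dom C (list_arr C f) = L C (Dom C f)" "Cod C (list_arr C f) = L C (Cod C f)"
    "Dom C f = X \<Longrightarrow> t \<in> Arr C \<Longrightarrow> Cod C t = One C \<Longrightarrow> list_arr C f \<cdot> (r0 C X \<cdot> t) = r0 C (Cod C f) \<cdot> t"
    "Dom C f = X \<Longrightarrow> x \<in> Arr C \<Longrightarrow> Cod C x = X \<Longrightarrow> l \<in> Arr C \<Longrightarrow> Cod C l = L C X \<Longrightarrow> Dom C l = Dom C x \<Longrightarrow>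
      list_arr C f \<cdot> cons X x l = cons (Cod C f) (f \<cdot> x) (list_arr C f \<cdot> l)"
proof -
  have f': "f \<in> Hom C (Dom C f) (Cod C f)" using f by (simp add: hom_iff)
  let ?k = "list_arr C f"
  have k: "?k \<in> Hom C (L C (Dom C f)) (L C (Cod C f))" "?k \<cdot> r0 C (Dom C f) = r0 C (Cod C f)"
    "?k \<cdot> r1 C (Dom C f) = r1 C (Cod C f) \<cdot> prod_arr C f ?k"
    using list_arr_iff[OF f', of ?k] by auto
  show K: "?k \<in> Arr C" "Dom C ?k = L C (Dom C f)" "Cod C ?k = L C (Cod C f)"
    using k(1) by (auto simp: hom_iff)
  show "?k \<cdot> (r0 C X \<cdot> t) = r0 C (Cod C f) \<cdot> t" if "Dom C f = X" "t \<in> Arr C" "Cod C t = One C"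
    using k(2) K that f by (auto simp flip: assoc)
  assume x: "Dom C f = X" "x \<in> Arr C" "Cod C x = X" "l \<in> Arr C" "Cod C l = L C X" "Dom C l = Dom C x"
  have "?k \<cdot> cons X x l = (?k \<cdot> r1 C X) \<cdot> \<langle>x, l\<rangle>" using K x f by auto
  also have "\<dots> = cons (Cod C f) (f \<cdot> x) (?k \<cdot> l)"
    using k(3) x K f by (auto simp: prod_arr_def)
  finally show "?k \<cdot> cons X x l = cons (Cod C f) (f \<cdot> x) (?k \<cdot> l)" .
qed

lemma list_arr_eqI:
  assumes f: "f \<in> Hom C X Y" and k: "k \<in> Hom C (L C X) (L C Y)" "k \<cdot> r0 C X = r0 C Y"
    "k \<cdot> cons X (Fst C X (L C X)) (Snd C X (L C X)) = cons Y (f \<cdot> Fst C X (L C X)) (k \<cdot> Snd C X (L C X))"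
  shows "list_arr C f = k"
  using list_arr_iff[OF f, of k] assms by (auto simp: hom_iff prod_arr_def)

lemma list_arr_Id: "X \<in> Obj C \<Longrightarrow> list_arr C (Id C X) = Id C (L C X)"
  by (rule list_arr_eqI[of _ X X]) (auto simp: hom_iff)

lemma list_arr_r0 [simp]: "f \<in> Arr C \<Longrightarrow> Dom C f = X \<Longrightarrow> list_arr C f \<cdot> r0 C X = r0 C (Cod C f)"
  using list_arr_simps(4)[where f = f and X = X and t = "Id C (One C)"]
  by (auto simp del: list_arr_simps(4))

lemma list_arr_Comp:
  assumes "f \<in> Hom C X Y" "g \<in> Hom C Y Z"
  shows "list_arr C (g \<cdot> f) = list_arr C g \<cdot> list_arr C f"
proof -
  have XYZ: "X \<in> Obj C" "Y \<in> Obj C" "Z \<in> Obj C" using assms by (auto simp: hom_iff)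
  have "\<langle>Fst C X (L C X), Snd C X (L C X)\<rangle> = Id C (Prod C X (L C X))" using XYZ by simp
  \<comment> \<open>The generic pair must not collapse to an identity here, since the cons rule of
    \<open>list_arr\<close> would no longer match.\<close>
  moreover have "list_arr C g \<cdot> (list_arr C f \<cdot> cons X (Fst C X (L C X)) (Snd C X (L C X))) =
    cons Z (g \<cdot> (f \<cdot> Fst C X (L C X))) (list_arr C g \<cdot> (list_arr C f \<cdot> Snd C X (L C X)))"
    using assms XYZ by (simp add: hom_iff del: pair_Fst_Snd)
  ultimately show ?thesis
    using assms XYZ by (intro list_arr_eqI[of _ X Z]) (auto simp: hom_iff)
qed

text \<open>As \<open>N = L 1\<close>, replacing every entry by the point of \<open>1\<close> yields
  the length. Invariance under \<open>list_arr\<close> is then functoriality.\<close>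

definition len :: "'o \<Rightarrow> 'a" where
  "len X = list_arr C (bang C X)"

lemma len_simps [simp]:
  assumes X: "X \<in> Obj C"
  shows "len X \<in> Arr C" "Dom C (len X) = L C X" "Cod C (len X) = N"
    "t \<in> Arr C \<Longrightarrow> Cod C t = One C \<Longrightarrow> len X \<cdot> (r0 C X \<cdot> t) = zero C \<cdot> t"
    "x \<in> Arr C \<Longrightarrow> Cod C x = X \<Longrightarrow> l \<in> Arr C \<Longrightarrow> Cod C l = L C X \<Longrightarrow> Dom C l = Dom C x \<Longrightarrow>
      len X \<cdot> cons X x l = suc (len X \<cdot> l)"
proof -
  show *: "len X \<in> Arr C" "Dom C (len X) = L C X" "Cod C (len X) = N"
    using X by (simp_all add: len_def NN_def)
  show "len X \<cdot> (r0 C X \<cdot> t) = zero C \<cdot> t" if "t \<in> Arr C" "Cod C t = One C"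
    using X that by (simp add: len_def zero_def)
  show "len X \<cdot> cons X x l = suc (len X \<cdot> l)"
    if "x \<in> Arr C" "Cod C x = X" "l \<in> Arr C" "Cod C l = L C X" "Dom C l = Dom C x"
    using X that cons_One[of "bang C (Dom C x)" "len X \<cdot> l"] * by (simp add: len_def NN_def)
qed

lemma len_list_arr: "f \<in> Hom C X Y \<Longrightarrow> len Y \<cdot> list_arr C f = len X"
  using list_arr_Comp[of f X Y "bang C Y" "One C"] by (simp add: len_def hom_iff)

section \<open>Tails and final segments\<close>

definition tail :: "'o \<Rightarrow> 'a" where
  "tail X = (THE t. t \<in> Hom C (L C X) (L C X) \<and> t \<cdot> r0 C X = r0 C X \<and> t \<cdot> r1 C X = Snd C X (L C X))"

text \<open>The empty list is its own tail, in step with \<open>P 0 = 0\<close>; this is what lets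
  \<open>len_tail\<close> and \<open>len_drop\<close> hold without a bound.\<close>

lemma tail_simps [simp]:
  assumes X: "X \<in> Obj C"
  shows "tail X \<in> Arr C" "Dom C (tail X) = L C X" "Cod C (tail X) = L C X"
    "t \<in> Arr C \<Longrightarrow> Cod C t = One C \<Longrightarrow> tail X \<cdot> (r0 C X \<cdot> t) = r0 C X \<cdot> t"
    "x \<in> Arr C \<Longrightarrow> Cod C x = X \<Longrightarrow> l \<in> Arr C \<Longrightarrow> Cod C l = L C X \<Longrightarrow> Dom C l = Dom C x \<Longrightarrow>
      tail X \<cdot> cons X x l = l"
proof -
  have "r0 C X \<in> Hom C (One C) (L C X)" "Snd C X (L C X) \<in> Hom C (Prod C X (L C X)) (L C X)" "L C X \<in> Obj C"
    using X by (auto simp: hom_iff)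
  then have "\<exists>!t. t \<in> Hom C (L C X) (L C X) \<and> t \<cdot> r0 C X = r0 C X \<and> t \<cdot> r1 C X = Snd C X (L C X)"
    using list_coproduct[OF X] unfolding is_coproduct_def by blast
  from theI'[OF this] have t: "tail X \<in> Hom C (L C X) (L C X)" "tail X \<cdot> r0 C X = r0 C X"
    "tail X \<cdot> r1 C X = Snd C X (L C X)"
    by (auto simp: tail_def)
  then show *: "tail X \<in> Arr C" "Dom C (tail X) = L C X" "Cod C (tail X) = L C X"
    by (auto simp: hom_iff)
  show "tail X \<cdot> (r0 C X \<cdot> t) = r0 C X \<cdot> t" if "t \<in> Arr C" "Cod C t = One C"
    using t * X that by (simp flip: assoc)
  show "tail X \<cdot> cons X x l = l"
    if x: "x \<in> Arr C" "Cod C x = X" "l \<in> Arr C" "Cod C l = L C X" "Dom C l = Dom C x"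
  proof -
    have "tail X \<cdot> cons X x l = (tail X \<cdot> r1 C X) \<cdot> \<langle>x, l\<rangle>" using * X x by simp
    also have "\<dots> = l" unfolding t(3) using X x by simp
    finally show ?thesis .
  qed
qed

definition drop :: "'o \<Rightarrow> 'a" where
  "drop X = (THE f. nat_recursive (L C X) (L C X) (Id C (L C X)) (tail X) f)"

lemma drop_recursive: "X \<in> Obj C \<Longrightarrow> nat_recursive (L C X) (L C X) (Id C (L C X)) (tail X) (drop X)"
  unfolding drop_def by (rule theI', rule nat_recursive_ex1) (auto simp: hom_iff)

lemma drop_simps [simp]:
  assumes X: "X \<in> Obj C"
  shows "drop X \<in> Arr C" "Dom C (drop X) = Prod C (L C X) N" "Cod C (drop X) = L C X"
    "l \<in> Arr C \<Longrightarrow> Cod C l = L C X \<Longrightarrow> Dom C l = T \<Longrightarrow> drop X \<cdot> \<langle>l, zero_at T\<rangle> = l"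
    "l \<in> Arr C \<Longrightarrow> Cod C l = L C X \<Longrightarrow> k \<in> Arr C \<Longrightarrow> Cod C k = N \<Longrightarrow> Dom C k = Dom C l \<Longrightarrow>
      drop X \<cdot> \<langle>l, suc k\<rangle> = tail X \<cdot> (drop X \<cdot> \<langle>l, k\<rangle>)"
proof -
  note d = drop_recursive[OF X]
  show "drop X \<in> Arr C" "Dom C (drop X) = Prod C (L C X) N" "Cod C (drop X) = L C X"
    using d by (auto simp: nat_recursive_def hom_iff)
  show "drop X \<cdot> \<langle>l, zero_at T\<rangle> = l" if "l \<in> Arr C" "Cod C l = L C X" "Dom C l = T"
    using d that by (auto simp: nat_recursive_def hom_iff)
  show "drop X \<cdot> \<langle>l, suc k\<rangle> = tail X \<cdot> (drop X \<cdot> \<langle>l, k\<rangle>)"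
    if "l \<in> Arr C" "Cod C l = L C X" "k \<in> Arr C" "Cod C k = N" "Dom C k = Dom C l"
  proof -
    have "l \<in> Hom C (Dom C l) (L C X)" "k \<in> Hom C (Dom C l) N" using that X by (auto simp: hom_iff)
    then show ?thesis using d unfolding nat_recursive_def by blast
  qed
qed

lemma len_tail:
  assumes l: "l \<in> Hom C T (L C X)" and X: "X \<in> Obj C"
  shows "len X \<cdot> (tail X \<cdot> l) = pre (len X \<cdot> l)"
proof (rule list_cases_eqI[OF X l])
  show "len X \<cdot> (tail X \<cdot> l) \<in> Hom C T N" "pre (len X \<cdot> l) \<in> Hom C T N"
    using l X by (auto simp: hom_iff)
qed (use l X in \<open>simp_all add: hom_iff\<close>)

lemma tail_list_arr:
  assumes f: "f \<in> Hom C X Y" and l: "l \<in> Hom C T (L C X)"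
  shows "tail Y \<cdot> (list_arr C f \<cdot> l) = list_arr C f \<cdot> (tail X \<cdot> l)"
proof (rule list_cases_eqI[OF _ l])
  show "tail Y \<cdot> (list_arr C f \<cdot> l) \<in> Hom C T (L C Y)" "list_arr C f \<cdot> (tail X \<cdot> l) \<in> Hom C T (L C Y)"
    using f l by (auto simp: hom_iff)
qed (use f l in \<open>simp_all add: hom_iff\<close>)

text \<open>\<open>drop\<close> iterates \<open>tail\<close> exactly as truncated subtraction
  iterates the predecessor, and \<open>len\<close> carries the one to the other.\<close>

lemma len_drop:
  assumes X: "X \<in> Obj C" and l: "l \<in> Hom C T (L C X)" and k: "k \<in> Hom C T N"
  shows "len X \<cdot> (drop X \<cdot> \<langle>l, k\<rangle>) = (len X \<cdot> l) \<ominus> k"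
  using nat_induct_eqI[OF k, where Z = "N" and F = "\<lambda>t k. len X \<cdot> (drop X \<cdot> \<langle>l \<cdot> t, k\<rangle>)"
      and G = "\<lambda>t k. (len X \<cdot> (l \<cdot> t)) \<ominus> k"] assms
  by (simp add: hom_iff len_tail[of l "Dom C l" for l, unfolded hom_iff])

lemma drop_list_arr:
  assumes f: "f \<in> Hom C X Y" and l: "l \<in> Hom C T (L C X)" and k: "k \<in> Hom C T N"
  shows "drop Y \<cdot> \<langle>list_arr C f \<cdot> l, k\<rangle> = list_arr C f \<cdot> (drop X \<cdot> \<langle>l, k\<rangle>)"
  using nat_induct_eqI[OF k, where Z = "L C Y" and F = "\<lambda>t k. drop Y \<cdot> \<langle>list_arr C f \<cdot> (l \<cdot> t), k\<rangle>"
      and G = "\<lambda>t k. list_arr C f \<cdot> (drop X \<cdot> \<langle>l \<cdot> t, k\<rangle>)"] assms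
  by (simp add: hom_iff tail_list_arr[of f "Dom C f" _ l "Dom C l" for f l, unfolded hom_iff])

text \<open>Where \<open>l\<close> is a cons, its length is both zero and a successor, so the stage
  is contradictory and the equation holds trivially.\<close>

lemma len_zero_imp_empty:
  assumes X: "X \<in> Obj C" and l: "l \<in> Hom C T (L C X)" and z: "len X \<cdot> l = zero_at T"
  shows "l = empty X T"
proof (rule list_cases_eqI[OF X l l])
  show e: "empty X T \<in> Hom C T (L C X)" using X l by (auto simp: hom_iff)
  show "l \<cdot> t = empty X T \<cdot> t" if "t \<in> Hom C T' T" "l \<cdot> t = empty X T'" for T' t
    using that X l by (simp add: hom_iff)
  fix T' t x r assume t: "t \<in> Hom C T' T" and x: "x \<in> Hom C T' X" and r: "r \<in> Hom C T' (L C X)"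
    and lt: "l \<cdot> t = cons X x r"
  have "(len X \<cdot> l) \<cdot> t = zero_at T'" unfolding z using t l by (simp add: hom_iff)
  then have "len X \<cdot> (l \<cdot> t) = zero_at T'" using t l X by (simp add: hom_iff)
  then have "zero_at T' = suc (len X \<cdot> r)" unfolding lt using x r by (simp add: hom_iff)
  then show "l \<cdot> t = empty X T \<cdot> t"
    by (rule zero_succ_absurd[rotated]) (use X t l r in \<open>auto simp: hom_iff\<close>)
qed

text \<open>A head cannot come from a total arrow \<open>L X \<rightarrow> X\<close>, as
  \<open>X\<close> may have no point to serve for the empty list. On \<open>T1\<close>, where
  \<open>l\<close> is a cons, it is a projection. On \<open>T0\<close> zero equals a successor, and
  \<open>coproduct_disjoint\<close> provides some arrow \<open>x0\<close> to
  \<open>X\<close>.\<close>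

lemma len_succ_imp_cons:
  assumes X: "X \<in> Obj C" and l: "l \<in> Hom C T (L C X)" and n: "n \<in> Hom C T N"
    and s: "len X \<cdot> l = suc n"
  obtains x where "x \<in> Hom C T X" "l = cons X x (tail X \<cdot> l)"
proof -
  obtain T0 T1 i j y where P: "is_coproduct C T0 T1 T i j"
    and i: "i \<in> Hom C T0 T" and li: "l \<cdot> i = empty X T0"
    and j: "j \<in> Hom C T1 T" and lj: "l \<cdot> j = r1 C X \<cdot> y" and y: "y \<in> Hom C T1 (Prod C X (L C X))"
    using list_split[OF X l] .
  have "(len X \<cdot> l) \<cdot> i = suc (n \<cdot> i)" unfolding s using n i by (simp add: hom_iff)
  then have "len X \<cdot> (l \<cdot> i) = suc (n \<cdot> i)" using l i X by (simp add: hom_iff)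
  then have zs: "zero_at T0 = suc (n \<cdot> i)"
    unfolding li using i X by (simp add: hom_iff)
  have b: "bang C T0 \<in> Hom C T0 (One C)" and ni: "n \<cdot> i \<in> Hom C T0 N"
    and bn: "\<langle>bang C T0, n \<cdot> i\<rangle> \<in> Hom C T0 (Prod C (One C) (L C (One C)))"
    using n i by (auto simp: hom_iff NN_def)
  have "r0 C (One C) \<cdot> bang C T0 = r1 C (One C) \<cdot> \<langle>bang C T0, n \<cdot> i\<rangle>"
    using zs b ni cons_One[of "bang C T0" "n \<cdot> i"] unfolding zero_def by (simp add: hom_iff)
  then obtain x0 where x0: "x0 \<in> Hom C T0 X"
    using coproduct_disjoint[OF list_coproduct[OF One_Obj] b bn _ X] by blast
  have x1: "Fst C X (L C X) \<cdot> y \<in> Hom C T1 X" using y X by (auto simp: hom_iff)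
  obtain x where x: "x \<in> Hom C T X" "x \<cdot> j = Fst C X (L C X) \<cdot> y"
    using P X x0 x1 unfolding is_coproduct_def by metis
  have ct: "cons X x (tail X \<cdot> l) \<in> Hom C T (L C X)" using x l X by (auto simp: hom_iff)
  have "l = cons X x (tail X \<cdot> l)"
  proof (rule coproduct_eqI[OF P l ct])
    show "l \<cdot> i = cons X x (tail X \<cdot> l) \<cdot> i"
      by (rule zero_succ_absurd[OF ni zs]) (use l i ct in \<open>auto simp: hom_iff\<close>)
    have eta: "\<langle>Fst C X (L C X) \<cdot> y, Snd C X (L C X) \<cdot> y\<rangle> = y"
      using y X by (intro pair_eta) (auto simp: hom_iff)
    have "tail X \<cdot> (l \<cdot> j) = tail X \<cdot> cons X (Fst C X (L C X) \<cdot> y) (Snd C X (L C X) \<cdot> y)"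
      unfolding eta lj ..
    also have "\<dots> = Snd C X (L C X) \<cdot> y" using y X by (simp add: hom_iff)
    finally show "l \<cdot> j = cons X x (tail X \<cdot> l) \<cdot> j"
      using x j l X y eta lj by (simp add: hom_iff)
  qed
  with x show thesis by (rule_tac that)
qed

text \<open>Entries are counted from the end: \<open>last_at X l k\<close> is the final segment of length \<open>k\<close>, and the
  entry with index \<open>i\<close> is the one followed by exactly \<open>i\<close> others.\<close>

abbreviation last_at :: "'o \<Rightarrow> 'a \<Rightarrow> 'a \<Rightarrow> 'a" where
  "last_at X l k \<equiv> drop X \<cdot> \<langle>l, (len X \<cdot> l) \<ominus> k\<rangle>"

text \<open>A relation rather than an arrow: an entry need only exist where the index is below the
  length, and \<open>X\<close> may offer no default value.\<close>

definition is_entry :: "'o \<Rightarrow> 'a \<Rightarrow> 'a \<Rightarrow> 'a \<Rightarrow> bool" where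
  "is_entry X l i x \<longleftrightarrow> last_at X l (suc i) = cons X x (last_at X l i)"

lemma is_entry_Comp:
  assumes "is_entry X l i x" "X \<in> Obj C" "l \<in> Hom C T (L C X)" "i \<in> Hom C T N" "x \<in> Hom C T X" "t \<in> Hom C T' T"
  shows "is_entry X (l \<cdot> t) (i \<cdot> t) (x \<cdot> t)"
proof -
  have "last_at X l (suc i) \<cdot> t = cons X x (last_at X l i) \<cdot> t"
    using assms(1) by (simp add: is_entry_def)
  then show ?thesis
    using assms(2-) by (simp add: hom_iff is_entry_def)
qed

text \<open>\<open>list_arr C f\<close> preserves length and commutes with \<open>drop\<close>, so
  it sends final segments to final segments of the same length.\<close>

lemma is_entry_list_arr:
  assumes e: "is_entry X l i x" and f: "f \<in> Hom C X Y" and l: "l \<in> Hom C T (L C X)"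
    and i: "i \<in> Hom C T N" and x: "x \<in> Hom C T X"
  shows "is_entry Y (list_arr C f \<cdot> l) i (f \<cdot> x)"
proof -
  have X: "X \<in> Obj C" and Y: "Y \<in> Obj C" using f by (auto simp: hom_iff)
  have "len Y \<cdot> (list_arr C f \<cdot> l) = (len Y \<cdot> list_arr C f) \<cdot> l" using f l Y by (simp add: hom_iff)
  then have len: "len Y \<cdot> (list_arr C f \<cdot> l) = len X \<cdot> l" unfolding len_list_arr[OF f] .
  have k: "(len X \<cdot> l) \<ominus> suc i \<in> Hom C T N" "(len X \<cdot> l) \<ominus> i \<in> Hom C T N"
    using X l i by (auto simp: hom_iff)
  have "list_arr C f \<cdot> last_at X l (suc i) = list_arr C f \<cdot> cons X x (last_at X l i)"
    using e by (simp add: is_entry_def)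
  then have "list_arr C f \<cdot> last_at X l (suc i) = cons Y (f \<cdot> x) (list_arr C f \<cdot> last_at X l i)"
    using f l i x X Y by (simp add: hom_iff)
  then show ?thesis
    unfolding is_entry_def len drop_list_arr[OF f l k(1)] drop_list_arr[OF f l k(2)] .
qed

lemma is_entry_unique:
  assumes "is_entry X l i x" "is_entry X l i x'" "X \<in> Obj C" "l \<in> Hom C T (L C X)" "i \<in> Hom C T N"
    "x \<in> Hom C T X" "x' \<in> Hom C T X"
  shows "x = x'"
proof (rule cons_inject(1))
  show "cons X x (last_at X l i) = cons X x' (last_at X l i)"
    using assms(1,2) by (simp add: is_entry_def)
qed (use assms in \<open>auto simp: hom_iff\<close>)

text \<open>Below the length, the final segment of length \<open>i + 1\<close> really has that
  length, so it is a cons. Its tail is the final segment of length \<open>i\<close>, because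
  \<open>n - (i + 1)\<close> and \<open>n - i\<close> differ by exactly one.\<close>

lemma ex_entry:
  assumes X: "X \<in> Obj C" and l: "l \<in> Hom C T (L C X)" and i: "i \<in> Hom C T N"
    and less: "suc i \<ominus> (len X \<cdot> l) = zero_at T"
  obtains x where "x \<in> Hom C T X" "is_entry X l i x"
proof -
  have n: "len X \<cdot> l \<in> Hom C T N" and si: "suc i \<in> Hom C T N"
    and d: "(len X \<cdot> l) \<ominus> suc i \<in> Hom C T N"
    and m: "last_at X l (suc i) \<in> Hom C T (L C X)"
    using X l i by (auto simp: hom_iff)
  have "len X \<cdot> last_at X l (suc i) = suc i"
    unfolding len_drop[OF X l d] by (rule le_imp_minus_minus[OF si n less])
  then obtain x where x: "x \<in> Hom C T X" "last_at X l (suc i) = cons X x (tail X \<cdot> last_at X l (suc i))"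
    using len_succ_imp_cons[OF X m i] by blast
  have "tail X \<cdot> last_at X l (suc i) = drop X \<cdot> \<langle>l, suc ((len X \<cdot> l) \<ominus> suc i)\<rangle>"
    using X l d by (subst drop_simps(5)) (simp_all add: hom_iff)
  also have "\<dots> = last_at X l i"
    unfolding less_imp_succ_minus[OF i n less] ..
  finally have "is_entry X l i x"
    using x(2) unfolding is_entry_def by simp
  with x(1) show thesis by (rule that)
qed

text \<open>Induction on \<open>k\<close> shows that the final segments of length \<open>k\<close>
  agree; for \<open>k = len X \<cdot> l\<close> they are the lists themselves. As \<open>k\<close>
  ranges over all of \<open>N\<close>, the step distinguishes whether \<open>k\<close> is below the
  length: if so, the common entry extends both segments.\<close>

lemma list_eqI:
  assumes X: "X \<in> Obj C" and l: "l \<in> Hom C Y (L C X)" and l': "l' \<in> Hom C Y (L C X)"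
    and len: "len X \<cdot> l' = len X \<cdot> l"
    and entry: "\<And>T t i. t \<in> Hom C T Y \<Longrightarrow> i \<in> Hom C T N \<Longrightarrow>
      suc i \<ominus> (len X \<cdot> (l \<cdot> t)) = zero_at T \<Longrightarrow>
      \<exists>x \<in> Hom C T X. is_entry X (l \<cdot> t) i x \<and> is_entry X (l' \<cdot> t) i x"
  shows "l = l'"
proof -
  have n: "len X \<cdot> l \<in> Hom C Y N" using X l by (auto simp: hom_iff)
  have len': "len X \<cdot> (l' \<cdot> t) = len X \<cdot> (l \<cdot> t)" if "t \<in> Hom C T Y" for T t
  proof -
    have "(len X \<cdot> l') \<cdot> t = (len X \<cdot> l) \<cdot> t" unfolding len ..
    then show ?thesis using that X l l' by (simp add: hom_iff)
  qed
  have "last_at X (l \<cdot> Id C Y) (len X \<cdot> l) = last_at X (l' \<cdot> Id C Y) (len X \<cdot> l)"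
  proof (rule nat_induct_eqI[OF n, where Z = "L C X" and F = "\<lambda>t k. last_at X (l \<cdot> t) k" and G = "\<lambda>t k. last_at X (l' \<cdot> t) k"])
    fix T t assume t: "t \<in> Hom C T Y"
    have "last_at X (l \<cdot> t) (zero_at T) = empty X T" if "l \<in> Hom C Y (L C X)" for l
    proof (rule len_zero_imp_empty[OF X])
      have lt: "l \<cdot> t \<in> Hom C T (L C X)" "len X \<cdot> (l \<cdot> t) \<in> Hom C T N"
          "(len X \<cdot> (l \<cdot> t)) \<ominus> zero_at T \<in> Hom C T N"
        using that t X by (auto simp: hom_iff)
      then show "last_at X (l \<cdot> t) (zero_at T) \<in> Hom C T (L C X)" using X by (auto simp: hom_iff)
      show "len X \<cdot> last_at X (l \<cdot> t) (zero_at T) = zero_at T"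
        unfolding len_drop[OF X lt(1) lt(3)] using minus_self[OF lt(2)] lt(2) by (simp add: hom_iff)
    qed
    then show "last_at X (l \<cdot> t) (zero_at T) = last_at X (l' \<cdot> t) (zero_at T)"
      using l l' by simp
  next
    fix T t k assume t: "t \<in> Hom C T Y" and k: "k \<in> Hom C T N"
      and IH: "last_at X (l \<cdot> t) k = last_at X (l' \<cdot> t) k"
    let ?c = "suc k \<ominus> (len X \<cdot> (l \<cdot> t))"
    show "last_at X (l \<cdot> t) (suc k) = last_at X (l' \<cdot> t) (suc k)"
    proof (rule nat_cases_eqI[of ?c T _ "L C X"])
      fix S r assume r: "r \<in> Hom C S T" and z: "?c \<cdot> r = zero_at S"
      have tr: "t \<cdot> r \<in> Hom C S Y" and kr: "k \<cdot> r \<in> Hom C S N" using t r k by (auto simp: hom_iff)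
      have "suc (k \<cdot> r) \<ominus> (len X \<cdot> (l \<cdot> (t \<cdot> r))) = zero_at S"
        using z t k r l X by (simp add: hom_iff)
      from entry[OF tr kr this] obtain x where x: "x \<in> Hom C S X"
        "is_entry X (l \<cdot> (t \<cdot> r)) (k \<cdot> r) x" "is_entry X (l' \<cdot> (t \<cdot> r)) (k \<cdot> r) x"
        by blast
      have "last_at X (l \<cdot> (t \<cdot> r)) (k \<cdot> r) = last_at X (l \<cdot> t) k \<cdot> r"
        "last_at X (l' \<cdot> (t \<cdot> r)) (k \<cdot> r) = last_at X (l' \<cdot> t) k \<cdot> r"
        using l l' t k r X by (simp_all add: hom_iff)
      then have "last_at X (l \<cdot> (t \<cdot> r)) (suc (k \<cdot> r)) = last_at X (l' \<cdot> (t \<cdot> r)) (suc (k \<cdot> r))"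
        using x IH unfolding is_entry_def by simp
      then show "last_at X (l \<cdot> t) (suc k) \<cdot> r = last_at X (l' \<cdot> t) (suc k) \<cdot> r"
        using l l' t k r X by (simp add: hom_iff)
    next
      fix S r w assume r: "r \<in> Hom C S T" and w: "w \<in> Hom C S N" and s: "?c \<cdot> r = suc w"
      have nr: "len X \<cdot> (l \<cdot> (t \<cdot> r)) \<in> Hom C S N" and kr: "k \<cdot> r \<in> Hom C S N"
        using t r k X l by (auto simp: hom_iff)
      have "suc (k \<cdot> r) \<ominus> (len X \<cdot> (l \<cdot> (t \<cdot> r))) = suc w"
        using s t k r l X by (simp add: hom_iff)
      \<comment> \<open>From the length on, nothing is dropped, neither for \<open>k\<close> nor for
        \<open>suc k\<close>, so the segments have stopped growing.\<close>
      from not_less_imp_minus[OF kr nr w this]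
      have "(len X \<cdot> (l \<cdot> (t \<cdot> r))) \<ominus> (k \<cdot> r) = zero_at S" .
      moreover from this have "(len X \<cdot> (l \<cdot> (t \<cdot> r))) \<ominus> suc (k \<cdot> r) = zero_at S"
        using nr kr by (simp add: hom_iff)
      moreover have "last_at X (l \<cdot> t) k \<cdot> r = last_at X (l' \<cdot> t) k \<cdot> r" unfolding IH ..
      ultimately show "last_at X (l \<cdot> t) (suc k) \<cdot> r = last_at X (l' \<cdot> t) (suc k) \<cdot> r"
        using l l' t k r X len'[of "t \<cdot> r" S] len'[OF t] by (simp add: hom_iff)
    qed (use l l' t k X in \<open>auto simp: hom_iff\<close>)
  qed (use l l' X in \<open>simp_all add: hom_iff\<close>)
  moreover have "last_at X (m \<cdot> Id C Y) (len X \<cdot> l) = m"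
    if m: "m \<in> Hom C Y (L C X)" "len X \<cdot> m = len X \<cdot> l" for m
  proof -
    have "m \<cdot> Id C Y = m" using m(1) by (simp add: hom_iff)
    then show ?thesis
      using m(1) X minus_self[OF n] by (simp add: m(2) hom_iff)
  qed
  ultimately show ?thesis
    using l l' len by metis
qed

text \<open>The recursion along \<open>k\<close> stops adding entries once \<open>k \<ge> n y\<close>, which makes it total.\<close>

lemma ex_list:
  assumes X: "X \<in> Obj C" and n: "n \<in> Hom C Y N"
    and \<phi>: "\<And>T t i. t \<in> Hom C T Y \<Longrightarrow> i \<in> Hom C T N \<Longrightarrow> suc i \<ominus> (n \<cdot> t) = zero_at T \<Longrightarrow>
      \<phi> t i \<in> Hom C T X"
    and natural: "\<And>T T' t i r. t \<in> Hom C T Y \<Longrightarrow> i \<in> Hom C T N \<Longrightarrow>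
      suc i \<ominus> (n \<cdot> t) = zero_at T \<Longrightarrow> r \<in> Hom C T' T \<Longrightarrow> \<phi> (t \<cdot> r) (i \<cdot> r) = \<phi> t i \<cdot> r"
  obtains l where "l \<in> Hom C Y (L C X)" "len X \<cdot> l = n"
    "\<And>T t i. t \<in> Hom C T Y \<Longrightarrow> i \<in> Hom C T N \<Longrightarrow> suc i \<ominus> (n \<cdot> t) = zero_at T \<Longrightarrow>
      is_entry X (l \<cdot> t) i (\<phi> t i)"
proof -
  let ?LX = "L C X" let ?P = "Prod C Y N" let ?W = "Prod C ?P ?LX"
  have Y: "Y \<in> Obj C" and n': "n \<in> Arr C" "Dom C n = Y" "Cod C n = N" using n by (auto simp: hom_iff)
  \<comment> \<open>The generic argument of the step: base point \<open>y\<close>, counter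
    \<open>k\<close>, and \<open>r\<close>, the list built so far. The value of \<open>?c\<close> is
    zero exactly where \<open>k < n y\<close>.\<close>
  define y where "y = Fst C Y N \<cdot> Fst C ?P ?LX"
  define k where "k = Snd C Y N \<cdot> Fst C ?P ?LX"
  define r where "r = Snd C ?P ?LX"
  have ykr: "y \<in> Hom C ?W Y" "k \<in> Hom C ?W N" "r \<in> Hom C ?W ?LX"
    using X Y unfolding y_def k_def r_def by (auto simp: hom_iff)
  let ?c = "suc k \<ominus> (n \<cdot> y)"
  have c: "?c \<in> Hom C ?W N" using ykr n' by (auto simp: hom_iff)
  have typed: "y \<cdot> w \<in> Hom C T Y" "k \<cdot> w \<in> Hom C T N" "r \<cdot> w \<in> Hom C T ?LX"
    and cw: "?c \<cdot> w = suc (k \<cdot> w) \<ominus> (n \<cdot> (y \<cdot> w))" if "w \<in> Hom C T ?W" for T w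
    using that ykr n' by (auto simp: hom_iff)
  \<comment> \<open>\<open>h\<close> conses the prescribed entry where there is one and returns
    \<open>r\<close> unchanged otherwise. The default \<open>r\<close> is always available, unlike
    an element of \<open>X\<close>.\<close>
  obtain h where h: "h \<in> Hom C ?W ?LX"
    and h0: "\<And>T w. w \<in> Hom C T ?W \<Longrightarrow> ?c \<cdot> w = zero_at T \<Longrightarrow> h \<cdot> w = cons X (\<phi> (y \<cdot> w) (k \<cdot> w)) (r \<cdot> w)"
    and h1: "\<And>T w m. w \<in> Hom C T ?W \<Longrightarrow> m \<in> Hom C T N \<Longrightarrow> ?c \<cdot> w = suc m \<Longrightarrow> h \<cdot> w = r \<cdot> w"
  proof (rule if_zero[OF c ykr(3), where \<phi> = "\<lambda>w. cons X (\<phi> (y \<cdot> w) (k \<cdot> w)) (r \<cdot> w)"])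
    fix T w assume w: "w \<in> Hom C T ?W" and z: "?c \<cdot> w = zero_at T"
    note p = \<phi>[OF typed(1,2)[OF w] z[unfolded cw[OF w]]]
    show "cons X (\<phi> (y \<cdot> w) (k \<cdot> w)) (r \<cdot> w) \<in> Hom C T ?LX"
      using p typed(3)[OF w] by (simp add: hom_iff)
    fix T' t assume t: "t \<in> Hom C T' T"
    have "y \<cdot> (w \<cdot> t) = (y \<cdot> w) \<cdot> t" "k \<cdot> (w \<cdot> t) = (k \<cdot> w) \<cdot> t" "r \<cdot> (w \<cdot> t) = (r \<cdot> w) \<cdot> t"
      using w t ykr by (simp_all add: hom_iff)
    then show "cons X (\<phi> (y \<cdot> (w \<cdot> t)) (k \<cdot> (w \<cdot> t))) (r \<cdot> (w \<cdot> t)) = cons X (\<phi> (y \<cdot> w) (k \<cdot> w)) (r \<cdot> w) \<cdot> t"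
      using natural[OF typed(1,2)[OF w] z[unfolded cw[OF w]] t] p typed[OF w] t X by (simp add: hom_iff)
  qed blast
  have g: "empty X Y \<in> Hom C Y ?LX" using X Y by (auto simp: hom_iff)
  obtain f where f: "f \<in> Hom C ?P ?LX"
    and f0': "\<And>T a. a \<in> Hom C T Y \<Longrightarrow> f \<cdot> \<langle>a, zero_at T\<rangle> = empty X Y \<cdot> a"
    and fs: "\<And>T a k. a \<in> Hom C T Y \<Longrightarrow> k \<in> Hom C T N \<Longrightarrow>
      f \<cdot> \<langle>a, suc k\<rangle> = h \<cdot> \<langle>\<langle>a, k\<rangle>, f \<cdot> \<langle>a, k\<rangle>\<rangle>"
    using primitive_recursion[OF g h] by blast
  have f0: "f \<cdot> \<langle>a, zero_at T\<rangle> = empty X T" if "a \<in> Hom C T Y" for a T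
    using f0'[OF that] that X by (simp add: hom_iff)
  have w: "\<langle>\<langle>a, i\<rangle>, f \<cdot> \<langle>a, i\<rangle>\<rangle> \<in> Hom C T ?W"
    and yw: "y \<cdot> \<langle>\<langle>a, i\<rangle>, f \<cdot> \<langle>a, i\<rangle>\<rangle> = a" "k \<cdot> \<langle>\<langle>a, i\<rangle>, f \<cdot> \<langle>a, i\<rangle>\<rangle> = i" "r \<cdot> \<langle>\<langle>a, i\<rangle>, f \<cdot> \<langle>a, i\<rangle>\<rangle> = f \<cdot> \<langle>a, i\<rangle>"
    if "a \<in> Hom C T Y" "i \<in> Hom C T N" for a i T
    using that f X Y unfolding y_def k_def r_def by (auto simp: hom_iff)
  have f1: "f \<cdot> \<langle>a, suc i\<rangle> = cons X (\<phi> a i) (f \<cdot> \<langle>a, i\<rangle>)"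
    if "a \<in> Hom C T Y" "i \<in> Hom C T N" "suc i \<ominus> (n \<cdot> a) = zero_at T" for a i T
    using h0[OF w[OF that(1,2)]] cw[OF w[OF that(1,2)]] that yw[OF that(1,2)] fs[OF that(1,2)] by simp
  have f2: "f \<cdot> \<langle>a, suc i\<rangle> = f \<cdot> \<langle>a, i\<rangle>"
    if "a \<in> Hom C T Y" "i \<in> Hom C T N" "m \<in> Hom C T N" "suc i \<ominus> (n \<cdot> a) = suc m" for a i m T
    using h1[OF w[OF that(1,2)] that(3)] cw[OF w[OF that(1,2)]] that yw[OF that(1,2)] fs[OF that(1,2)] by simp
  \<comment> \<open>The length is the minimum of \<open>i\<close> and \<open>n a\<close>, expressed
    by truncated subtraction.\<close>
  have len_f: "len X \<cdot> (f \<cdot> \<langle>a, i\<rangle>) = (n \<cdot> a) \<ominus> ((n \<cdot> a) \<ominus> i)" if a: "a \<in> Hom C T Y" and i: "i \<in> Hom C T N" for a i T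
  proof -
    have "len X \<cdot> (f \<cdot> \<langle>a \<cdot> Id C T, i\<rangle>) = (n \<cdot> (a \<cdot> Id C T)) \<ominus> ((n \<cdot> (a \<cdot> Id C T)) \<ominus> i)"
    proof (rule nat_induct_eqI[OF i, where Z = N and F = "\<lambda>t i. len X \<cdot> (f \<cdot> \<langle>a \<cdot> t, i\<rangle>)"
          and G = "\<lambda>t i. (n \<cdot> (a \<cdot> t)) \<ominus> ((n \<cdot> (a \<cdot> t)) \<ominus> i)"])
      fix T' t assume t: "t \<in> Hom C T' T"
      have at: "a \<cdot> t \<in> Hom C T' Y" and nat: "n \<cdot> (a \<cdot> t) \<in> Hom C T' N" using a t n by (auto simp: hom_iff)
      show "len X \<cdot> (f \<cdot> \<langle>a \<cdot> t, zero_at T'\<rangle>) = (n \<cdot> (a \<cdot> t)) \<ominus> ((n \<cdot> (a \<cdot> t)) \<ominus> zero_at T')"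
        unfolding f0[OF at] using minus_self[OF nat] nat X by (simp add: hom_iff)
    next
      fix T' t i assume t: "t \<in> Hom C T' T" and i: "i \<in> Hom C T' N"
        and IH: "len X \<cdot> (f \<cdot> \<langle>a \<cdot> t, i\<rangle>) = (n \<cdot> (a \<cdot> t)) \<ominus> ((n \<cdot> (a \<cdot> t)) \<ominus> i)"
      let ?c = "suc i \<ominus> (n \<cdot> (a \<cdot> t))"
      show "len X \<cdot> (f \<cdot> \<langle>a \<cdot> t, suc i\<rangle>) = (n \<cdot> (a \<cdot> t)) \<ominus> ((n \<cdot> (a \<cdot> t)) \<ominus> suc i)"
      proof (rule nat_cases_eqI[of ?c T' _ N])
        fix S s assume s: "s \<in> Hom C S T'"
        define b j m where "b = a \<cdot> (t \<cdot> s)" and "j = i \<cdot> s" and "m = n \<cdot> b"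
        have b: "b \<in> Hom C S Y" and j: "j \<in> Hom C S N" "suc j \<in> Hom C S N" and m: "m \<in> Hom C S N"
          and c: "?c \<cdot> s = suc j \<ominus> m"
          using a t s i n unfolding b_def j_def m_def by (auto simp: hom_iff)
        have "(len X \<cdot> (f \<cdot> \<langle>a \<cdot> t, i\<rangle>)) \<cdot> s = ((n \<cdot> (a \<cdot> t)) \<ominus> ((n \<cdot> (a \<cdot> t)) \<ominus> i)) \<cdot> s" unfolding IH ..
        then have IH': "len X \<cdot> (f \<cdot> \<langle>b, j\<rangle>) = m \<ominus> (m \<ominus> j)"
          using a t s i n f X unfolding b_def j_def m_def by (simp add: hom_iff)
        have goal: "(len X \<cdot> (f \<cdot> \<langle>a \<cdot> t, suc i\<rangle>)) \<cdot> s = ((n \<cdot> (a \<cdot> t)) \<ominus> ((n \<cdot> (a \<cdot> t)) \<ominus> suc i)) \<cdot> s" (is ?goal)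
          if "len X \<cdot> (f \<cdot> \<langle>b, suc j\<rangle>) = m \<ominus> (m \<ominus> suc j)"
          using that a t s i n f X unfolding b_def j_def m_def by (simp add: hom_iff)
        {
          assume z: "?c \<cdot> s = zero_at S"
          note less = z[unfolded c]
          have "len X \<cdot> (f \<cdot> \<langle>b, j\<rangle>) = j"
            using IH' unfolding le_imp_minus_minus[OF j(1) m less_imp_le[OF j(1) m less]] .
          then have "len X \<cdot> (f \<cdot> \<langle>b, suc j\<rangle>) = m \<ominus> (m \<ominus> suc j)"
            unfolding f1[OF b j(1) less[unfolded m_def]] le_imp_minus_minus[OF j(2) m less]
            using \<phi>[OF b j(1) less[unfolded m_def]] f b j X by (simp add: hom_iff)
          then show ?goal by (rule goal)
        next
          fix v assume v: "v \<in> Hom C S N" and ge: "?c \<cdot> s = suc v"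
          have "len X \<cdot> (f \<cdot> \<langle>b, suc j\<rangle>) = m \<ominus> (m \<ominus> suc j)"
            unfolding f2[OF b j(1) v ge[unfolded c m_def]]
            using IH' not_less_imp_minus[OF j(1) m v ge[unfolded c]] j m by (simp add: hom_iff)
          then show ?goal by (rule goal)
        }
      qed (use a t i n f X in \<open>auto simp: hom_iff\<close>)
    qed (use a n f X in \<open>simp_all add: hom_iff\<close>)
    then show ?thesis using a by (simp add: hom_iff)
  qed
  \<comment> \<open>Taking tails undoes the recursion, so dropping from the finished list returns
    its intermediate values.\<close>
  have drop_f: "drop X \<cdot> \<langle>f \<cdot> \<langle>a, n \<cdot> a\<rangle>, i\<rangle> = f \<cdot> \<langle>a, (n \<cdot> a) \<ominus> i\<rangle>" if a: "a \<in> Hom C T Y" and i: "i \<in> Hom C T N" for a i T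
  proof -
    have "drop X \<cdot> \<langle>f \<cdot> \<langle>a \<cdot> Id C T, n \<cdot> (a \<cdot> Id C T)\<rangle>, i\<rangle> = f \<cdot> \<langle>a \<cdot> Id C T, (n \<cdot> (a \<cdot> Id C T)) \<ominus> i\<rangle>"
    proof (rule nat_induct_eqI[OF i, where Z = ?LX and F = "\<lambda>t i. drop X \<cdot> \<langle>f \<cdot> \<langle>a \<cdot> t, n \<cdot> (a \<cdot> t)\<rangle>, i\<rangle>"
          and G = "\<lambda>t i. f \<cdot> \<langle>a \<cdot> t, (n \<cdot> (a \<cdot> t)) \<ominus> i\<rangle>"])
      fix T' t i assume t: "t \<in> Hom C T' T" and i: "i \<in> Hom C T' N"
        and IH: "drop X \<cdot> \<langle>f \<cdot> \<langle>a \<cdot> t, n \<cdot> (a \<cdot> t)\<rangle>, i\<rangle> = f \<cdot> \<langle>a \<cdot> t, (n \<cdot> (a \<cdot> t)) \<ominus> i\<rangle>"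
      let ?d = "(n \<cdot> (a \<cdot> t)) \<ominus> i"
      have at: "a \<cdot> t \<in> Hom C T' Y" and nat: "n \<cdot> (a \<cdot> t) \<in> Hom C T' N" and d: "?d \<in> Hom C T' N"
        using a t n i by (auto simp: hom_iff)
      have at_s: "(tail X \<cdot> (f \<cdot> \<langle>a \<cdot> t, ?d\<rangle>)) \<cdot> s = tail X \<cdot> (f \<cdot> \<langle>a \<cdot> (t \<cdot> s), ?d \<cdot> s\<rangle>)"
        "(f \<cdot> \<langle>a \<cdot> t, pre ?d\<rangle>) \<cdot> s = f \<cdot> \<langle>a \<cdot> (t \<cdot> s), pre (?d \<cdot> s)\<rangle>" if "s \<in> Hom C S T'" for s S
        using that a t d f X i n by (simp_all add: hom_iff)
      have "tail X \<cdot> (f \<cdot> \<langle>a \<cdot> t, ?d\<rangle>) = f \<cdot> \<langle>a \<cdot> t, pre ?d\<rangle>"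
      proof (rule nat_cases_eqI[OF d, of _ ?LX])
        fix S s assume s: "s \<in> Hom C S T'" and z: "?d \<cdot> s = zero_at S"
        have ats: "a \<cdot> (t \<cdot> s) \<in> Hom C S Y" using a t s by (auto simp: hom_iff)
        show "(tail X \<cdot> (f \<cdot> \<langle>a \<cdot> t, ?d\<rangle>)) \<cdot> s = (f \<cdot> \<langle>a \<cdot> t, pre ?d\<rangle>) \<cdot> s"
          unfolding at_s[OF s] z using f0[OF ats] ats X by (simp add: hom_iff)
      next
        fix S s j assume s: "s \<in> Hom C S T'" and j: "j \<in> Hom C S N" and sj: "?d \<cdot> s = suc j"
        have ats: "a \<cdot> (t \<cdot> s) \<in> Hom C S Y" using a t s by (auto simp: hom_iff)
        \<comment> \<open>Since \<open>suc j\<close> is the difference \<open>n - i\<close>, it is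
          at most \<open>n\<close>. Hence the recursion did add an entry at \<open>j\<close>, and
          the tail removes precisely that one.\<close>
        have "(?d \<ominus> (n \<cdot> (a \<cdot> t))) \<cdot> s = zero_at S"
          using minus_minus_self[OF nat i] s by (simp add: hom_iff)
        then have "(?d \<cdot> s) \<ominus> (n \<cdot> (a \<cdot> (t \<cdot> s))) = zero_at S"
          using a t s d n i by (simp add: hom_iff)
        then have less: "suc j \<ominus> (n \<cdot> (a \<cdot> (t \<cdot> s))) = zero_at S"
          unfolding sj .
        show "(tail X \<cdot> (f \<cdot> \<langle>a \<cdot> t, ?d\<rangle>)) \<cdot> s = (f \<cdot> \<langle>a \<cdot> t, pre ?d\<rangle>) \<cdot> s"
          unfolding at_s[OF s] sj f1[OF ats j less] using \<phi>[OF ats j less] j ats f X by (simp add: hom_iff)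
      qed (use a t i n f X in \<open>auto simp: hom_iff\<close>)
      then show "drop X \<cdot> \<langle>f \<cdot> \<langle>a \<cdot> t, n \<cdot> (a \<cdot> t)\<rangle>, suc i\<rangle> = f \<cdot> \<langle>a \<cdot> t, (n \<cdot> (a \<cdot> t)) \<ominus> suc i\<rangle>"
        using IH a t i n f X by (simp add: hom_iff)
    qed (use a n f X in \<open>simp_all add: hom_iff\<close>)
    then show ?thesis using a by (simp add: hom_iff)
  qed
  define l where "l = f \<cdot> \<langle>Id C Y, n\<rangle>"
  have l: "l \<in> Hom C Y ?LX" using f n Y unfolding l_def by (auto simp: hom_iff)
  have lt: "l \<cdot> t = f \<cdot> \<langle>t, n \<cdot> t\<rangle>" if "t \<in> Hom C T Y" for t T
    using that f n Y unfolding l_def by (simp add: hom_iff)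
  have len: "len X \<cdot> l = n"
    unfolding l_def using len_f[OF Id_Hom[OF Y] n] minus_self[OF n] n Y by (simp add: hom_iff)
  show thesis
  proof (rule that[OF l len])
    fix T t i assume t: "t \<in> Hom C T Y" and i: "i \<in> Hom C T N" and less: "suc i \<ominus> (n \<cdot> t) = zero_at T"
    have nt: "n \<cdot> t \<in> Hom C T N" "(n \<cdot> t) \<ominus> i \<in> Hom C T N" "(n \<cdot> t) \<ominus> suc i \<in> Hom C T N"
      and si: "suc i \<in> Hom C T N" using t n i by (auto simp: hom_iff)
    have "(len X \<cdot> l) \<cdot> t = n \<cdot> t" unfolding len ..
    then have lent: "len X \<cdot> (f \<cdot> \<langle>t, n \<cdot> t\<rangle>) = n \<cdot> t" using l t X lt[OF t] by (simp add: hom_iff)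
    \<comment> \<open>The final segments of lengths \<open>i\<close> and \<open>i + 1\<close> are
      the values of \<open>f\<close> at \<open>i\<close> and \<open>i + 1\<close>, so the entry
      condition is the recursion equation \<open>f1\<close>.\<close>
    show "is_entry X (l \<cdot> t) i (\<phi> t i)"
      unfolding is_entry_def lt[OF t] lent drop_f[OF t nt(2)] drop_f[OF t nt(3)]
        le_imp_minus_minus[OF si nt(1) less] le_imp_minus_minus[OF i nt(1) less_imp_le[OF i nt(1) less]]
      by (rule f1[OF t i less])
  qed
qed

end

section \<open>Right adjoints from universal arrows\<close>

lemma is_functorD:
  assumes "is_functor C D F"
  shows "category C" "category D" "X \<in> Obj C \<Longrightarrow> Omap F X \<in> Obj D"
    "X \<in> Obj C \<Longrightarrow> Amap F (Id C X) = Id D (Omap F X)"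
    "f \<in> Hom C X Y \<Longrightarrow> Amap F f \<in> Hom D (Omap F X) (Omap F Y)"
    "f \<in> Hom C X Y \<Longrightarrow> g \<in> Hom C Y Z \<Longrightarrow> Amap F (g \<cdot>\<^bsub>C\<^esub> f) = Amap F g \<cdot>\<^bsub>D\<^esub> Amap F f"
  using assms by (auto simp: is_functor_def Hom_def)

lemma is_functorI:
  assumes "category C" "category D" "\<And>X. X \<in> Obj C \<Longrightarrow> Omap F X \<in> Obj D"
    "\<And>X. X \<in> Obj C \<Longrightarrow> Amap F (Id C X) = Id D (Omap F X)"
    "\<And>f X Y. f \<in> Hom C X Y \<Longrightarrow> Amap F f \<in> Hom D (Omap F X) (Omap F Y)"
    "\<And>f g X Y Z. f \<in> Hom C X Y \<Longrightarrow> g \<in> Hom C Y Z \<Longrightarrow> Amap F (g \<cdot>\<^bsub>C\<^esub> f) = Amap F g \<cdot>\<^bsub>D\<^esub> Amap F f"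
  shows "is_functor C D F"
  using assms by (auto simp: is_functor_def Hom_def)

lemma is_functor_comp:
  assumes F: "is_functor A B F" and G: "is_functor B D G"
  shows "is_functor A D (G \<circ>\<^sub>F F)"
proof (rule is_functorI)
  fix f g X Y Z assume f: "f \<in> Hom A X Y" and g: "g \<in> Hom A Y Z"
  show "Amap (G \<circ>\<^sub>F F) (g \<cdot>\<^bsub>A\<^esub> f) = Amap (G \<circ>\<^sub>F F) g \<cdot>\<^bsub>D\<^esub> Amap (G \<circ>\<^sub>F F) f"
    using is_functorD(6)[OF F f g] is_functorD(6)[OF G is_functorD(5)[OF F f] is_functorD(5)[OF F g]]
    by (simp add: comp_functor_def)
qed (use is_functorD[OF F] is_functorD[OF G] in \<open>simp_all add: comp_functor_def\<close>)

lemma is_isoI: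
  assumes "category C" "f \<in> Hom C X Y" "g \<in> Hom C Y X" "g \<cdot>\<^bsub>C\<^esub> f = Id C X" "f \<cdot>\<^bsub>C\<^esub> g = Id C Y"
  shows "is_iso C f"
  using assms by (auto simp: is_iso_def Hom_def)

lemma is_iso_functor:
  assumes F: "is_functor C D F" and f: "f \<in> Hom C X Y" "is_iso C f"
  shows "is_iso D (Amap F f)"
proof -
  interpret category C using F by (rule is_functorD)
  obtain g where g: "g \<in> Hom C Y X" "g \<cdot>\<^bsub>C\<^esub> f = Id C X" "f \<cdot>\<^bsub>C\<^esub> g = Id C Y"
    using f by (auto simp: is_iso_def Hom_def)
  have "Amap F g \<cdot>\<^bsub>D\<^esub> Amap F f = Id D (Omap F X)" "Amap F f \<cdot>\<^bsub>D\<^esub> Amap F g = Id D (Omap F Y)"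
    using is_functorD(4)[OF F] is_functorD(6)[OF F f(1) g(1)] is_functorD(6)[OF F g(1) f(1)] f(1) g
    by (simp_all add: hom_iff)
  then show ?thesis
    using is_functorD(2,5)[OF F] f(1) g(1) by (intro is_isoI[of D _ "Omap F X" "Omap F Y" "Amap F g"]) auto
qed

lemma naturally_isomorphic_postcomp:
  assumes n: "naturally_isomorphic A B F G" and S: "is_functor B D S"
  shows "naturally_isomorphic A D (S \<circ>\<^sub>F F) (S \<circ>\<^sub>F G)"
proof -
  have F: "is_functor A B F" and G: "is_functor A B G" using n by (auto simp: naturally_isomorphic_def)
  interpret A: category A using F by (rule is_functorD)
  obtain \<eta> where \<eta>: "\<And>X. X \<in> Obj A \<Longrightarrow> \<eta> X \<in> Hom B (Omap F X) (Omap G X)"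
    "\<And>X. X \<in> Obj A \<Longrightarrow> is_iso B (\<eta> X)"
    "\<And>f. f \<in> Arr A \<Longrightarrow> \<eta> (Cod A f) \<cdot>\<^bsub>B\<^esub> Amap F f = Amap G f \<cdot>\<^bsub>B\<^esub> \<eta> (Dom A f)"
    using n unfolding naturally_isomorphic_def by blast
  show ?thesis
    unfolding naturally_isomorphic_def
  proof (intro conjI exI[of _ "\<lambda>X. Amap S (\<eta> X)"] ballI)
    fix X assume X: "X \<in> Obj A"
    show "Amap S (\<eta> X) \<in> Hom D (Omap (S \<circ>\<^sub>F F) X) (Omap (S \<circ>\<^sub>F G) X)"
      using is_functorD(5)[OF S \<eta>(1)[OF X]] by (simp add: comp_functor_def)
    show "is_iso D (Amap S (\<eta> X))" by (rule is_iso_functor[OF S \<eta>(1,2)[OF X]])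
  next
    fix f assume f: "f \<in> Arr A"
    have Ff: "Amap F f \<in> Hom B (Omap F (Dom A f)) (Omap F (Cod A f))"
      and Gf: "Amap G f \<in> Hom B (Omap G (Dom A f)) (Omap G (Cod A f))"
      using f F G by (auto simp: is_functor_def)
    show "Amap S (\<eta> (Cod A f)) \<cdot>\<^bsub>D\<^esub> Amap (S \<circ>\<^sub>F F) f = Amap (S \<circ>\<^sub>F G) f \<cdot>\<^bsub>D\<^esub> Amap S (\<eta> (Dom A f))"
      using is_functorD(6)[OF S Ff \<eta>(1)] is_functorD(6)[OF S \<eta>(1) Gf] \<eta>(3)[OF f] f
      by (simp add: comp_functor_def)
  qed (use F G S in \<open>auto intro: is_functor_comp\<close>)
qed

lemma naturally_isomorphic_precomp:
  assumes n: "naturally_isomorphic A B F G" and K: "is_functor D A K"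
  shows "naturally_isomorphic D B (F \<circ>\<^sub>F K) (G \<circ>\<^sub>F K)"
proof -
  have F: "is_functor A B F" and G: "is_functor A B G" using n by (auto simp: naturally_isomorphic_def)
  obtain \<eta> where \<eta>: "\<And>X. X \<in> Obj A \<Longrightarrow> \<eta> X \<in> Hom B (Omap F X) (Omap G X)"
    "\<And>X. X \<in> Obj A \<Longrightarrow> is_iso B (\<eta> X)"
    "\<And>f. f \<in> Arr A \<Longrightarrow> \<eta> (Cod A f) \<cdot>\<^bsub>B\<^esub> Amap F f = Amap G f \<cdot>\<^bsub>B\<^esub> \<eta> (Dom A f)"
    using n unfolding naturally_isomorphic_def by blast
  show ?thesis
    unfolding naturally_isomorphic_def
  proof (intro conjI exI[of _ "\<lambda>X. \<eta> (Omap K X)"] ballI)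
    fix X assume X: "X \<in> Obj D"
    show "\<eta> (Omap K X) \<in> Hom B (Omap (F \<circ>\<^sub>F K) X) (Omap (G \<circ>\<^sub>F K) X)" "is_iso B (\<eta> (Omap K X))"
      using \<eta>(1,2)[OF is_functorD(3)[OF K X]] by (auto simp: comp_functor_def)
  next
    fix f assume f: "f \<in> Arr D"
    have "Amap K f \<in> Hom A (Omap K (Dom D f)) (Omap K (Cod D f))"
      using f K by (auto simp: is_functor_def)
    then show "\<eta> (Omap K (Cod D f)) \<cdot>\<^bsub>B\<^esub> Amap (F \<circ>\<^sub>F K) f = Amap (G \<circ>\<^sub>F K) f \<cdot>\<^bsub>B\<^esub> \<eta> (Omap K (Dom D f))"
      using \<eta>(3)[of "Amap K f"] by (simp add: comp_functor_def Hom_def)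
  qed (use F G K in \<open>auto intro: is_functor_comp\<close>)
qed

text \<open>Functor records are total HOL functions, so functors that agree on all of
  \<open>A\<close> need not be equal as records.\<close>

lemma naturally_isomorphic_cong:
  assumes n: "naturally_isomorphic A B F G"
    and O: "\<And>X. X \<in> Obj A \<Longrightarrow> Omap F' X = Omap F X" and A: "\<And>f. f \<in> Arr A \<Longrightarrow> Amap F' f = Amap F f"
  shows "naturally_isomorphic A B F' G"
proof -
  have F: "is_functor A B F" using n by (simp add: naturally_isomorphic_def)
  interpret category A using F by (rule is_functorD)
  have "is_functor A B F'"
    using F unfolding is_functor_def by (simp add: O A)
  then show ?thesis
    using n unfolding naturally_isomorphic_def by (simp add: O A)
qed

text \<open>A right adjoint given objectwise: \<open>\<epsilon> Y\<close> is a universal arrow from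
  \<open>F\<close> to \<open>Y\<close>. Instantiated twice, to obtain \<open>Delta f\<close> from
  \<open>Sigma_functor C f\<close> and the dependent product from
  \<open>Delta \<pi>\<close>.\<close>

locale universal_arrows = C: category C + D: category D
  for C :: "('o, 'a, 'm) category_scheme" and D :: "('p, 'b, 'n) category_scheme" +
  fixes F :: "('o, 'a, 'p, 'b) functor_data" and G :: "'p \<Rightarrow> 'o" and \<epsilon> :: "'p \<Rightarrow> 'b"
  assumes F: "is_functor C D F"
    and G_Obj: "Y \<in> Obj D \<Longrightarrow> G Y \<in> Obj C"
    and \<epsilon>_Hom: "Y \<in> Obj D \<Longrightarrow> \<epsilon> Y \<in> Hom D (Omap F (G Y)) Y"
    and universal: "Z \<in> Obj C \<Longrightarrow> Y \<in> Obj D \<Longrightarrow> k \<in> Hom D (Omap F Z) Y \<Longrightarrow>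
      \<exists>!u. u \<in> Hom C Z (G Y) \<and> \<epsilon> Y \<cdot>\<^bsub>D\<^esub> Amap F u = k"
begin

abbreviation comp_D :: "'b \<Rightarrow> 'b \<Rightarrow> 'b" (infixl "\<bullet>" 70) where
  "g \<bullet> f \<equiv> g \<cdot>\<^bsub>D\<^esub> f"

definition transpose :: "'o \<Rightarrow> 'p \<Rightarrow> 'b \<Rightarrow> 'a" where
  "transpose Z Y k = (THE u. u \<in> Hom C Z (G Y) \<and> \<epsilon> Y \<bullet> Amap F u = k)"

lemma transpose:
  assumes "k \<in> Hom D (Omap F Z) Y" "Z \<in> Obj C"
  shows "transpose Z Y k \<in> Hom C Z (G Y)" "\<epsilon> Y \<bullet> Amap F (transpose Z Y k) = k"
proof -
  have "Y \<in> Obj D" using assms by (simp add: D.hom_iff)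
  from theI'[OF universal[OF assms(2) this assms(1)]]
  show "transpose Z Y k \<in> Hom C Z (G Y)" "\<epsilon> Y \<bullet> Amap F (transpose Z Y k) = k"
    by (auto simp: transpose_def)
qed

lemma untranspose_Hom:
  assumes "u \<in> Hom C Z (G Y)" "Y \<in> Obj D"
  shows "\<epsilon> Y \<bullet> Amap F u \<in> Hom D (Omap F Z) Y"
  by (rule D.Comp_Hom[OF is_functorD(5)[OF F assms(1)] \<epsilon>_Hom[OF assms(2)]])

lemma transpose_eqI:
  assumes "u \<in> Hom C Z (G Y)" "u' \<in> Hom C Z (G Y)" "Y \<in> Obj D"
    "\<epsilon> Y \<bullet> Amap F u = \<epsilon> Y \<bullet> Amap F u'"
  shows "u = u'"
  using universal[OF _ assms(3) untranspose_Hom[OF assms(2,3)]] assms by (auto simp: C.hom_iff)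

definition right_adjoint :: "('p, 'b, 'o, 'a) functor_data" where
  "right_adjoint = \<lparr>Omap = G, Amap = (\<lambda>v. transpose (G (Dom D v)) (Cod D v) (v \<bullet> \<epsilon> (Dom D v)))\<rparr>"

abbreviation Gmap :: "'b \<Rightarrow> 'a" where
  "Gmap \<equiv> Amap right_adjoint"

lemma right_adjoint_Omap [simp]: "Omap right_adjoint = G"
  by (simp add: right_adjoint_def)

lemma right_adjoint_Amap:
  assumes v: "v \<in> Hom D Y Y'"
  shows "Gmap v \<in> Hom C (G Y) (G Y')"
    "\<epsilon> Y' \<bullet> Amap F (Gmap v) = v \<bullet> \<epsilon> Y"
proof -
  have Y: "Y \<in> Obj D" "Dom D v = Y" "Cod D v = Y'" using v by (auto simp: D.hom_iff)
  have k: "v \<bullet> \<epsilon> Y \<in> Hom D (Omap F (G Y)) Y'"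
    by (rule D.Comp_Hom[OF \<epsilon>_Hom[OF Y(1)] v])
  show "Gmap v \<in> Hom C (G Y) (G Y')"
    "\<epsilon> Y' \<bullet> Amap F (Gmap v) = v \<bullet> \<epsilon> Y"
    using transpose[OF k G_Obj[OF Y(1)]] Y by (simp_all add: right_adjoint_def)
qed

text \<open>Naturality of the counit, precomposed with \<open>Amap F u\<close>. Through
  \<open>transpose_eqI\<close>, preservation of composition and the naturality of the adjunction
  reduce to it.\<close>

lemma \<epsilon>_right_adjoint_comp:
  assumes v: "v \<in> Hom D Y Y'" and u: "u \<in> Hom C Z (G Y)"
  shows "\<epsilon> Y' \<bullet> Amap F (Gmap v \<cdot>\<^bsub>C\<^esub> u) = v \<bullet> (\<epsilon> Y \<bullet> Amap F u)"
proof -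
  have Y: "Y \<in> Obj D" "Y' \<in> Obj D" using v by (auto simp: D.hom_iff)
  note Gv = right_adjoint_Amap[OF v]
  have "\<epsilon> Y' \<bullet> Amap F (Gmap v \<cdot>\<^bsub>C\<^esub> u)
    = \<epsilon> Y' \<bullet> (Amap F (Gmap v) \<bullet> Amap F u)"
    using is_functorD(6)[OF F u Gv(1)] by simp
  also have "\<dots> = (\<epsilon> Y' \<bullet> Amap F (Gmap v)) \<bullet> Amap F u"
    using D.Comp_assoc[OF is_functorD(5)[OF F u] is_functorD(5)[OF F Gv(1)] \<epsilon>_Hom[OF Y(2)]] by simp
  also have "\<dots> = v \<bullet> (\<epsilon> Y \<bullet> Amap F u)"
    unfolding Gv(2) by (rule D.Comp_assoc[OF is_functorD(5)[OF F u] \<epsilon>_Hom[OF Y(1)] v])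
  finally show ?thesis .
qed

lemma right_adjoint_functor: "is_functor D C right_adjoint"
proof (rule is_functorI)
  show "category D" "category C" by unfold_locales
  show "Omap right_adjoint Y \<in> Obj C" if "Y \<in> Obj D" for Y
    using that by (simp add: G_Obj)
  show "Gmap f \<in> Hom C (Omap right_adjoint X) (Omap right_adjoint Y)" if "f \<in> Hom D X Y" for f X Y
    using right_adjoint_Amap(1)[OF that] by simp
next
  fix Y assume Y: "Y \<in> Obj D"
  have id: "Id D Y \<in> Hom D Y Y" using Y by (rule D.Id_Hom)
  have "\<epsilon> Y \<bullet> Amap F (Gmap (Id D Y)) = \<epsilon> Y \<bullet> Amap F (Id C (G Y))"
    unfolding right_adjoint_Amap(2)[OF id] is_functorD(4)[OF F G_Obj[OF Y]]
    using D.Id_Comp[OF \<epsilon>_Hom[OF Y]] D.Comp_Id[OF \<epsilon>_Hom[OF Y]] by simp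
  then show "Gmap (Id D Y) = Id C (Omap right_adjoint Y)"
    using transpose_eqI[OF right_adjoint_Amap(1)[OF id] C.Id_Hom[OF G_Obj[OF Y]] Y] by simp
next
  fix f g X Y Z assume f: "f \<in> Hom D X Y" and g: "g \<in> Hom D Y Z"
  have X: "X \<in> Obj D" and Z: "Z \<in> Obj D" using f g by (auto simp: D.hom_iff)
  note gf = D.Comp_Hom[OF f g] and Gf = right_adjoint_Amap[OF f]
  show "Gmap (g \<bullet> f) = Gmap g \<cdot>\<^bsub>C\<^esub> Gmap f"
  proof (rule transpose_eqI[OF right_adjoint_Amap(1)[OF gf] C.Comp_Hom[OF Gf(1) right_adjoint_Amap(1)[OF g]] Z])
    show "\<epsilon> Z \<bullet> Amap F (Gmap (g \<bullet> f)) =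
      \<epsilon> Z \<bullet> Amap F (Gmap g \<cdot>\<^bsub>C\<^esub> Gmap f)"
      unfolding \<epsilon>_right_adjoint_comp[OF g Gf(1)] Gf(2) right_adjoint_Amap(2)[OF gf]
      by (rule D.Comp_assoc[OF \<epsilon>_Hom[OF X] f g])
  qed
qed

lemma right_adjoint_adjunction: "adjunction C D F right_adjoint"
  unfolding adjunction_def
proof (intro conjI exI[of _ transpose] ballI)
  show "is_functor C D F" by (rule F)
  show "is_functor D C right_adjoint" by (rule right_adjoint_functor)
next
  fix X Y assume X: "X \<in> Obj C" and Y: "Y \<in> Obj D"
  show "bij_betw (transpose X Y) (Hom D (Omap F X) Y) (Hom C X (Omap right_adjoint Y))"
  proof (rule bij_betw_byWitness[where f' = "\<lambda>u. \<epsilon> Y \<bullet> Amap F u"])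
    show "\<forall>k \<in> Hom D (Omap F X) Y. \<epsilon> Y \<bullet> Amap F (transpose X Y k) = k"
      using transpose(2) X by blast
    show "\<forall>u \<in> Hom C X (Omap right_adjoint Y). transpose X Y (\<epsilon> Y \<bullet> Amap F u) = u"
      using transpose_eqI[OF transpose(1) _ Y] transpose(2) untranspose_Hom[OF _ Y] X by simp
    show "transpose X Y ` Hom D (Omap F X) Y \<subseteq> Hom C X (Omap right_adjoint Y)"
      using transpose(1) X by auto
    show "(\<lambda>u. \<epsilon> Y \<bullet> Amap F u) ` Hom C X (Omap right_adjoint Y) \<subseteq> Hom D (Omap F X) Y"
      using untranspose_Hom[OF _ Y] by auto
  qed
next
  fix X X' Y Y' u v k
  assume X: "X \<in> Obj C" and X': "X' \<in> Obj C" and Y: "Y \<in> Obj D" and Y': "Y' \<in> Obj D"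
    and u: "u \<in> Hom C X' X" and v: "v \<in> Hom D Y Y'" and k: "k \<in> Hom D (Omap F X) Y"
  note Fu = is_functorD(5)[OF F u] and t = transpose[OF k X] and Gv = right_adjoint_Amap[OF v]
  note vk = D.Comp_Hom[OF k v]
  note vku = D.Comp_Hom[OF Fu vk]
  note Gvt = C.Comp_Hom[OF t(1) Gv(1)]
  show "transpose X' Y' (v \<bullet> k \<bullet> Amap F u) = Gmap v \<cdot>\<^bsub>C\<^esub> transpose X Y k \<cdot>\<^bsub>C\<^esub> u"
  proof (rule transpose_eqI[OF transpose(1)[OF vku X'] C.Comp_Hom[OF u Gvt] Y'])
    have "\<epsilon> Y' \<bullet> Amap F ((Gmap v \<cdot>\<^bsub>C\<^esub> transpose X Y k) \<cdot>\<^bsub>C\<^esub> u)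
      = (\<epsilon> Y' \<bullet> Amap F (Gmap v \<cdot>\<^bsub>C\<^esub> transpose X Y k)) \<bullet> Amap F u"
      unfolding is_functorD(6)[OF F u Gvt]
      by (rule D.Comp_assoc[symmetric, OF Fu is_functorD(5)[OF F Gvt] \<epsilon>_Hom[OF Y']])
    then show "\<epsilon> Y' \<bullet> Amap F (transpose X' Y' (v \<bullet> k \<bullet> Amap F u)) =
      \<epsilon> Y' \<bullet> Amap F (Gmap v \<cdot>\<^bsub>C\<^esub> transpose X Y k \<cdot>\<^bsub>C\<^esub> u)"
      unfolding transpose(2)[OF vku X'] \<epsilon>_right_adjoint_comp[OF v t(1)] t(2) by simp
  qed
qed

text \<open>\<open>\<tau> X\<close> is a second universal arrow from \<open>F\<close> to
  \<open>Omap K X\<close>, hence canonically isomorphic to the chosen one. This identifies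
  \<open>right_adjoint \<circ>\<^sub>F K\<close> without unfolding the construction of
  \<open>G\<close>.\<close>

lemma right_adjoint_comp_naturally_isomorphic:
  assumes H: "is_functor B C H" and K: "is_functor B D K"
    and \<tau>: "\<And>X. X \<in> Obj B \<Longrightarrow> \<tau> X \<in> Hom D (Omap F (Omap H X)) (Omap K X)"
    and \<tau>_universal: "\<And>X Z k. X \<in> Obj B \<Longrightarrow> Z \<in> Obj C \<Longrightarrow> k \<in> Hom D (Omap F Z) (Omap K X) \<Longrightarrow>
      \<exists>!u. u \<in> Hom C Z (Omap H X) \<and> \<tau> X \<bullet> Amap F u = k"
    and \<tau>_natural: "\<And>f X X'. f \<in> Hom B X X' \<Longrightarrow>
      \<tau> X' \<bullet> Amap F (Amap H f) = Amap K f \<bullet> \<tau> X"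
  shows "naturally_isomorphic B C H (right_adjoint \<circ>\<^sub>F K)"
  unfolding naturally_isomorphic_def
proof (intro conjI exI ballI)
  let ?\<eta> = "\<lambda>X. transpose (Omap H X) (Omap K X) (\<tau> X)"
  interpret B: category B using H by (rule is_functorD)
  show "is_functor B C H" by (rule H)
  show "is_functor B C (right_adjoint \<circ>\<^sub>F K)" by (rule is_functor_comp[OF K right_adjoint_functor])
  fix X assume X: "X \<in> Obj B"
  note HX = is_functorD(3)[OF H X] and KX = is_functorD(3)[OF K X]
  note \<eta> = transpose[OF \<tau>[OF X] HX]
  show "?\<eta> X \<in> Hom C (Omap H X) (Omap (right_adjoint \<circ>\<^sub>F K) X)"
    using \<eta>(1) by (simp add: comp_functor_def)
  note GKX = G_Obj[OF KX] and \<epsilon> = \<epsilon>_Hom[OF KX]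
  \<comment> \<open>The comparison in the other direction; both round trips fix a universal arrow
    and so are identities.\<close>
  obtain w where w: "w \<in> Hom C (G (Omap K X)) (Omap H X)" "\<tau> X \<bullet> Amap F w = \<epsilon> (Omap K X)"
    using \<tau>_universal[OF X GKX \<epsilon>] by blast
  note Fw = is_functorD(5)[OF F w(1)] and F\<eta> = is_functorD(5)[OF F \<eta>(1)]
  show "is_iso C (?\<eta> X)"
  proof (rule is_isoI[OF _ \<eta>(1) w(1)])
    show "category C" by unfold_locales
    have "\<tau> X \<bullet> Amap F (w \<cdot>\<^bsub>C\<^esub> ?\<eta> X) = (\<tau> X \<bullet> Amap F w) \<bullet> Amap F (?\<eta> X)"
      unfolding is_functorD(6)[OF F \<eta>(1) w(1)] using D.Comp_assoc[OF F\<eta> Fw \<tau>[OF X]] by simp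
    also have "\<dots> = \<tau> X" unfolding w(2) \<eta>(2) ..
    finally have "\<tau> X \<bullet> Amap F (w \<cdot>\<^bsub>C\<^esub> ?\<eta> X) = \<tau> X" .
    moreover have "\<tau> X \<bullet> Amap F (Id C (Omap H X)) = \<tau> X"
      unfolding is_functorD(4)[OF F HX] by (rule D.Comp_Id[OF \<tau>[OF X]])
    ultimately show "w \<cdot>\<^bsub>C\<^esub> ?\<eta> X = Id C (Omap H X)"
      using \<tau>_universal[OF X HX \<tau>[OF X]] C.Comp_Hom[OF \<eta>(1) w(1)] C.Id_Hom[OF HX] by blast
    have "\<epsilon> (Omap K X) \<bullet> Amap F (?\<eta> X \<cdot>\<^bsub>C\<^esub> w) = (\<epsilon> (Omap K X) \<bullet> Amap F (?\<eta> X)) \<bullet> Amap F w"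
      unfolding is_functorD(6)[OF F w(1) \<eta>(1)] using D.Comp_assoc[OF Fw F\<eta> \<epsilon>] by simp
    also have "\<dots> = \<epsilon> (Omap K X) \<bullet> Amap F (Id C (G (Omap K X)))"
      unfolding w(2) \<eta>(2) is_functorD(4)[OF F GKX] using D.Comp_Id[OF \<epsilon>] by simp
    finally show "?\<eta> X \<cdot>\<^bsub>C\<^esub> w = Id C (G (Omap K X))"
      by (intro transpose_eqI[OF C.Comp_Hom[OF w(1) \<eta>(1)] C.Id_Hom[OF GKX] KX])
  qed
next
  let ?\<eta> = "\<lambda>X. transpose (Omap H X) (Omap K X) (\<tau> X)"
  interpret B: category B using H by (rule is_functorD)
  fix f assume "f \<in> Arr B"
  then obtain X Y where f: "f \<in> Hom B X Y" by (simp add: Hom_def)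
  then have X: "X \<in> Obj B" and Y: "Y \<in> Obj B" and DC: "Dom B f = X" "Cod B f = Y" by (auto simp: B.hom_iff)
  note \<eta>X = transpose[OF \<tau>[OF X] is_functorD(3)[OF H X]] and \<eta>Y = transpose[OF \<tau>[OF Y] is_functorD(3)[OF H Y]]
  note Hf = is_functorD(5)[OF H f] and Kf = is_functorD(5)[OF K f]
  note KY = is_functorD(3)[OF K Y]
  have "?\<eta> Y \<cdot>\<^bsub>C\<^esub> Amap H f = Gmap (Amap K f) \<cdot>\<^bsub>C\<^esub> ?\<eta> X"
  proof (rule transpose_eqI[OF C.Comp_Hom[OF Hf \<eta>Y(1)] C.Comp_Hom[OF \<eta>X(1) right_adjoint_Amap(1)[OF Kf]] KY])
    have "\<epsilon> (Omap K Y) \<bullet> Amap F (?\<eta> Y \<cdot>\<^bsub>C\<^esub> Amap H f)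
      = (\<epsilon> (Omap K Y) \<bullet> Amap F (?\<eta> Y)) \<bullet> Amap F (Amap H f)"
      unfolding is_functorD(6)[OF F Hf \<eta>Y(1)]
      using D.Comp_assoc[OF is_functorD(5)[OF F Hf] is_functorD(5)[OF F \<eta>Y(1)] \<epsilon>_Hom[OF KY]] by simp
    also have "\<dots> = Amap K f \<bullet> \<tau> X" unfolding \<eta>Y(2) by (rule \<tau>_natural[OF f])
    also have "\<dots> = \<epsilon> (Omap K Y) \<bullet> Amap F (Gmap (Amap K f) \<cdot>\<^bsub>C\<^esub> ?\<eta> X)"
      unfolding \<epsilon>_right_adjoint_comp[OF Kf \<eta>X(1)] \<eta>X(2) ..
    finally show "\<epsilon> (Omap K Y) \<bullet> Amap F (?\<eta> Y \<cdot>\<^bsub>C\<^esub> Amap H f) =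
      \<epsilon> (Omap K Y) \<bullet> Amap F (Gmap (Amap K f) \<cdot>\<^bsub>C\<^esub> ?\<eta> X)" .
  qed
  then show "?\<eta> (Cod B f) \<cdot>\<^bsub>C\<^esub> Amap H f = Amap (right_adjoint \<circ>\<^sub>F K) f \<cdot>\<^bsub>C\<^esub> ?\<eta> (Dom B f)"
    unfolding DC by (simp add: comp_functor_def)
qed

end

section \<open>Slices and pullback functors\<close>

context category
begin

lemma slice_Obj_iff [simp]: "f \<in> Obj (slice C A) \<longleftrightarrow> f \<in> Arr C \<and> Cod C f = A"
  by (simp add: slice_def)

lemma slice_Hom_iff: "(f, h, g) \<in> Hom (slice C A) f' g' \<longleftrightarrow> f = f' \<and> g = g' \<and> f \<in> Arr C \<and> Cod C f = A \<and>
    g \<in> Arr C \<and> Cod C g = A \<and> h \<in> Hom C (Dom C f) (Dom C g) \<and> g \<cdot> h = f"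
  by (auto simp: slice_def Hom_def)

lemma slice_HomE:
  assumes "k \<in> Hom (slice C A) f g"
  obtains h where "k = (f, h, g)" "f \<in> Arr C" "Cod C f = A" "g \<in> Arr C" "Cod C g = A"
    "h \<in> Hom C (Dom C f) (Dom C g)" "g \<cdot> h = f"
  using assms by (cases k) (auto simp: slice_Hom_iff)

lemma slice_simps [simp]:
  "Comp (slice C A) (f', h', g') (f, h, g) = (f, h' \<cdot> h, g')"
  "Id (slice C A) f = (f, Id C (Dom C f), f)"
  "Dom (slice C A) (f, h, g) = f" "Cod (slice C A) (f, h, g) = g"
  by (simp_all add: slice_def)

lemma slice_category: "category (slice C A)"
proof
  fix f assume "f \<in> Arr (slice C A)"
  then show "Dom (slice C A) f \<in> Obj (slice C A)" "Cod (slice C A) f \<in> Obj (slice C A)"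
    by (auto simp: slice_def)
next
  fix X assume "X \<in> Obj (slice C A)"
  then show "Id (slice C A) X \<in> Hom (slice C A) X X"
    by (simp add: slice_Hom_iff Id_Hom)
next
  fix f g X Y Z assume "f \<in> Hom (slice C A) X Y" "g \<in> Hom (slice C A) Y Z"
  then show "g \<cdot>\<^bsub>slice C A\<^esub> f \<in> Hom (slice C A) X Z"
    by (elim slice_HomE) (auto simp: slice_Hom_iff hom_iff simp flip: assoc)
next
  fix f X Y assume "f \<in> Hom (slice C A) X Y"
  then show "f \<cdot>\<^bsub>slice C A\<^esub> Id (slice C A) X = f" "Id (slice C A) Y \<cdot>\<^bsub>slice C A\<^esub> f = f"
    by (elim slice_HomE; simp add: hom_iff)+
next
  fix f g h W X Y Z
  assume "f \<in> Hom (slice C A) W X" "g \<in> Hom (slice C A) X Y" "h \<in> Hom (slice C A) Y Z"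
  then show "h \<cdot>\<^bsub>slice C A\<^esub> g \<cdot>\<^bsub>slice C A\<^esub> f = h \<cdot>\<^bsub>slice C A\<^esub> (g \<cdot>\<^bsub>slice C A\<^esub> f)"
    by (elim slice_HomE) (simp add: hom_iff)
qed

lemma Sigma_functor_functor:
  assumes f: "f \<in> Arr C"
  shows "is_functor (slice C (Dom C f)) (slice C (Cod C f)) (Sigma_functor C f)"
proof (rule is_functorI)
  show "Amap (Sigma_functor C f) g \<in> Hom (slice C (Cod C f)) (Omap (Sigma_functor C f) X) (Omap (Sigma_functor C f) Y)"
    if "g \<in> Hom (slice C (Dom C f)) X Y" for g X Y
    using that f by (elim slice_HomE) (auto simp: Sigma_functor_def slice_Hom_iff hom_iff)
  show "Amap (Sigma_functor C f) (h \<cdot>\<^bsub>slice C (Dom C f)\<^esub> g) =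
      Amap (Sigma_functor C f) h \<cdot>\<^bsub>slice C (Cod C f)\<^esub> Amap (Sigma_functor C f) g"
    if "g \<in> Hom (slice C (Dom C f)) X Y" "h \<in> Hom (slice C (Dom C f)) Y Z" for g h X Y Z
    using that f by (elim slice_HomE) (simp add: Sigma_functor_def)
qed (use f in \<open>auto simp: slice_category Sigma_functor_def\<close>)

end

context finite_limit_category
begin

text \<open>Only the projections are chosen; the vertex is the domain of the first. One fixed choice
  per pair of arrows is needed to make pullback an object map.\<close>

definition pullback_of :: "'a \<Rightarrow> 'a \<Rightarrow> 'a \<times> 'a" where
  "pullback_of f g = (SOME pq. is_pullback C f g (Dom C (fst pq)) (fst pq) (snd pq))"

abbreviation pb1 :: "'a \<Rightarrow> 'a \<Rightarrow> 'a" where "pb1 f g \<equiv> fst (pullback_of f g)"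
abbreviation pb2 :: "'a \<Rightarrow> 'a \<Rightarrow> 'a" where "pb2 f g \<equiv> snd (pullback_of f g)"

lemma pb_is_pullback:
  assumes "f \<in> Arr C" "g \<in> Arr C" "Cod C g = Cod C f"
  shows "is_pullback C f g (Dom C (pb1 f g)) (pb1 f g) (pb2 f g)"
proof -
  have "f \<in> Hom C (Dom C f) (Cod C f)" "g \<in> Hom C (Dom C g) (Cod C f)"
    using assms by (auto simp: hom_iff)
  then obtain P p q where P: "is_pullback C f g P p q" using ex_is_pullback by blast
  then have "P = Dom C p" by (simp add: is_pullback_def hom_iff)
  with P have "\<exists>pq. is_pullback C f g (Dom C (fst pq)) (fst pq) (snd pq)" by auto
  from someI_ex[OF this] show ?thesis
    unfolding pullback_of_def .
qed

lemma pb_simps [simp]: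
  assumes "f \<in> Arr C" "g \<in> Arr C" "Cod C g = Cod C f"
  shows "pb1 f g \<in> Arr C" "Cod C (pb1 f g) = Dom C f"
    "pb2 f g \<in> Arr C" "Dom C (pb2 f g) = Dom C (pb1 f g)" "Cod C (pb2 f g) = Dom C g"
  using pb_is_pullback[OF assms] by (simp_all add: is_pullback_def hom_iff)

lemma pb_eq:
  assumes "f \<in> Arr C" "g \<in> Arr C" "Cod C g = Cod C f"
  shows "f \<cdot> pb1 f g = g \<cdot> pb2 f g"
  using pb_is_pullback[OF assms] by (simp add: is_pullback_def)

lemma pb_lift:
  assumes "f \<in> Arr C" "g \<in> Arr C" "Cod C g = Cod C f"
    "h \<in> Hom C X (Dom C f)" "k \<in> Hom C X (Dom C g)" "f \<cdot> h = g \<cdot> k"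
  shows "\<exists>!u. u \<in> Hom C X (Dom C (pb1 f g)) \<and> pb1 f g \<cdot> u = h \<and> pb2 f g \<cdot> u = k"
  by (rule pullback_lift[OF pb_is_pullback[OF assms(1-3)] assms(4-6)])

lemma pb_eqI:
  assumes f: "f \<in> Arr C" and g: "g \<in> Arr C" "Cod C g = Cod C f"
    and u: "u \<in> Hom C X (Dom C (pb1 f g))" and v: "v \<in> Hom C X (Dom C (pb1 f g))"
    and eq: "pb1 f g \<cdot> u = pb1 f g \<cdot> v" "pb2 f g \<cdot> u = pb2 f g \<cdot> v"
  shows "u = v"
proof -
  have "pb1 f g \<cdot> v \<in> Hom C X (Dom C f)" "pb2 f g \<cdot> v \<in> Hom C X (Dom C g)"
    using f g v by (auto simp: hom_iff)
  moreover have "f \<cdot> (pb1 f g \<cdot> v) = g \<cdot> (pb2 f g \<cdot> v)"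
    using pb_eq[OF f g] f g v by (simp add: hom_iff flip: assoc)
  ultimately show ?thesis
    using pb_lift[OF f g, of "pb1 f g \<cdot> v" X "pb2 f g \<cdot> v"] u v eq by metis
qed

text \<open>An arrow from \<open>f \<cdot> z\<close> to \<open>g\<close> over the codomain of
  \<open>f\<close> is a cone on \<open>f\<close> and \<open>g\<close> with first leg
  \<open>z\<close>, that is, an arrow from \<open>z\<close> to \<open>pb1 f g\<close> over the
  domain. The counit is the second projection.\<close>

lemma pullback_universal_arrows:
  assumes f: "f \<in> Arr C"
  shows "universal_arrows (slice C (Dom C f)) (slice C (Cod C f)) (Sigma_functor C f)
    (pb1 f) (\<lambda>g. (f \<cdot> pb1 f g, pb2 f g, g))"
proof (intro universal_arrows.intro universal_arrows_axioms.intro)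
  show "is_functor (slice C (Dom C f)) (slice C (Cod C f)) (Sigma_functor C f)"
    by (rule Sigma_functor_functor[OF f])
next
  fix z g k assume "z \<in> Obj (slice C (Dom C f))" and "g \<in> Obj (slice C (Cod C f))"
    and k: "k \<in> Hom (slice C (Cod C f)) (Omap (Sigma_functor C f) z) g"
  then have z: "z \<in> Arr C" "Cod C z = Dom C f" and g: "g \<in> Arr C" "Cod C g = Cod C f" by simp_all
  obtain h where h: "k = (f \<cdot> z, h, g)" "h \<in> Hom C (Dom C z) (Dom C g)" "g \<cdot> h = f \<cdot> z"
    using k z f by (elim slice_HomE) (simp add: Sigma_functor_def)
  have z': "z \<in> Hom C (Dom C z) (Dom C f)" using z f by (simp add: hom_iff)
  let ?P = "\<lambda>u. u \<in> Hom (slice C (Dom C f)) z (pb1 f g) \<and>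
    (f \<cdot> pb1 f g, pb2 f g, g) \<cdot>\<^bsub>slice C (Cod C f)\<^esub> Amap (Sigma_functor C f) u = k"
  have iff: "?P u \<longleftrightarrow> (\<exists>w. u = (z, w, pb1 f g) \<and> w \<in> Hom C (Dom C z) (Dom C (pb1 f g)) \<and>
      pb1 f g \<cdot> w = z \<and> pb2 f g \<cdot> w = h)" for u
    using z f g h(1) by (cases u) (auto simp: slice_Hom_iff Sigma_functor_def)
  obtain w where w: "w \<in> Hom C (Dom C z) (Dom C (pb1 f g))" "pb1 f g \<cdot> w = z" "pb2 f g \<cdot> w = h"
    "\<And>w'. w' \<in> Hom C (Dom C z) (Dom C (pb1 f g)) \<Longrightarrow> pb1 f g \<cdot> w' = z \<Longrightarrow> pb2 f g \<cdot> w' = h \<Longrightarrow> w' = w"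
    using pb_lift[OF f g z' h(2) h(3)[symmetric]] by (elim ex1E) blast
  show "\<exists>!u. ?P u"
    unfolding iff
  proof (rule ex1I[of _ "(z, w, pb1 f g)"])
    fix u assume "\<exists>w. u = (z, w, pb1 f g) \<and> w \<in> Hom C (Dom C z) (Dom C (pb1 f g)) \<and>
      pb1 f g \<cdot> w = z \<and> pb2 f g \<cdot> w = h"
    then show "u = (z, w, pb1 f g)" using w(4) by blast
  qed (use w(1-3) in blast)
qed (use f in \<open>auto simp: slice_category Sigma_functor_def slice_Hom_iff hom_iff pb_eq\<close>)

definition Delta :: "'a \<Rightarrow> ('a, 'a \<times> 'a \<times> 'a, 'a, 'a \<times> 'a \<times> 'a) functor_data" where
  "Delta f = universal_arrows.right_adjoint (slice C (Dom C f)) (slice C (Cod C f)) (Sigma_functor C f)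
    (pb1 f) (\<lambda>g. (f \<cdot> pb1 f g, pb2 f g, g))"

lemma Delta_is_Delta: "f \<in> Arr C \<Longrightarrow> is_Delta C f (Delta f)"
  unfolding is_Delta_def Delta_def
  by (rule universal_arrows.right_adjoint_adjunction[OF pullback_universal_arrows])

lemma Delta_functor: "f \<in> Arr C \<Longrightarrow> is_functor (slice C (Cod C f)) (slice C (Dom C f)) (Delta f)"
  unfolding Delta_def
  by (rule universal_arrows.right_adjoint_functor[OF pullback_universal_arrows])

lemma Delta_Omap [simp]: "f \<in> Arr C \<Longrightarrow> Omap (Delta f) = pb1 f"
  unfolding Delta_def
  by (rule universal_arrows.right_adjoint_Omap[OF pullback_universal_arrows])

text \<open>Makes the abstract adjoint concrete: on arrows it is the induced map between pullbacks,
  pinned down by its two projections.\<close>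

lemma Delta_AmapE:
  assumes f: "f \<in> Arr C" and g: "g \<in> Arr C" "Cod C g = Cod C f" and g': "g' \<in> Arr C" "Cod C g' = Cod C f"
    and h: "h \<in> Hom C (Dom C g) (Dom C g')" "g' \<cdot> h = g"
  obtains d where "Amap (Delta f) (g, h, g') = (pb1 f g, d, pb1 f g')"
    "d \<in> Hom C (Dom C (pb1 f g)) (Dom C (pb1 f g'))" "pb1 f g' \<cdot> d = pb1 f g" "pb2 f g' \<cdot> d = h \<cdot> pb2 f g"
proof -
  interpret u: universal_arrows "slice C (Dom C f)" "slice C (Cod C f)" "Sigma_functor C f"
    "pb1 f" "\<lambda>g. (f \<cdot> pb1 f g, pb2 f g, g)"
    by (rule pullback_universal_arrows[OF f])
  have v: "(g, h, g') \<in> Hom (slice C (Cod C f)) g g'"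
    using g g' h by (simp add: slice_Hom_iff)
  note a = u.right_adjoint_Amap[OF v, folded Delta_def]
  from a(1) obtain d where d: "Amap (Delta f) (g, h, g') = (pb1 f g, d, pb1 f g')"
    "d \<in> Hom C (Dom C (pb1 f g)) (Dom C (pb1 f g'))" "pb1 f g' \<cdot> d = pb1 f g"
    by (elim slice_HomE)
  moreover have "pb2 f g' \<cdot> d = h \<cdot> pb2 f g"
    using a(2) unfolding d(1) by (simp add: Sigma_functor_def)
  ultimately show thesis by (rule that)
qed

section \<open>The slice over the terminal object\<close>

lemma from_slice_One_functor: "is_functor (slice C (One C)) C (from_slice_One C)"
proof (rule is_functorI)
  show "Amap (from_slice_One C) f \<in> Hom C (Omap (from_slice_One C) X) (Omap (from_slice_One C) Y)"
    if "f \<in> Hom (slice C (One C)) X Y" for f X Y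
    using that by (elim slice_HomE) (simp add: from_slice_One_def)
  show "Amap (from_slice_One C) (g \<cdot>\<^bsub>slice C (One C)\<^esub> f) = Amap (from_slice_One C) g \<cdot> Amap (from_slice_One C) f"
    if "f \<in> Hom (slice C (One C)) X Y" "g \<in> Hom (slice C (One C)) Y Z" for f g X Y Z
    using that by (elim slice_HomE) (simp add: from_slice_One_def)
qed (auto simp: slice_category category_axioms from_slice_One_def)

lemma to_slice_One_functor: "is_functor C (slice C (One C)) (to_slice_One C)"
  by (rule is_functorI)
    (auto simp: slice_category category_axioms to_slice_One_def hom_iff slice_Hom_iff)

end

section \<open>The dependent product along \<open>E \<rightarrow> N\<close>\<close>

locale less_than_object = extensive_list_category +
  fixes E \<epsilon>
  assumes E: "is_less_than_object C E \<epsilon>"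
begin

section \<open>Elements of \<open>E\<close> as pairs of an index and a bound\<close>

definition \<pi> :: 'b where "\<pi> = Snd C N N \<cdot> \<epsilon>"

definition ind :: 'b where "ind = Fst C N N \<cdot> \<epsilon>"

lemma \<epsilon>_simps [simp]: "\<epsilon> \<in> Arr C" "Dom C \<epsilon> = E" "Cod C \<epsilon> = Prod C N N" "E \<in> Obj C"
  using equalizerD(1)[OF E[unfolded is_less_than_object_def]] by (simp_all add: prod_arr_def hom_iff)

lemma \<pi>_simps [simp]: "\<pi> \<in> Arr C" "Dom C \<pi> = E" "Cod C \<pi> = N"
  and ind_simps [simp]: "ind \<in> Arr C" "Dom C ind = E" "Cod C ind = N"
  by (simp_all add: \<pi>_def ind_def)

lemma ind_less:
  assumes e: "e \<in> Hom C T E"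
  shows "suc (ind \<cdot> e) \<ominus> (\<pi> \<cdot> e) = zero_at T"
proof -
  have "(truncated_minus C \<cdot> prod_arr C (succ C) (Id C N)) \<cdot> \<epsilon> = zero_at (Prod C N N) \<cdot> \<epsilon>"
    using equalizerD(2)[OF E[unfolded is_less_than_object_def]] .
  then have *: "suc ind \<ominus> \<pi> = zero_at E"
    by (simp add: prod_arr_def \<pi>_def ind_def)
  have "suc (ind \<cdot> e) \<ominus> (\<pi> \<cdot> e) = (suc ind \<ominus> \<pi>) \<cdot> e"
    using e by (simp add: hom_iff)
  also have "\<dots> = zero_at T"
    unfolding * using e by (simp add: hom_iff)
  finally show ?thesis .
qed

lemma less_lift:
  assumes i: "i \<in> Hom C T N" and n: "n \<in> Hom C T N" and less: "suc i \<ominus> n = zero_at T"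
  shows "\<exists>e \<in> Hom C T E. ind \<cdot> e = i \<and> \<pi> \<cdot> e = n"
proof -
  let ?f = "truncated_minus C \<cdot> prod_arr C (succ C) (Id C N)"
  have "\<langle>i, n\<rangle> \<in> Hom C T (Dom C ?f)" "?f \<cdot> \<langle>i, n\<rangle> = zero_at (Prod C N N) \<cdot> \<langle>i, n\<rangle>"
    using i n less by (auto simp: hom_iff prod_arr_def)
  from equalizer_lift[OF E[unfolded is_less_than_object_def] this]
  obtain e where e: "e \<in> Hom C T E" "\<epsilon> \<cdot> e = \<langle>i, n\<rangle>" by blast
  have "ind \<cdot> e = Fst C N N \<cdot> (\<epsilon> \<cdot> e)" "\<pi> \<cdot> e = Snd C N N \<cdot> (\<epsilon> \<cdot> e)"
    using e by (simp_all add: ind_def \<pi>_def hom_iff)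
  then show ?thesis using e i n by (auto simp: hom_iff)
qed

lemma E_eqI:
  assumes e: "e \<in> Hom C T E" and e': "e' \<in> Hom C T E" and eq: "ind \<cdot> e = ind \<cdot> e'" "\<pi> \<cdot> e = \<pi> \<cdot> e'"
  shows "e = e'"
proof -
  have pe: "\<epsilon> \<cdot> e = \<epsilon> \<cdot> e'"
    by (rule pair_ext[of _ T "N" "N"]) (use e e' eq in \<open>auto simp: hom_iff ind_def \<pi>_def\<close>)
  let ?f = "truncated_minus C \<cdot> prod_arr C (succ C) (Id C N)"
  let ?g = "zero_at (Prod C N N)"
  have k: "\<epsilon> \<cdot> e \<in> Hom C T (Dom C ?f)"
    using e by (simp add: hom_iff prod_arr_def)
  have "?f \<cdot> (\<epsilon> \<cdot> e) = (?f \<cdot> \<epsilon>) \<cdot> e" using e by (simp add: hom_iff prod_arr_def)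
  also have "\<dots> = (?g \<cdot> \<epsilon>) \<cdot> e"
    using equalizerD(2)[OF E[unfolded is_less_than_object_def]] by simp
  also have "\<dots> = ?g \<cdot> (\<epsilon> \<cdot> e)" using e by (simp add: hom_iff)
  finally show ?thesis
    using equalizer_lift[OF E[unfolded is_less_than_object_def] k] e e' pe by metis
qed

lemma ex1_entry:
  assumes X: "X \<in> Obj C" and l: "l \<in> Hom C T (L C X)" and e: "e \<in> Hom C T E" and len: "len X \<cdot> l = \<pi> \<cdot> e"
  shows "\<exists>!x. x \<in> Hom C T X \<and> is_entry X l (ind \<cdot> e) x"
proof -
  have i: "ind \<cdot> e \<in> Hom C T N" using e by (auto simp: hom_iff)
  obtain x where "x \<in> Hom C T X" "is_entry X l (ind \<cdot> e) x"
    using ex_entry[OF X l i] ind_less[OF e] unfolding len by blast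
  then show ?thesis
    using is_entry_unique[OF _ _ X l i] by blast
qed

text \<open>This makes \<open>L X\<close> a partial product of \<open>X\<close> along \<open>\<pi>\<close>, which is why \<open>\<pi>\<close> is exponentiable.\<close>

lemma ex1_list:
  assumes X: "X \<in> Obj C" and n: "n \<in> Hom C Y N" and v: "v \<in> Hom C (Dom C (pb1 \<pi> n)) X"
  shows "\<exists>!l. l \<in> Hom C Y (L C X) \<and> len X \<cdot> l = n \<and> is_entry X (l \<cdot> pb2 \<pi> n) (ind \<cdot> pb1 \<pi> n) v"
proof -
  let ?q = "pb1 \<pi> n" and ?p = "pb2 \<pi> n" let ?Q = "Dom C ?q"
  have n': "n \<in> Arr C" "Dom C n = Y" "Cod C n = N" using n by (auto simp: hom_iff)
  have nn: "n \<in> Arr C" "Cod C n = Cod C \<pi>" using n' by auto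
  have q: "?q \<in> Hom C ?Q E" and p: "?p \<in> Hom C ?Q Y" using n' n by (auto simp: hom_iff)
  have iq: "ind \<cdot> ?q \<in> Hom C ?Q N" using q by (auto simp: hom_iff)
  have pq: "\<pi> \<cdot> ?q = n \<cdot> ?p" using pb_eq[of \<pi> n] n' by simp
  \<comment> \<open>The pullback of \<open>\<pi>\<close> along \<open>n\<close> represents the pairs
    \<open>(t, i)\<close> with \<open>i < n t\<close>. Composition with \<open>v\<close> thereby
    becomes a natural family of the kind that \<open>ex_list\<close> accepts.\<close>
  have lift: "\<exists>!u. u \<in> Hom C T ?Q \<and> ?p \<cdot> u = t \<and> (ind \<cdot> ?q) \<cdot> u = i"
    if t: "t \<in> Hom C T Y" and i: "i \<in> Hom C T N" and less: "suc i \<ominus> (n \<cdot> t) = zero_at T" for T t i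
  proof -
    have nt: "n \<cdot> t \<in> Hom C T N" using n t by (auto simp: hom_iff)
    obtain e where e: "e \<in> Hom C T E" "ind \<cdot> e = i" "\<pi> \<cdot> e = n \<cdot> t"
      using less_lift[OF i nt less] by blast
    have "e \<in> Hom C T (Dom C \<pi>)" "t \<in> Hom C T (Dom C n)" using e t n' by auto
    from pb_lift[OF \<pi>_simps(1) nn this e(3)]
    obtain u where u: "u \<in> Hom C T ?Q" "?q \<cdot> u = e" "?p \<cdot> u = t" by blast
    show ?thesis
    proof (rule ex1I[of _ u])
      show "u \<in> Hom C T ?Q \<and> ?p \<cdot> u = t \<and> (ind \<cdot> ?q) \<cdot> u = i"
        using u e q by (simp add: hom_iff)
    next
      fix u' assume u': "u' \<in> Hom C T ?Q \<and> ?p \<cdot> u' = t \<and> (ind \<cdot> ?q) \<cdot> u' = i"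
      have qu: "?q \<cdot> u' \<in> Hom C T E" using u' q by (auto simp: hom_iff)
      have "\<pi> \<cdot> (?q \<cdot> u') = (\<pi> \<cdot> ?q) \<cdot> u'" using u' q by (simp add: hom_iff)
      also have "\<dots> = n \<cdot> (?p \<cdot> u')" unfolding pq using u' p n by (simp add: hom_iff)
      finally have "\<pi> \<cdot> (?q \<cdot> u') = n \<cdot> t" using u' by simp
      moreover have "ind \<cdot> (?q \<cdot> u') = (ind \<cdot> ?q) \<cdot> u'"
        using conjunct1[OF u'] q by (simp add: hom_iff)
      then have "ind \<cdot> (?q \<cdot> u') = i" using u' by simp
      ultimately have "?q \<cdot> u' = e"
        using E_eqI[OF qu e(1)] e by simp
      then show "u' = u"
        using pb_eqI[OF \<pi>_simps(1) nn, of u' T u] u u' by simp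
    qed
  qed
  define U where "U T t i = (THE u. u \<in> Hom C T ?Q \<and> ?p \<cdot> u = t \<and> (ind \<cdot> ?q) \<cdot> u = i)" for T t i
  have U: "U T t i \<in> Hom C T ?Q" "?p \<cdot> U T t i = t" "(ind \<cdot> ?q) \<cdot> U T t i = i"
    if "t \<in> Hom C T Y" "i \<in> Hom C T N" "suc i \<ominus> (n \<cdot> t) = zero_at T" for T t i
    using theI'[OF lift[OF that]] unfolding U_def by auto
  have U_eq: "U T t i = u"
    if "t \<in> Hom C T Y" "i \<in> Hom C T N" "suc i \<ominus> (n \<cdot> t) = zero_at T"
      "u \<in> Hom C T ?Q" "?p \<cdot> u = t" "(ind \<cdot> ?q) \<cdot> u = i" for T t i u
    using lift[OF that(1-3)] U[OF that(1-3)] that(4-) by blast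
  have less_q: "suc (ind \<cdot> ?q) \<ominus> (n \<cdot> ?p) = zero_at ?Q"
    using ind_less[OF q] unfolding pq .
  \<comment> \<open>The generic pair is classified by the identity, so the entry prescribed there is
    \<open>v\<close> itself.\<close>
  have Upq: "U ?Q ?p (ind \<cdot> ?q) = Id C ?Q"
    using p iq q less_q by (intro U_eq) (auto simp: hom_iff)
  obtain l where l: "l \<in> Hom C Y (L C X)" "len X \<cdot> l = n"
    "\<And>T t i. t \<in> Hom C T Y \<Longrightarrow> i \<in> Hom C T N \<Longrightarrow> suc i \<ominus> (n \<cdot> t) = zero_at T \<Longrightarrow>
      is_entry X (l \<cdot> t) i (v \<cdot> U (Dom C t) t i)"
  \<comment> \<open>The family receives only \<open>t\<close> and \<open>i\<close>; its stage is
    recovered as \<open>Dom C t\<close>.\<close>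
  proof (rule ex_list[OF X n, where \<phi> = "\<lambda>t i. v \<cdot> U (Dom C t) t i"])
    fix T t i assume t: "t \<in> Hom C T Y" and i: "i \<in> Hom C T N" and less: "suc i \<ominus> (n \<cdot> t) = zero_at T"
    have T: "Dom C t = T" using t by (simp add: hom_iff)
    note u = U[OF t i less]
    show "v \<cdot> U (Dom C t) t i \<in> Hom C T X" unfolding T by (rule Comp_Hom[OF u(1) v])
    fix T' r assume r: "r \<in> Hom C T' T"
    have "U T' (t \<cdot> r) (i \<cdot> r) = U T t i \<cdot> r"
    proof (rule U_eq)
      show "t \<cdot> r \<in> Hom C T' Y" "i \<cdot> r \<in> Hom C T' N" "U T t i \<cdot> r \<in> Hom C T' ?Q"
        using t i r u(1) by (auto simp: hom_iff)
      have "(suc i \<ominus> (n \<cdot> t)) \<cdot> r = zero_at T'"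
        unfolding less using t r by (simp add: hom_iff)
      then show "suc (i \<cdot> r) \<ominus> (n \<cdot> (t \<cdot> r)) = zero_at T'"
        using t i r n by (simp add: hom_iff)
      have "?p \<cdot> (U T t i \<cdot> r) = (?p \<cdot> U T t i) \<cdot> r" "(ind \<cdot> ?q) \<cdot> (U T t i \<cdot> r) = ((ind \<cdot> ?q) \<cdot> U T t i) \<cdot> r"
        using u(1) r p q by (simp_all add: hom_iff)
      then show "?p \<cdot> (U T t i \<cdot> r) = t \<cdot> r" "(ind \<cdot> ?q) \<cdot> (U T t i \<cdot> r) = i \<cdot> r"
        unfolding u by simp_all
    qed
    then show "v \<cdot> U (Dom C (t \<cdot> r)) (t \<cdot> r) (i \<cdot> r) = (v \<cdot> U (Dom C t) t i) \<cdot> r"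
      using t r u(1) v by (simp add: hom_iff)
  qed blast
  show ?thesis
  proof (rule ex1I[of _ l])
    have "is_entry X (l \<cdot> ?p) (ind \<cdot> ?q) (v \<cdot> U (Dom C ?p) ?p (ind \<cdot> ?q))"
      by (rule l(3)[OF p iq less_q])
    moreover have "v \<cdot> U (Dom C ?p) ?p (ind \<cdot> ?q) = v"
      using Upq p v by (simp add: hom_iff)
    ultimately show "l \<in> Hom C Y (L C X) \<and> len X \<cdot> l = n \<and> is_entry X (l \<cdot> ?p) (ind \<cdot> ?q) v"
      using l(1,2) by simp
  next
    fix l' assume l': "l' \<in> Hom C Y (L C X) \<and> len X \<cdot> l' = n \<and> is_entry X (l' \<cdot> ?p) (ind \<cdot> ?q) v"
    show "l' = l"
    proof (rule list_eqI[OF X])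
      fix T t i assume t: "t \<in> Hom C T Y" and i: "i \<in> Hom C T N"
        and less: "suc i \<ominus> (len X \<cdot> (l' \<cdot> t)) = zero_at T"
      have "(len X \<cdot> l') \<cdot> t = n \<cdot> t" using l' by simp
      then have "len X \<cdot> (l' \<cdot> t) = n \<cdot> t" using conjunct1[OF l'] t X by (simp add: hom_iff)
      with less have less': "suc i \<ominus> (n \<cdot> t) = zero_at T" by simp
      note u = U[OF t i less']
      have lp: "l' \<cdot> ?p \<in> Hom C ?Q (L C X)" using l' p by (auto simp: hom_iff)
      \<comment> \<open>The single condition on \<open>l'\<close> at the generic pair determines its
        entry at every \<open>(t, i)\<close>, by pulling back along \<open>U T t i\<close>. The
        entries of \<open>l\<close> are the same, so \<open>list_eqI\<close> applies.\<close>
      have "is_entry X ((l' \<cdot> ?p) \<cdot> U T t i) ((ind \<cdot> ?q) \<cdot> U T t i) (v \<cdot> U T t i)"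
        by (rule is_entry_Comp[OF _ X lp iq v u(1)]) (use l' in blast)
      moreover have "(l' \<cdot> ?p) \<cdot> U T t i = l' \<cdot> (?p \<cdot> U T t i)"
        using l' p u(1) by (simp add: hom_iff)
      ultimately have "is_entry X (l' \<cdot> t) i (v \<cdot> U T t i)" unfolding u by simp
      moreover have "is_entry X (l \<cdot> t) i (v \<cdot> U T t i)"
        using l(3)[OF t i less'] t by (simp add: hom_iff)
      moreover have "v \<cdot> U T t i \<in> Hom C T X" by (rule Comp_Hom[OF u(1) v])
      ultimately show "\<exists>x \<in> Hom C T X. is_entry X (l' \<cdot> t) i x \<and> is_entry X (l \<cdot> t) i x" by blast
    qed (use l l' in auto)
  qed
qed

section \<open>Evaluation of lists at elements of \<open>E\<close>\<close>

definition entry :: "'a \<Rightarrow> 'b \<Rightarrow> 'b \<Rightarrow> 'b" where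
  "entry X l e = (THE x. x \<in> Hom C (Dom C l) X \<and> is_entry X l (ind \<cdot> e) x)"

lemma entry:
  assumes "X \<in> Obj C" "l \<in> Hom C T (L C X)" "e \<in> Hom C T E" "len X \<cdot> l = \<pi> \<cdot> e"
  shows "entry X l e \<in> Hom C T X" "is_entry X l (ind \<cdot> e) (entry X l e)"
proof -
  have "Dom C l = T" using assms(2) by (simp add: hom_iff)
  with theI'[OF ex1_entry[OF assms]]
  show "entry X l e \<in> Hom C T X" "is_entry X l (ind \<cdot> e) (entry X l e)"
    unfolding entry_def by simp_all
qed

text \<open>All entries of the family of lists \<open>c\<close> at once. The domain is the pullback
  of \<open>\<pi>\<close> along the length, whose elements are a point of \<open>P\<close> together
  with an index below the length of the list there.\<close>

abbreviation entries :: "'a \<Rightarrow> 'b \<Rightarrow> 'b" where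
  "entries X c \<equiv> entry X (c \<cdot> pb2 \<pi> (len X \<cdot> c)) (pb1 \<pi> (len X \<cdot> c))"

lemma entries:
  assumes X: "X \<in> Obj C" and c: "c \<in> Hom C P (L C X)"
  shows "entries X c \<in> Hom C (Dom C (pb1 \<pi> (len X \<cdot> c))) X"
    "is_entry X (c \<cdot> pb2 \<pi> (len X \<cdot> c)) (ind \<cdot> pb1 \<pi> (len X \<cdot> c)) (entries X c)"
proof -
  let ?n = "len X \<cdot> c"
  let ?Q = "Dom C (pb1 \<pi> ?n)"
  have n: "?n \<in> Arr C" "Cod C ?n = Cod C \<pi>" "Dom C ?n = P" using X c by (auto simp: hom_iff)
  have l: "c \<cdot> pb2 \<pi> ?n \<in> Hom C ?Q (L C X)" and e: "pb1 \<pi> ?n \<in> Hom C ?Q E"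
    using n c pb_simps[OF \<pi>_simps(1) n(1,2)] by (auto simp: hom_iff)
  have "len X \<cdot> (c \<cdot> pb2 \<pi> ?n) = ?n \<cdot> pb2 \<pi> ?n"
    using X c n pb_simps[OF \<pi>_simps(1) n(1,2)] by (simp add: hom_iff)
  also have "\<dots> = \<pi> \<cdot> pb1 \<pi> ?n" using pb_eq[OF \<pi>_simps(1) n(1,2)] by simp
  finally show "entries X c \<in> Hom C ?Q X"
    "is_entry X (c \<cdot> pb2 \<pi> ?n) (ind \<cdot> pb1 \<pi> ?n) (entries X c)"
    by (auto intro: entry[OF X l e])
qed

text \<open>Entries are unique and stable under change of stage, so evaluating \<open>c\<close>
  after the pullback \<open>d\<close> of \<open>w\<close> is evaluating \<open>c \<cdot> w\<close>.
  This turns the factorization demanded by both universal properties below into the entry condition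
  of \<open>ex1_list\<close>.\<close>

lemma entries_Delta_eq_iff:
  assumes X: "X \<in> Obj C" and c: "c \<in> Hom C P (L C X)" and w: "w \<in> Hom C Y P" and n: "n = len X \<cdot> (c \<cdot> w)"
    and d: "d \<in> Hom C (Dom C (pb1 \<pi> n)) (Dom C (pb1 \<pi> (len X \<cdot> c)))"
      "pb1 \<pi> (len X \<cdot> c) \<cdot> d = pb1 \<pi> n" "pb2 \<pi> (len X \<cdot> c) \<cdot> d = w \<cdot> pb2 \<pi> n"
    and v: "v \<in> Hom C (Dom C (pb1 \<pi> n)) X"
  shows "entries X c \<cdot> d = v \<longleftrightarrow> is_entry X ((c \<cdot> w) \<cdot> pb2 \<pi> n) (ind \<cdot> pb1 \<pi> n) v"
proof -
  let ?m = "len X \<cdot> c"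
  let ?Q = "Dom C (pb1 \<pi> n)"
  have n': "n \<in> Arr C" "Cod C n = Cod C \<pi>" "Dom C n = Y" and m: "?m \<in> Arr C" "Cod C ?m = Cod C \<pi>" "Dom C ?m = P"
    using X c w n by (auto simp: hom_iff)
  note pn = pb_simps[OF \<pi>_simps(1) n'(1,2)] and pm = pb_simps[OF \<pi>_simps(1) m(1,2)]
  note e = entries[OF X c]
  have cp: "c \<cdot> pb2 \<pi> ?m \<in> Hom C (Dom C (pb1 \<pi> ?m)) (L C X)" "ind \<cdot> pb1 \<pi> ?m \<in> Hom C (Dom C (pb1 \<pi> ?m)) N"
    and l: "(c \<cdot> w) \<cdot> pb2 \<pi> n \<in> Hom C ?Q (L C X)" and i: "ind \<cdot> pb1 \<pi> n \<in> Hom C ?Q N"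
    using c w m n' pn pm by (auto simp: hom_iff)
  have ed: "entries X c \<cdot> d \<in> Hom C ?Q X" by (rule Comp_Hom[OF d(1) e(1)])
  have "(c \<cdot> pb2 \<pi> ?m) \<cdot> d = c \<cdot> (pb2 \<pi> ?m \<cdot> d)" "(ind \<cdot> pb1 \<pi> ?m) \<cdot> d = ind \<cdot> (pb1 \<pi> ?m \<cdot> d)"
    using c d(1) pm m by (simp_all add: hom_iff)
  moreover have "c \<cdot> (w \<cdot> pb2 \<pi> n) = (c \<cdot> w) \<cdot> pb2 \<pi> n"
    using c w pn n' by (simp add: hom_iff)
  ultimately have "is_entry X ((c \<cdot> w) \<cdot> pb2 \<pi> n) (ind \<cdot> pb1 \<pi> n) (entries X c \<cdot> d)"
    using is_entry_Comp[OF e(2) X cp e(1) d(1)] d by simp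
  then show ?thesis
    using is_entry_unique[OF _ _ X l i ed v] by blast
qed

text \<open>The list \<open>[(n - 1, n), ..., (0, n)]\<close> of all elements of the fibre of \<open>\<pi>\<close> over \<open>n\<close>.\<close>

definition enum :: 'b where
  "enum = (THE l. l \<in> Hom C N (L C E) \<and> len E \<cdot> l = Id C N \<and>
    is_entry E (l \<cdot> pb2 \<pi> (Id C N)) (ind \<cdot> pb1 \<pi> (Id C N)) (pb1 \<pi> (Id C N)))"

lemma enum:
  "enum \<in> Hom C N (L C E)" "len E \<cdot> enum = Id C N"
  "is_entry E (enum \<cdot> pb2 \<pi> (Id C N)) (ind \<cdot> pb1 \<pi> (Id C N)) (pb1 \<pi> (Id C N))"
proof -
  let ?I = "Id C N"
  have "?I \<in> Hom C N N" "pb1 \<pi> ?I \<in> Hom C (Dom C (pb1 \<pi> ?I)) E"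
    by (auto simp: hom_iff)
  from theI'[OF ex1_list[OF _ this]]
  show "enum \<in> Hom C N (L C E)" "len E \<cdot> enum = Id C N"
    "is_entry E (enum \<cdot> pb2 \<pi> (Id C N)) (ind \<cdot> pb1 \<pi> (Id C N)) (pb1 \<pi> (Id C N))"
    unfolding enum_def by simp_all
qed

text \<open>The property defining \<open>enum\<close> lives on the pullback of \<open>\<pi>\<close>
  along \<open>Id C N\<close>, which is a copy of \<open>E\<close>. The element \<open>e\<close>
  factors through it by \<open>u\<close>, and the property is pulled back along
  \<open>u\<close>.\<close>

lemma is_entry_enum:
  assumes e: "e \<in> Hom C T E"
  shows "is_entry E (enum \<cdot> (\<pi> \<cdot> e)) (ind \<cdot> e) e"
proof -
  let ?I = "Id C N" let ?q = "pb1 \<pi> ?I" and ?p = "pb2 \<pi> ?I"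
  have I: "?I \<in> Arr C" "Cod C ?I = Cod C \<pi>" by auto
  note pI = pb_simps[OF \<pi>_simps(1) I]
  have "e \<in> Hom C T (Dom C \<pi>)" "\<pi> \<cdot> e \<in> Hom C T (Dom C ?I)" "\<pi> \<cdot> e = ?I \<cdot> (\<pi> \<cdot> e)"
    using e by (auto simp: hom_iff)
  from pb_lift[OF \<pi>_simps(1) I this]
  obtain u where u: "u \<in> Hom C T (Dom C ?q)" "?q \<cdot> u = e" "?p \<cdot> u = \<pi> \<cdot> e" by blast
  have q: "?q \<in> Hom C (Dom C ?q) E" "ind \<cdot> ?q \<in> Hom C (Dom C ?q) N" "enum \<cdot> ?p \<in> Hom C (Dom C ?q) (L C E)"
    using enum(1) pI by (auto simp: hom_iff)
  have "is_entry E ((enum \<cdot> ?p) \<cdot> u) ((ind \<cdot> ?q) \<cdot> u) (?q \<cdot> u)"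
    by (rule is_entry_Comp[OF enum(3) _ q(3,2,1) u(1)]) simp
  moreover have "(enum \<cdot> ?p) \<cdot> u = enum \<cdot> (?p \<cdot> u)" "(ind \<cdot> ?q) \<cdot> u = ind \<cdot> (?q \<cdot> u)"
    using enum(1) pI u(1) by (simp_all add: hom_iff)
  ultimately show ?thesis unfolding u(2,3) by simp
qed

text \<open>\<open>\<Pi> u\<close> consists of the lists \<open>l : L U\<close> whose entry with index \<open>i\<close> lies over \<open>(i, len l)\<close>.\<close>

definition Pi_incl :: "'b \<Rightarrow> 'b" where
  "Pi_incl u = (SOME m. is_equalizer C (list_arr C u) (enum \<cdot> len (Dom C u)) (Dom C m) m)"

lemma Pi_incl:
  assumes u: "u \<in> Arr C" "Cod C u = E"
  shows "is_equalizer C (list_arr C u) (enum \<cdot> len (Dom C u)) (Dom C (Pi_incl u)) (Pi_incl u)"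
proof -
  have "list_arr C u \<in> Hom C (L C (Dom C u)) (L C E)" "enum \<cdot> len (Dom C u) \<in> Hom C (L C (Dom C u)) (L C E)"
    using u enum(1) by (auto simp: hom_iff)
  then obtain P m where m: "is_equalizer C (list_arr C u) (enum \<cdot> len (Dom C u)) P m"
    using ex_equalizer by blast
  then have "P = Dom C m" by (simp add: is_equalizer_def hom_iff)
  with m have "\<exists>m. is_equalizer C (list_arr C u) (enum \<cdot> len (Dom C u)) (Dom C m) m" by blast
  from someI_ex[OF this] show ?thesis unfolding Pi_incl_def .
qed

lemma Pi_incl_Hom:
  assumes u: "u \<in> Arr C" "Cod C u = E"
  shows "Pi_incl u \<in> Hom C (Dom C (Pi_incl u)) (L C (Dom C u))"
  using equalizerD(1)[OF Pi_incl[OF u]] u by simp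

abbreviation Pi_Obj :: "'b \<Rightarrow> 'b" where
  "Pi_Obj u \<equiv> len (Dom C u) \<cdot> Pi_incl u"

text \<open>An arrow from the pullback of \<open>n\<close> to \<open>u\<close> over \<open>E\<close>
  is an arrow \<open>v\<close> with \<open>u \<cdot> v = pb1 \<pi> n\<close>. By
  \<open>ex1_list\<close> the arrow \<open>v\<close> is a list \<open>l\<close> of length
  \<open>n\<close>, and the condition on \<open>v\<close> says that
  \<open>list_arr C u \<cdot> l\<close> lists the fibre of \<open>\<pi>\<close>, so that
  \<open>l\<close> factors through the equalizer. The counit evaluates the lists in
  \<open>Pi_incl u\<close>.\<close>

lemma Pi_universal_arrows:
  "universal_arrows (slice C N) (slice C E) (Delta \<pi>) Pi_Obj
    (\<lambda>u. (pb1 \<pi> (Pi_Obj u), entries (Dom C u) (Pi_incl u), u))"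
proof (intro universal_arrows.intro universal_arrows_axioms.intro)
  show "is_functor (slice C N) (slice C E) (Delta \<pi>)"
    using Delta_functor[of \<pi>] by simp
next
  fix u assume "u \<in> Obj (slice C E)"
  then have u: "u \<in> Arr C" "Cod C u = E" and U: "Dom C u \<in> Obj C" by auto
  let ?U = "Dom C u" and ?m = "Pi_incl u"
  have u': "u \<in> Hom C ?U E" using u by (simp add: hom_iff)
  note m = Pi_incl_Hom[OF u]
  then have m': "?m \<in> Arr C" "Cod C ?m = L C ?U" by (auto simp: hom_iff)
  have m_eq: "list_arr C u \<cdot> ?m = enum \<cdot> Pi_Obj u"
    using equalizerD(2)[OF Pi_incl[OF u]] m' enum(1) U by (simp add: hom_iff)
  have n: "Pi_Obj u \<in> Arr C" "Cod C (Pi_Obj u) = Cod C \<pi>" "Dom C (Pi_Obj u) = Dom C ?m"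
    using m' U by auto
  then show "Pi_Obj u \<in> Obj (slice C N)" by simp
  note p = pb_simps[OF \<pi>_simps(1) n(1,2)]
  let ?q = "pb1 \<pi> (Pi_Obj u)" and ?p = "pb2 \<pi> (Pi_Obj u)"
  note e = entries[OF U m]
  have q: "?q \<in> Hom C (Dom C ?q) E" and iq: "ind \<cdot> ?q \<in> Hom C (Dom C ?q) N"
    and mp: "?m \<cdot> ?p \<in> Hom C (Dom C ?q) (L C ?U)"
    using p m' n U by (auto simp: hom_iff)
  \<comment> \<open>Both sides are the entry with index \<open>ind \<cdot> ?q\<close> of one and the
    same list: \<open>m_eq\<close> identifies the image of the universal list with a list of
    \<open>enum\<close>.\<close>
  have "u \<cdot> entries ?U ?m = ?q"
  proof (rule is_entry_unique)
    have "is_entry E (list_arr C u \<cdot> (?m \<cdot> ?p)) (ind \<cdot> ?q) (u \<cdot> entries ?U ?m)"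
      by (rule is_entry_list_arr[OF e(2) u' mp iq e(1)])
    moreover have "list_arr C u \<cdot> (?m \<cdot> ?p) = (list_arr C u \<cdot> ?m) \<cdot> ?p"
      using u m' p n by simp
    moreover have "\<dots> = enum \<cdot> (\<pi> \<cdot> ?q)"
      unfolding m_eq pb_eq[OF \<pi>_simps(1) n(1,2)] using enum(1) p n m' U by (simp add: hom_iff)
    ultimately show "is_entry E (enum \<cdot> (\<pi> \<cdot> ?q)) (ind \<cdot> ?q) (u \<cdot> entries ?U ?m)" by simp
    show "is_entry E (enum \<cdot> (\<pi> \<cdot> ?q)) (ind \<cdot> ?q) ?q" by (rule is_entry_enum[OF q])
    show "enum \<cdot> (\<pi> \<cdot> ?q) \<in> Hom C (Dom C ?q) (L C E)" using enum(1) p by (auto simp: hom_iff)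
    show "u \<cdot> entries ?U ?m \<in> Hom C (Dom C ?q) E" by (rule Comp_Hom[OF e(1) u'])
  qed (use iq q in simp_all)
  then show "(?q, entries ?U ?m, u) \<in> Hom (slice C E) (Omap (Delta \<pi>) (Pi_Obj u)) u"
    using u e(1) p by (simp add: slice_Hom_iff)
next
  fix n u k assume n_Obj: "n \<in> Obj (slice C N)" and "u \<in> Obj (slice C E)"
    and k: "k \<in> Hom (slice C E) (Omap (Delta \<pi>) n) u"
  then have u: "u \<in> Arr C" "Cod C u = E" and U: "Dom C u \<in> Obj C"
    and n: "n \<in> Arr C" "Cod C n = Cod C \<pi>" by auto
  let ?U = "Dom C u" and ?m = "Pi_incl u" and ?Y = "Dom C n"
  let ?n' = "Pi_Obj u"
  have u': "u \<in> Hom C ?U E" using u by (simp add: hom_iff)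
  note m = Pi_incl_Hom[OF u]
  then have m': "?m \<in> Arr C" "Cod C ?m = L C ?U" by (auto simp: hom_iff)
  have n': "?n' \<in> Arr C" "Cod C ?n' = Cod C \<pi>" "Dom C ?n' = Dom C ?m"
    using m' U by auto
  have nY: "n \<in> Hom C ?Y N" using n by (simp add: hom_iff)
  note p = pb_simps[OF \<pi>_simps(1) n]
  let ?q = "pb1 \<pi> n" and ?p = "pb2 \<pi> n"
  obtain v where kv: "k = (?q, v, u)" and v: "v \<in> Hom C (Dom C ?q) ?U" "u \<cdot> v = ?q"
    using k by (elim slice_HomE) simp
  let ?\<epsilon> = "(pb1 \<pi> ?n', entries ?U ?m, u)"
  have iff: "?\<epsilon> \<cdot>\<^bsub>slice C E\<^esub> Amap (Delta \<pi>) (n, w, ?n') = k \<longleftrightarrow>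
      is_entry ?U ((?m \<cdot> w) \<cdot> ?p) (ind \<cdot> ?q) v"
    if w: "w \<in> Hom C ?Y (Dom C ?m)" "?n' \<cdot> w = n" for w
  proof -
    have "w \<in> Hom C (Dom C n) (Dom C ?n')" using w n' by simp
    then obtain d where d: "Amap (Delta \<pi>) (n, w, ?n') = (?q, d, pb1 \<pi> ?n')"
      "d \<in> Hom C (Dom C ?q) (Dom C (pb1 \<pi> ?n'))" "pb1 \<pi> ?n' \<cdot> d = ?q" "pb2 \<pi> ?n' \<cdot> d = w \<cdot> ?p"
      using Delta_AmapE[OF \<pi>_simps(1) n n'(1,2) _ w(2)] by blast
    have nw: "n = len ?U \<cdot> (?m \<cdot> w)" using w m' U by (simp add: hom_iff)
    have "entries ?U ?m \<cdot> d = v \<longleftrightarrow> is_entry ?U ((?m \<cdot> w) \<cdot> ?p) (ind \<cdot> ?q) v"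
      by (rule entries_Delta_eq_iff[OF U m w(1) nw d(2-4) v(1)])
    then show ?thesis unfolding d(1) kv by simp
  qed
  obtain l where l: "l \<in> Hom C ?Y (L C ?U)" "len ?U \<cdot> l = n" "is_entry ?U (l \<cdot> ?p) (ind \<cdot> ?q) v"
    and l_unique: "\<And>l'. l' \<in> Hom C ?Y (L C ?U) \<Longrightarrow> len ?U \<cdot> l' = n \<Longrightarrow>
      is_entry ?U (l' \<cdot> ?p) (ind \<cdot> ?q) v \<Longrightarrow> l' = l"
    using ex1_list[OF U nY v(1)] by blast
  have q: "?q \<in> Hom C (Dom C ?q) E" and iq: "ind \<cdot> ?q \<in> Hom C (Dom C ?q) N"
    and lp: "l \<cdot> ?p \<in> Hom C (Dom C ?q) (L C ?U)"
    using p l(1) by (auto simp: hom_iff)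
  \<comment> \<open>Both are lists over \<open>E\<close> of length \<open>n\<close> whose generic
    entry is \<open>?q\<close>, and \<open>ex1_list\<close> with \<open>X = E\<close> allows only
    one.\<close>
  have "list_arr C u \<cdot> l = enum \<cdot> n"
  proof -
    have EO: "E \<in> Obj C" by simp
    have 1: "list_arr C u \<cdot> l \<in> Hom C ?Y (L C E)" "enum \<cdot> n \<in> Hom C ?Y (L C E)"
      using u l(1) enum(1) nY by (auto simp: hom_iff)
    have "(len E \<cdot> list_arr C u) \<cdot> l = n" "(len E \<cdot> enum) \<cdot> n = n"
      unfolding len_list_arr[OF u'] enum(2) using l(2) n by simp_all
    then have 2: "len E \<cdot> (list_arr C u \<cdot> l) = n" "len E \<cdot> (enum \<cdot> n) = n"
      using u l(1) enum(1) n by (simp_all add: hom_iff)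
    have "is_entry E (list_arr C u \<cdot> (l \<cdot> ?p)) (ind \<cdot> ?q) (u \<cdot> v)"
      by (rule is_entry_list_arr[OF l(3) u' lp iq v(1)])
    then have 3: "is_entry E ((list_arr C u \<cdot> l) \<cdot> ?p) (ind \<cdot> ?q) ?q"
      unfolding v(2) using u l(1) p by (simp add: hom_iff)
    have "is_entry E (enum \<cdot> (\<pi> \<cdot> ?q)) (ind \<cdot> ?q) ?q" by (rule is_entry_enum[OF q])
    then have 4: "is_entry E ((enum \<cdot> n) \<cdot> ?p) (ind \<cdot> ?q) ?q"
      unfolding pb_eq[OF \<pi>_simps(1) n] using enum(1) n p by (simp add: hom_iff)
    show ?thesis
      using ex1_list[OF EO nY q] 1 2 3 4 by blast
  qed
  then have "list_arr C u \<cdot> l = (enum \<cdot> len ?U) \<cdot> l"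
    using enum(1) l(1,2) U by (simp add: hom_iff)
  moreover have "l \<in> Hom C ?Y (Dom C (list_arr C u))" using l(1) u by simp
  ultimately obtain w where w: "w \<in> Hom C ?Y (Dom C ?m)" "?m \<cdot> w = l"
    and w_unique: "\<And>w'. w' \<in> Hom C ?Y (Dom C ?m) \<Longrightarrow> ?m \<cdot> w' = l \<Longrightarrow> w' = w"
    using equalizer_lift[OF Pi_incl[OF u], of l ?Y] by blast
  have nw: "?n' \<cdot> w = n" using w l(2) m' U by (auto simp: hom_iff)
  show "\<exists>!w. w \<in> Hom (slice C N) n ?n' \<and> ?\<epsilon> \<cdot>\<^bsub>slice C E\<^esub> Amap (Delta \<pi>) w = k"
  proof (rule ex1I[of _ "(n, w, ?n')"], intro conjI)
    show "(n, w, ?n') \<in> Hom (slice C N) n ?n'"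
      using n n' w(1) nw by (simp add: slice_Hom_iff)
    show "?\<epsilon> \<cdot>\<^bsub>slice C E\<^esub> Amap (Delta \<pi>) (n, w, ?n') = k"
      unfolding iff[OF w(1) nw] w(2) by (rule l(3))
  next
    fix x assume x: "x \<in> Hom (slice C N) n ?n' \<and> ?\<epsilon> \<cdot>\<^bsub>slice C E\<^esub> Amap (Delta \<pi>) x = k"
    then obtain w' where x': "x = (n, w', ?n')" and w': "w' \<in> Hom C ?Y (Dom C ?m)" "?n' \<cdot> w' = n"
      using n' by (elim conjE slice_HomE) simp
    have e: "is_entry ?U ((?m \<cdot> w') \<cdot> ?p) (ind \<cdot> ?q) v"
      using x iff[OF w'] unfolding x' by blast
    have "?m \<cdot> w' = l"
      by (rule l_unique[OF _ _ e]) (use w' m' U in \<open>auto simp: hom_iff\<close>)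
    then show "x = (n, w, ?n')" using w_unique[OF w'(1)] x' by simp
  qed
qed (simp_all add: slice_category)

section \<open>The dependent product functor and its comparison with lists\<close>

definition Pi :: "('b, 'b \<times> 'b \<times> 'b, 'b, 'b \<times> 'b \<times> 'b) functor_data" where
  "Pi = universal_arrows.right_adjoint (slice C N) (slice C E) (Delta \<pi>) Pi_Obj
    (\<lambda>u. (pb1 \<pi> (Pi_Obj u), entries (Dom C u) (Pi_incl u), u))"

lemma Pi_is_Pi: "is_Pi C \<pi> Pi"
  unfolding is_Pi_def Pi_def
  using Delta_is_Delta[of \<pi>] universal_arrows.right_adjoint_adjunction[OF Pi_universal_arrows] by auto

text \<open>The list functor viewed over \<open>N\<close>. Composing with
  \<open>N \<rightarrow> 1\<close> returns the list functor over \<open>1\<close>, so what remains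
  is to compare this functor with \<open>Pi \<circ>\<^sub>F Delta (bang C E)\<close>.\<close>

definition len_functor :: "('b, 'b \<times> 'b \<times> 'b, 'b, 'b \<times> 'b \<times> 'b) functor_data" where
  "len_functor = \<lparr>Omap = (\<lambda>x. len (Dom C x)),
    Amap = (\<lambda>(x, h, y). (len (Dom C x), list_arr C h, len (Dom C y)))\<rparr>"

lemma len_functor_functor: "is_functor (slice C (One C)) (slice C N) len_functor"
proof (rule is_functorI)
  fix f X Y assume "f \<in> Hom (slice C (One C)) X Y"
  then show "Amap len_functor f \<in> Hom (slice C N) (Omap len_functor X) (Omap len_functor Y)"
    by (elim slice_HomE) (auto simp: len_functor_def slice_Hom_iff hom_iff intro!: len_list_arr)
next
  fix f g X Y Z assume "f \<in> Hom (slice C (One C)) X Y" "g \<in> Hom (slice C (One C)) Y Z"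
  then show "Amap len_functor (g \<cdot>\<^bsub>slice C (One C)\<^esub> f) =
    Amap len_functor g \<cdot>\<^bsub>slice C N\<^esub> Amap len_functor f"
    by (elim slice_HomE) (simp add: len_functor_def list_arr_Comp)
qed (auto simp: slice_category len_functor_def list_arr_Id)

text \<open>\<open>len X\<close> is a dependent product of
  \<open>E \<times> X \<rightarrow> E\<close>: an arrow into \<open>E \<times> X\<close> over
  \<open>E\<close> has a forced first component, and its second is a family of entries, hence by
  \<open>ex1_list\<close> a list of the given length. No equalizer is involved, so the comparison
  uses the universal property rather than the construction of \<open>Pi\<close>.\<close>

lemma len_functor_iso_Pi_Delta:
  "naturally_isomorphic (slice C (One C)) (slice C N) len_functor (Pi \<circ>\<^sub>F Delta (bang C E))"
proof -
  interpret P: universal_arrows "slice C N" "slice C E" "Delta \<pi>" Pi_Obj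
    "\<lambda>u. (pb1 \<pi> (Pi_Obj u), entries (Dom C u) (Pi_incl u), u)"
    by (rule Pi_universal_arrows)
  let ?b = "bang C E"
  have b: "?b \<in> Arr C" "Dom C ?b = E" "Cod C ?b = One C" by simp_all
  let ?q = "\<lambda>X. pb1 \<pi> (len X)" and ?p = "\<lambda>X. pb2 \<pi> (len X)" and ?e = "\<lambda>X. entries X (Id C (L C X))"
  have lenI: "len X \<cdot> Id C (L C X) = len X" if "X \<in> Obj C" for X using that by simp
  have e: "?e X \<in> Hom C (Dom C (?q X)) X" "is_entry X (?p X) (ind \<cdot> ?q X) (?e X)"
    "?q X \<in> Hom C (Dom C (?q X)) E" "?p X \<in> Hom C (Dom C (?q X)) (L C X)" if X: "X \<in> Obj C" for X
    using entries[OF X Id_Hom[OF L_Obj[OF X]]] pb_simps[of \<pi> "len X"] X by (simp_all add: hom_iff)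
  \<comment> \<open>The pairing of the projection to \<open>E\<close> with the evaluation of the
    generic list \<open>Id C (L C X)\<close>. The product \<open>E \<times> X\<close> appears as the
    pullback of \<open>bang C E\<close> and \<open>x\<close>.\<close>
  define t where "t x = (THE u. u \<in> Hom C (Dom C (?q (Dom C x))) (Dom C (pb1 ?b x)) \<and>
    pb1 ?b x \<cdot> u = ?q (Dom C x) \<and> pb2 ?b x \<cdot> u = ?e (Dom C x))" for x
  have t: "t x \<in> Hom C (Dom C (?q (Dom C x))) (Dom C (pb1 ?b x))" "pb1 ?b x \<cdot> t x = ?q (Dom C x)"
    "pb2 ?b x \<cdot> t x = ?e (Dom C x)" if x: "x \<in> Arr C" "Cod C x = Cod C ?b" for x
  proof -
    have X: "Dom C x \<in> Obj C" using x by simp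
    have q: "?q (Dom C x) \<in> Hom C (Dom C (?q (Dom C x))) (Dom C ?b)" using e(3)[OF X] by simp
    have "?b \<cdot> ?q (Dom C x) = x \<cdot> ?e (Dom C x)"
      using e(1,3)[OF X] x bang_eqI[of "x \<cdot> ?e (Dom C x)" "Dom C (?q (Dom C x))"] by (auto simp: hom_iff)
    from theI'[OF pb_lift[OF b(1) x q e(1)[OF X] this]]
    show "t x \<in> Hom C (Dom C (?q (Dom C x))) (Dom C (pb1 ?b x))" "pb1 ?b x \<cdot> t x = ?q (Dom C x)"
      "pb2 ?b x \<cdot> t x = ?e (Dom C x)"
      unfolding t_def by auto
  qed
  let ?\<tau> = "\<lambda>x. (?q (Dom C x), t x, pb1 ?b x)"
  show ?thesis
    unfolding Pi_def
  proof (rule P.right_adjoint_comp_naturally_isomorphic[OF len_functor_functor, where \<tau> = ?\<tau>])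
    show "is_functor (slice C (One C)) (slice C E) (Delta ?b)"
      using Delta_functor[OF b(1)] by simp
  next
    fix x assume "x \<in> Obj (slice C (One C))"
    then have x: "x \<in> Arr C" "Cod C x = Cod C ?b" by simp_all
    show "?\<tau> x \<in> Hom (slice C E) (Omap (Delta \<pi>) (Omap len_functor x)) (Omap (Delta ?b) x)"
      using t[OF x] e(3)[of "Dom C x"] x pb_simps[OF b(1) x]
      by (simp add: slice_Hom_iff len_functor_def hom_iff)
  next
    fix x n k assume "x \<in> Obj (slice C (One C))" and "n \<in> Obj (slice C N)"
      and k: "k \<in> Hom (slice C E) (Omap (Delta \<pi>) n) (Omap (Delta ?b) x)"
    then have x: "x \<in> Arr C" "Cod C x = Cod C ?b" and n: "n \<in> Arr C" "Cod C n = Cod C \<pi>"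
      and X: "Dom C x \<in> Obj C" by simp_all
    let ?X = "Dom C x" and ?Y = "Dom C n" and ?qn = "pb1 \<pi> n" and ?pn = "pb2 \<pi> n"
    have nY: "n \<in> Hom C ?Y N" using n by (simp add: hom_iff)
    obtain h where kh: "k = (?qn, h, pb1 ?b x)" and h: "h \<in> Hom C (Dom C ?qn) (Dom C (pb1 ?b x))"
      "pb1 ?b x \<cdot> h = ?qn"
      using k by (elim slice_HomE) simp
    \<comment> \<open>The component of \<open>h\<close> in \<open>E\<close> is fixed by the slice,
      so \<open>v\<close> is all the data in \<open>k\<close>.\<close>
    define v where "v = pb2 ?b x \<cdot> h"
    have v: "v \<in> Hom C (Dom C ?qn) ?X"
      unfolding v_def using h X pb_simps[OF b(1) x] by (simp add: hom_iff)
    have len_X: "len ?X \<in> Arr C" "Cod C (len ?X) = Cod C \<pi>" using X by simp_all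
    have iff: "?\<tau> x \<cdot>\<^bsub>slice C E\<^esub> Amap (Delta \<pi>) (n, l, len ?X) = k \<longleftrightarrow>
        is_entry ?X (l \<cdot> ?pn) (ind \<cdot> ?qn) v"
      if l: "l \<in> Hom C ?Y (L C ?X)" "len ?X \<cdot> l = n" for l
    proof -
      have "l \<in> Hom C (Dom C n) (Dom C (len ?X))" using l X by simp
      then obtain d where d: "Amap (Delta \<pi>) (n, l, len ?X) = (?qn, d, ?q ?X)"
        "d \<in> Hom C (Dom C ?qn) (Dom C (?q ?X))" "?q ?X \<cdot> d = ?qn" "?p ?X \<cdot> d = l \<cdot> ?pn"
        using Delta_AmapE[OF \<pi>_simps(1) n len_X _ l(2)] by blast
      have td: "t x \<cdot> d \<in> Hom C (Dom C ?qn) (Dom C (pb1 ?b x))"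
        by (rule Comp_Hom[OF d(2) t(1)[OF x]])
      have "pb1 ?b x \<cdot> (t x \<cdot> d) = (pb1 ?b x \<cdot> t x) \<cdot> d" "pb2 ?b x \<cdot> (t x \<cdot> d) = (pb2 ?b x \<cdot> t x) \<cdot> d"
        using t(1)[OF x] d(2) pb_simps[OF b(1) x] by (simp_all add: hom_iff)
      then have "pb1 ?b x \<cdot> (t x \<cdot> d) = pb1 ?b x \<cdot> h" "pb2 ?b x \<cdot> (t x \<cdot> d) = ?e ?X \<cdot> d"
        unfolding t(2,3)[OF x] d(3) h(2) by simp_all
      then have "t x \<cdot> d = h \<longleftrightarrow> ?e ?X \<cdot> d = v"
        using pb_eqI[OF b(1) x td h(1)] unfolding v_def by auto
      moreover have "?e ?X \<cdot> d = v \<longleftrightarrow> is_entry ?X ((Id C (L C ?X) \<cdot> l) \<cdot> ?pn) (ind \<cdot> ?qn) v"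
      proof (rule entries_Delta_eq_iff[OF X Id_Hom[OF L_Obj[OF X]] l(1) _ _ _ _ v])
        show "n = len ?X \<cdot> (Id C (L C ?X) \<cdot> l)" using l by (auto simp: hom_iff)
      qed (use d lenI[OF X] in simp_all)
      moreover have "Id C (L C ?X) \<cdot> l = l" using l(1) by (simp add: hom_iff)
      ultimately show ?thesis unfolding d(1) kh by simp
    qed
    obtain l where l: "l \<in> Hom C ?Y (L C ?X)" "len ?X \<cdot> l = n" "is_entry ?X (l \<cdot> ?pn) (ind \<cdot> ?qn) v"
      and l_unique: "\<And>l'. l' \<in> Hom C ?Y (L C ?X) \<Longrightarrow> len ?X \<cdot> l' = n \<Longrightarrow>
        is_entry ?X (l' \<cdot> ?pn) (ind \<cdot> ?qn) v \<Longrightarrow> l' = l"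
      using ex1_list[OF X nY v] by blast
    have O: "Omap len_functor x = len ?X" by (simp add: len_functor_def)
    show "\<exists>!u. u \<in> Hom (slice C N) n (Omap len_functor x) \<and>
        ?\<tau> x \<cdot>\<^bsub>slice C E\<^esub> Amap (Delta \<pi>) u = k"
      unfolding O
    proof (rule ex1I[of _ "(n, l, len ?X)"], intro conjI)
      show "(n, l, len ?X) \<in> Hom (slice C N) n (len ?X)"
        using n X l by (simp add: slice_Hom_iff)
      show "?\<tau> x \<cdot>\<^bsub>slice C E\<^esub> Amap (Delta \<pi>) (n, l, len ?X) = k"
        unfolding iff[OF l(1,2)] by (rule l(3))
    next
      fix u assume u: "u \<in> Hom (slice C N) n (len ?X) \<and> ?\<tau> x \<cdot>\<^bsub>slice C E\<^esub> Amap (Delta \<pi>) u = k"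
      then obtain l' where u': "u = (n, l', len ?X)" and l': "l' \<in> Hom C ?Y (L C ?X)" "len ?X \<cdot> l' = n"
        using X by (elim conjE slice_HomE) simp
      have "is_entry ?X (l' \<cdot> ?pn) (ind \<cdot> ?qn) v"
        using u iff[OF l'] unfolding u' by blast
      from l_unique[OF l' this] show "u = (n, l, len ?X)" unfolding u' by simp
    qed
  next
    fix f x y assume "f \<in> Hom (slice C (One C)) x y"
    then obtain h where fh: "f = (x, h, y)" and x: "x \<in> Arr C" "Cod C x = Cod C ?b"
      and y: "y \<in> Arr C" "Cod C y = Cod C ?b" and h: "h \<in> Hom C (Dom C x) (Dom C y)" "y \<cdot> h = x"
      by (elim slice_HomE) simp
    let ?X = "Dom C x" and ?Y = "Dom C y"
    have X: "?X \<in> Obj C" and Y: "?Y \<in> Obj C" using x y by simp_all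
    have h': "h \<in> Arr C" "Dom C h = ?X" "Cod C h = ?Y" using h by (auto simp: hom_iff)
    have lX: "len ?X \<in> Arr C" "Cod C (len ?X) = Cod C \<pi>" and lY: "len ?Y \<in> Arr C" "Cod C (len ?Y) = Cod C \<pi>"
      using X Y by simp_all
    have "list_arr C h \<in> Hom C (Dom C (len ?X)) (Dom C (len ?Y))" using h' X Y by (simp add: hom_iff)
    then obtain d where d: "Amap (Delta \<pi>) (len ?X, list_arr C h, len ?Y) = (?q ?X, d, ?q ?Y)"
      "d \<in> Hom C (Dom C (?q ?X)) (Dom C (?q ?Y))" "?q ?Y \<cdot> d = ?q ?X" "?p ?Y \<cdot> d = list_arr C h \<cdot> ?p ?X"
      using Delta_AmapE[OF \<pi>_simps(1) lX lY _ len_list_arr[OF h(1)]] by blast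
    obtain d' where d': "Amap (Delta ?b) (x, h, y) = (pb1 ?b x, d', pb1 ?b y)"
      "d' \<in> Hom C (Dom C (pb1 ?b x)) (Dom C (pb1 ?b y))" "pb1 ?b y \<cdot> d' = pb1 ?b x" "pb2 ?b y \<cdot> d' = h \<cdot> pb2 ?b x"
      using Delta_AmapE[OF b(1) x y h] by blast
    have "t y \<cdot> d = d' \<cdot> t x"
    proof (rule pb_eqI[OF b(1) y])
      show "t y \<cdot> d \<in> Hom C (Dom C (?q ?X)) (Dom C (pb1 ?b y))" by (rule Comp_Hom[OF d(2) t(1)[OF y]])
      show "d' \<cdot> t x \<in> Hom C (Dom C (?q ?X)) (Dom C (pb1 ?b y))" by (rule Comp_Hom[OF t(1)[OF x] d'(2)])
      have a: "pb1 ?b y \<cdot> (t y \<cdot> d) = (pb1 ?b y \<cdot> t y) \<cdot> d" "pb2 ?b y \<cdot> (t y \<cdot> d) = (pb2 ?b y \<cdot> t y) \<cdot> d"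
        "pb1 ?b y \<cdot> (d' \<cdot> t x) = (pb1 ?b y \<cdot> d') \<cdot> t x" "pb2 ?b y \<cdot> (d' \<cdot> t x) = (pb2 ?b y \<cdot> d') \<cdot> t x"
        "(h \<cdot> pb2 ?b x) \<cdot> t x = h \<cdot> (pb2 ?b x \<cdot> t x)"
        using t(1)[OF x] t(1)[OF y] d(2) d'(2) h' pb_simps[OF b(1) y] pb_simps[OF b(1) x]
        by (simp_all add: hom_iff)
      show "pb1 ?b y \<cdot> (t y \<cdot> d) = pb1 ?b y \<cdot> (d' \<cdot> t x)"
        unfolding a t(2)[OF x] t(2)[OF y] d(3) d'(3) by (rule refl)
      note eX = e[OF X]
      have 1: "list_arr C h \<cdot> ?p ?X \<in> Hom C (Dom C (?q ?X)) (L C ?Y)" "ind \<cdot> ?q ?X \<in> Hom C (Dom C (?q ?X)) N"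
        using eX(3,4) h' Y by (auto simp: hom_iff)
      have he: "h \<cdot> ?e ?X \<in> Hom C (Dom C (?q ?X)) ?Y" by (rule Comp_Hom[OF eX(1) h(1)])
      \<comment> \<open>Naturality in \<open>X\<close>: by \<open>is_entry_list_arr\<close>,
        evaluating after \<open>list_arr C h\<close> gives the images under \<open>h\<close> of the
        entries.\<close>
      have "?e ?Y \<cdot> d = h \<cdot> ?e ?X"
      proof (rule iffD2[OF entries_Delta_eq_iff[OF Y Id_Hom[OF L_Obj[OF Y]] _ _ _ _ _ he]])
        show "list_arr C h \<in> Hom C (L C ?X) (L C ?Y)" using h' by (simp add: hom_iff X Y)
        have I: "Id C (L C ?Y) \<cdot> list_arr C h = list_arr C h" using h' by simp
        show "len ?X = len ?Y \<cdot> (Id C (L C ?Y) \<cdot> list_arr C h)"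
          unfolding I len_list_arr[OF h(1)] by (rule refl)
        show "is_entry ?Y ((Id C (L C ?Y) \<cdot> list_arr C h) \<cdot> ?p ?X) (ind \<cdot> ?q ?X) (h \<cdot> ?e ?X)"
          unfolding I by (rule is_entry_list_arr[OF eX(2) h(1) eX(4) 1(2) eX(1)])
      qed (use d lenI[OF Y] in simp_all)
      then show "pb2 ?b y \<cdot> (t y \<cdot> d) = pb2 ?b y \<cdot> (d' \<cdot> t x)"
        unfolding a d'(4) t(3)[OF x] t(3)[OF y] .
    qed
    then show "?\<tau> y \<cdot>\<^bsub>slice C E\<^esub> Amap (Delta \<pi>) (Amap len_functor f) = Amap (Delta ?b) f \<cdot>\<^bsub>slice C E\<^esub> ?\<tau> x"
      unfolding fh by (simp add: len_functor_def d(1) d'(1))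
  qed
qed

lemmas over_One_defs =
  over_One_def to_slice_One_def from_slice_One_def list_functor_def comp_functor_def

lemma over_One_list_functor_iso:
  "naturally_isomorphic (slice C (One C)) (slice C (One C)) (over_One C (list_functor C))
    (Sigma_functor C (bang C N) \<circ>\<^sub>F Pi \<circ>\<^sub>F Delta (bang C E))"
proof -
  let ?S = "Sigma_functor C (bang C N)"
  have S: "is_functor (slice C N) (slice C (One C)) ?S"
    using Sigma_functor_functor[of "bang C N"] by simp
  have "naturally_isomorphic (slice C (One C)) (slice C (One C)) (over_One C (list_functor C))
    (?S \<circ>\<^sub>F (Pi \<circ>\<^sub>F Delta (bang C E)))"
  proof (rule naturally_isomorphic_cong[OF naturally_isomorphic_postcomp[OF len_functor_iso_Pi_Delta S]])
    fix x assume "x \<in> Obj (slice C (One C))"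
    then show "Omap (over_One C (list_functor C)) x = Omap (?S \<circ>\<^sub>F len_functor) x"
      by (simp add: over_One_defs Sigma_functor_def len_functor_def)
  next
    fix f assume "f \<in> Arr (slice C (One C))"
    then show "Amap (over_One C (list_functor C)) f = Amap (?S \<circ>\<^sub>F len_functor) f"
      by (auto simp: over_One_defs Sigma_functor_def len_functor_def slice_def hom_iff)
  qed
  then show ?thesis by (simp add: comp_functor_def o_assoc)
qed

text \<open>Transport along the identification of the slice over \<open>1\<close> with
  \<open>C\<close>. Going there and back returns \<open>list_functor C\<close> on the nose, on
  objects and on arrows, so \<open>naturally_isomorphic_cong\<close> suffices.\<close>

lemma list_functor_iso:
  "naturally_isomorphic C C (list_functor C)
    (Sigma_obj C N \<circ>\<^sub>F Pi \<circ>\<^sub>F (Delta (bang C E) \<circ>\<^sub>F to_slice_One C))"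
proof -
  let ?G = "Sigma_functor C (bang C N) \<circ>\<^sub>F Pi \<circ>\<^sub>F Delta (bang C E)"
  have "naturally_isomorphic C C (list_functor C) (from_slice_One C \<circ>\<^sub>F ?G \<circ>\<^sub>F to_slice_One C)"
  proof (rule naturally_isomorphic_cong[OF naturally_isomorphic_precomp[OF
          naturally_isomorphic_postcomp[OF over_One_list_functor_iso from_slice_One_functor] to_slice_One_functor]])
    fix X assume "X \<in> Obj C"
    then show "Omap (list_functor C) X =
        Omap (from_slice_One C \<circ>\<^sub>F over_One C (list_functor C) \<circ>\<^sub>F to_slice_One C) X"
      by (simp add: over_One_defs)
  next
    fix f assume "f \<in> Arr C"
    then show "Amap (list_functor C) f =
        Amap (from_slice_One C \<circ>\<^sub>F over_One C (list_functor C) \<circ>\<^sub>F to_slice_One C) f"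
      by (simp add: over_One_defs)
  qed
  then show ?thesis by (simp add: Sigma_obj_def comp_functor_def o_assoc)
qed

end

theorem theorem1p1:
  fixes C :: "('o, 'a) list_category" and E :: 'o and \<epsilon> \<pi> :: 'a
  assumes "extensive_category C"
    and "parametrized_list_category C"
    and "is_less_than_object C E \<epsilon>"
    and "\<pi> = Snd C (NN C) (NN C) \<cdot>\<^bsub>C\<^esub> \<epsilon>"
  shows "represents C (bang C E) \<pi> (bang C (NN C)) (over_One C (list_functor C)) \<and>
    (\<exists>\<Delta> \<Pi>. is_Delta_obj C E \<Delta> \<and> is_Pi C \<pi> \<Pi> \<and>
       naturally_isomorphic C C (list_functor C) (Sigma_obj C (NN C) \<circ>\<^sub>F \<Pi> \<circ>\<^sub>F \<Delta>))"
proof -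
  interpret less_than_object C E \<epsilon>
    using assms by (simp add: less_than_object_def less_than_object_axioms_def extensive_list_category_def)
  have \<pi>: "\<pi> = less_than_object.\<pi> C \<epsilon>" using assms(4) \<pi>_def by simp
  have "is_Delta C (bang C E) (Delta (bang C E))" by (rule Delta_is_Delta) simp
  then show ?thesis
    unfolding represents_def is_Delta_obj_def \<pi>
    using Pi_is_Pi over_One_list_functor_iso list_functor_iso by auto
qed

end
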